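(* Let $\Lambda$ be a periodic single-vertex $2$-graph, with vertex $v$, with $2\le|\Lambda^{e_1}|<\infty$ and $2\le|\Lambda^{e_2}|<\infty$. Let $(a,-b)$, with $a,b$ positive integers, be the generator of $\mathrm{Per}(\Lambda)$, and let $h:\Lambda^{ae_1}\to\Lambda^{be_2}$ be the bijection satisfying $\mu\nu=h(\mu)h^{-1}(\nu)$ for all $\mu\in\Lambda^{ae_1}$, $\nu\in\Lambda^{be_2}$. Let $\{D_v,R_\mu,f_\mu\}_{\mu\in\Lambda^{e_1}\cup\Lambda^{e_2}}$ be a $\Lambda$-branching system on a measure space $(X,\eta)$ such that $\eta(D_v)\neq 0$, and let $\pi:C^*(\Lambda)\to B(L^2(X,\eta))$ be the representation induced from the branching system. Suppose that for every finite subset $\mathcal{F}$ of $\mathbb{Z}\setminus\{0\}$ there exist $\mu\in\Lambda^{ae_1}$ and a measurable subset $E$ of $f_\mu(D_v)$ such that $\eta(E)\ne 0$ and $(f_\mu\circ f_{h(\mu)}^{-1})^n(E)\cap E=\emptyset$ $\eta$-a.e. for all $n\in\mathcal{F}$. Then $\pi$ is faithful.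
   Context: $\mathbb{N}=\{0,1,2,\dots\}$; $e_1,e_2$ is the standard basis of $\mathbb{N}^2$. All measure spaces are assumed $\sigma$-finite. A $2$-graph is a countable small category $\Lambda$ (identified with its set of morphisms, with range and source maps $r,s$, composites $\mu\nu$ defined when $s(\mu)=r(\nu)$) together with a functor $d:\Lambda\to\mathbb{N}^2$ with the factorization property: whenever $d(\mu)=n+m$ there are unique $\nu,\alpha\in\Lambda$ with $d(\nu)=n$, $d(\alpha)=m$, $s(\nu)=r(\alpha)$, $\mu=\nu\alpha$. Put $\Lambda^n:=d^{-1}(n)$; $\Lambda^0$ is identified with the set of objects (vertices), and $\Lambda$ is single-vertex if $\Lambda^0=\{v\}$ has one element. Paths of degree $ae_1$ (resp. $be_2$) are identified with words of length $a$ in $\Lambda^{e_1}$ (resp. of length $b$ in $\Lambda^{e_2}$). Infinite paths: let $\Omega=\{(p,q)\in\mathbb{N}^2\times\mathbb{N}^2:p\le q\}$, a $2$-graph with $(p,q)(q,m)=(p,m)$, $r(p,q)=(p,p)$, $s(p,q)=(q,q)$, $d(p,q)=q-p$. $\Lambda^\infty$ is the set of degree-preserving functors $x:\Omega\to\Lambda$. For $m\in\mathbb{N}^2$, $\sigma^m(x)(p,q)=x(p+m,q+m)$; for $\mu\in\Lambda$ with $s(\mu)=x(0,0)$, $\mu x$ is the unique infinite path with $(\mu x)(0,d(\mu))=\mu$ and $\sigma^{d(\mu)}(\mu x)=x$. The single-vertex $2$-graph $\Lambda$ is aperiodic if there is $x\in\Lambda^\infty$ with $\sigma^n(x)\ne\sigma^m(x)$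 for all $n\ne m$ in $\mathbb{N}^2$; it is periodic if it is not aperiodic. A pair $(\mu,\nu)\in\Lambda\times\Lambda$ is a cycline pair if $s(\mu)=s(\nu)$ and $\mu x=\nu x$ for all $x\in\Lambda^\infty$ with $x(0,0)=s(\mu)$. $\mathrm{Per}(\Lambda):=\{d(\mu)-d(\nu):(\mu,\nu)\text{ is a cycline pair}\}$. It is known (Davidson–Yang) that for $\Lambda$ periodic as in the statement, $\mathrm{Per}(\Lambda)=\mathbb{Z}(a,-b)$ for some positive integers $a,b$, and that a bijection $h$ as in the statement exists (each $(\mu,h(\mu))$ being a cycline pair). $C^*(\Lambda)$ is the universal C*-algebra generated by partial isometries $\{s_\mu\}_{\mu\in\Lambda}$ such that $s_v$ is a projection; $s_{\mu\nu}=s_\mu s_\nu$ for all $\mu,\nu$; $s_\mu^*s_\mu=s_v$ for all $\mu$; and $s_v=\sum_{\mu\in\Lambda^n}s_\mu s_\mu^*$ for all $n\in\mathbb{N}^2$. For such $\Lambda$, a $\Lambda$-branching system on $(X,\eta)$ is a family $\{D_v,R_\mu,f_\mu\}_{\mu\in\Lambda^{e_1}\cup\Lambda^{e_2}}$ with $D_v,R_\mu\subseteq X$ measurable such that: (1) $R_\mu\cap R_\nu=\emptyset$ $\eta$-a.e. if $\mu\ne\nu$ are both in $\Lambda^{e_i}$ for some $i\in\{1,2\}$; (2) for each $\mu\in\Lambda^{e_1}\cup\Lambda^{e_2}$ there are measurable maps $f_\mu:D_v\to R_\mu$ and $f_\mu^{-1}:R_\mu\to D_v$ with $f_\mu\circ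 f_\mu^{-1}=\mathrm{id}_{R_\mu}$ and $f_\mu^{-1}\circ f_\mu=\mathrm{id}_{D_v}$ $\eta$-a.e., such that the pushforward measure $\eta\circ f_\mu$ (under $f_\mu^{-1}$) on $D_v$ is absolutely continuous with respect to $\eta$ on $D_v$, and the pushforward measure $\eta\circ f_\mu^{-1}$ (under $f_\mu$) on $R_\mu$ is absolutely continuous with respect to $\eta$ on $R_\mu$; (3) if $\mu,\nu,\alpha,\beta\in\Lambda^{e_1}\cup\Lambda^{e_2}$ and $\mu\nu=\alpha\beta$ then $f_\mu\circ f_\nu=f_\alpha\circ f_\beta$ $\eta$-a.e.; (4) $\bigcup_{\mu\in\Lambda^{e_i}}R_\mu=D_v$ $\eta$-a.e. for $i=1,2$. The induced representation $\pi$ is the unique $*$-homomorphism $C^*(\Lambda)\to B(L^2(X,\eta))$ with $\pi(s_\mu)(\phi)=\Phi_{f_\mu^{-1}}^{1/2}(\phi\circ f_\mu^{-1})$ (extended by $0$ off $R_\mu$), where $\Phi_{f_\mu^{-1}}=d(\eta\circ f_\mu^{-1})/d\eta$, and $\pi(s_v)(\phi)=\chi_{D_v}\phi$, for all $\mu\in\Lambda^{e_1}\cup\Lambda^{e_2}$, $\phi\in L^2(X,\eta)$. For a path $\mu=\mu_1\cdots\mu_n$ with $\mu_i\in\Lambda^{e_1}\cup\Lambda^{e_2}$, $f_\mu:=f_{\mu_1}\circ\cdots\circ f_{\mu_n}$ (well defined a.e. by (3)), with a.e. inverse $f_\mu^{-1}:f_\mu(D_v)\to D_v$. The sets $f_\mu(D_v)$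 and $f_{h(\mu)}(D_v)$ agree up to a null set, so $f_\mu\circ f_{h(\mu)}^{-1}$ is an a.e. defined, a.e. invertible self-map of $f_\mu(D_v)$, and its integer powers (negative ones being powers of the a.e. inverse $f_{h(\mu)}\circ f_\mu^{-1}$) are understood a.e. *)

theory Defs
  imports "HOL-Analysis.Analysis" "HOL-Algebra.Module"
begin

section \<open>2-graphs\<close>

text \<open>
  A small category is identified with its set of morphisms, so \<open>rng\<close> and \<open>src\<close> take values in the
  identity morphisms.  The order, sum and (truncated) difference on \<open>nat \<times> nat\<close> are componentwise.
\<close>

record 'a graded_category =
  mor :: "'a set"
  rng :: "'a \<Rightarrow> 'a"
  src :: "'a \<Rightarrow> 'a"
  cmp :: "'a \<Rightarrow> 'a \<Rightarrow> 'a"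
  deg :: "'a \<Rightarrow> nat \<times> nat"

locale two_graph =
  fixes \<Lambda> :: "'a graded_category"
  assumes countable_mor: "countable (mor \<Lambda>)"
    and rng_closed: "\<mu> \<in> mor \<Lambda> \<Longrightarrow> rng \<Lambda> \<mu> \<in> mor \<Lambda>"
    and src_closed: "\<mu> \<in> mor \<Lambda> \<Longrightarrow> src \<Lambda> \<mu> \<in> mor \<Lambda>"
    and rng_rng: "\<mu> \<in> mor \<Lambda> \<Longrightarrow> rng \<Lambda> (rng \<Lambda> \<mu>) = rng \<Lambda> \<mu>"
    and src_rng: "\<mu> \<in> mor \<Lambda> \<Longrightarrow> src \<Lambda> (rng \<Lambda> \<mu>) = rng \<Lambda> \<mu>"
    and rng_src: "\<mu> \<in> mor \<Lambda> \<Longrightarrow> rng \<Lambda> (src \<Lambda> \<mu>) = src \<Lambda> \<mu>"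
    and src_src: "\<mu> \<in> mor \<Lambda> \<Longrightarrow> src \<Lambda> (src \<Lambda> \<mu>) = src \<Lambda> \<mu>"
    and cmp_closed: "\<lbrakk>\<mu> \<in> mor \<Lambda>; \<nu> \<in> mor \<Lambda>; src \<Lambda> \<mu> = rng \<Lambda> \<nu>\<rbrakk> \<Longrightarrow> cmp \<Lambda> \<mu> \<nu> \<in> mor \<Lambda>"
    and rng_cmp: "\<lbrakk>\<mu> \<in> mor \<Lambda>; \<nu> \<in> mor \<Lambda>; src \<Lambda> \<mu> = rng \<Lambda> \<nu>\<rbrakk> \<Longrightarrow> rng \<Lambda> (cmp \<Lambda> \<mu> \<nu>) = rng \<Lambda> \<mu>"
    and src_cmp: "\<lbrakk>\<mu> \<in> mor \<Lambda>; \<nu> \<in> mor \<Lambda>; src \<Lambda> \<mu> = rng \<Lambda> \<nu>\<rbrakk> \<Longrightarrow> src \<Lambda> (cmp \<Lambda> \<mu> \<nu>) = src \<Lambda> \<nu>"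
    and cmp_assoc: "\<lbrakk>\<mu> \<in> mor \<Lambda>; \<nu> \<in> mor \<Lambda>; \<alpha> \<in> mor \<Lambda>; src \<Lambda> \<mu> = rng \<Lambda> \<nu>; src \<Lambda> \<nu> = rng \<Lambda> \<alpha>\<rbrakk>
      \<Longrightarrow> cmp \<Lambda> (cmp \<Lambda> \<mu> \<nu>) \<alpha> = cmp \<Lambda> \<mu> (cmp \<Lambda> \<nu> \<alpha>)"
    and cmp_id_left: "\<mu> \<in> mor \<Lambda> \<Longrightarrow> cmp \<Lambda> (rng \<Lambda> \<mu>) \<mu> = \<mu>"
    and cmp_id_right: "\<mu> \<in> mor \<Lambda> \<Longrightarrow> cmp \<Lambda> \<mu> (src \<Lambda> \<mu>) = \<mu>"
    and deg_id: "\<mu> \<in> mor \<Lambda> \<Longrightarrow> deg \<Lambda> (rng \<Lambda> \<mu>) = 0"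
    and deg_cmp: "\<lbrakk>\<mu> \<in> mor \<Lambda>; \<nu> \<in> mor \<Lambda>; src \<Lambda> \<mu> = rng \<Lambda> \<nu>\<rbrakk>
      \<Longrightarrow> deg \<Lambda> (cmp \<Lambda> \<mu> \<nu>) = deg \<Lambda> \<mu> + deg \<Lambda> \<nu>"
    and factorization: "\<lbrakk>\<mu> \<in> mor \<Lambda>; deg \<Lambda> \<mu> = n + m\<rbrakk>
      \<Longrightarrow> \<exists>!(\<nu>, \<alpha>). \<nu> \<in> mor \<Lambda> \<and> \<alpha> \<in> mor \<Lambda> \<and> deg \<Lambda> \<nu> = n \<and> deg \<Lambda> \<alpha> = m
            \<and> src \<Lambda> \<nu> = rng \<Lambda> \<alpha> \<and> \<mu> = cmp \<Lambda> \<nu> \<alpha>"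

definition paths :: "'a graded_category \<Rightarrow> nat \<times> nat \<Rightarrow> 'a set" where
  "paths \<Lambda> n = {\<mu> \<in> mor \<Lambda>. deg \<Lambda> \<mu> = n}"

definition edges :: "'a graded_category \<Rightarrow> 'a set" where
  "edges \<Lambda> = paths \<Lambda> (1, 0) \<union> paths \<Lambda> (0, 1)"

definition Omega :: "((nat \<times> nat) \<times> (nat \<times> nat)) graded_category" where
  "Omega = \<lparr>mor = {(p, q). p \<le> q}, rng = (\<lambda>(p, q). (p, p)), src = (\<lambda>(p, q). (q, q)),
            cmp = (\<lambda>(p, _) (_, m). (p, m)), deg = (\<lambda>(p, q). q - p)\<rparr>"

text \<open>Infinite paths are extensional (\<open>undefined\<close> off \<open>Omega\<close>), so HOL equality is equality of functors.\<close>

definition infinite_paths :: "'a graded_category \<Rightarrow> ((nat \<times> nat) \<times> (nat \<times> nat) \<Rightarrow> 'a) set" where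
  "infinite_paths \<Lambda> = {x \<in> mor Omega \<rightarrow>\<^sub>E mor \<Lambda>.
     (\<forall>w \<in> mor Omega. rng \<Lambda> (x w) = x (rng Omega w) \<and> src \<Lambda> (x w) = x (src Omega w)
        \<and> deg \<Lambda> (x w) = deg Omega w) \<and>
     (\<forall>w \<in> mor Omega. \<forall>w' \<in> mor Omega. src Omega w = rng Omega w' \<longrightarrow>
        x (cmp Omega w w') = cmp \<Lambda> (x w) (x w'))}"

definition shift ::
    "nat \<times> nat \<Rightarrow> ((nat \<times> nat) \<times> (nat \<times> nat) \<Rightarrow> 'a) \<Rightarrow> ((nat \<times> nat) \<times> (nat \<times> nat) \<Rightarrow> 'a)" where
  "shift m x = (\<lambda>(p, q) \<in> mor Omega. x (p + m, q + m))"

definition prepend :: "'a graded_category \<Rightarrow> 'a \<Rightarrow> ((nat \<times> nat) \<times> (nat \<times> nat) \<Rightarrow> 'a)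
    \<Rightarrow> ((nat \<times> nat) \<times> (nat \<times> nat) \<Rightarrow> 'a)" where
  "prepend \<Lambda> \<mu> x = (THE y. y \<in> infinite_paths \<Lambda> \<and> y (0, deg \<Lambda> \<mu>) = \<mu> \<and> shift (deg \<Lambda> \<mu>) y = x)"

text \<open>This notion of aperiodicity is the one for single-vertex 2-graphs.\<close>

definition aperiodic :: "'a graded_category \<Rightarrow> bool" where
  "aperiodic \<Lambda> \<longleftrightarrow> (\<exists>x \<in> infinite_paths \<Lambda>. \<forall>n m. n \<noteq> m \<longrightarrow> shift n x \<noteq> shift m x)"

definition periodic :: "'a graded_category \<Rightarrow> bool" where
  "periodic \<Lambda> \<longleftrightarrow> \<not> aperiodic \<Lambda>"

definition cycline_pair :: "'a graded_category \<Rightarrow> 'a \<Rightarrow> 'a \<Rightarrow> bool" where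
  "cycline_pair \<Lambda> \<mu> \<nu> \<longleftrightarrow> \<mu> \<in> mor \<Lambda> \<and> \<nu> \<in> mor \<Lambda> \<and> src \<Lambda> \<mu> = src \<Lambda> \<nu> \<and>
     (\<forall>x \<in> infinite_paths \<Lambda>. x (0, 0) = src \<Lambda> \<mu> \<longrightarrow> prepend \<Lambda> \<mu> x = prepend \<Lambda> \<nu> x)"

definition Per :: "'a graded_category \<Rightarrow> (int \<times> int) set" where
  "Per \<Lambda> = {(int (fst (deg \<Lambda> \<mu>)) - int (fst (deg \<Lambda> \<nu>)), int (snd (deg \<Lambda> \<mu>)) - int (snd (deg \<Lambda> \<nu>)))
     | \<mu> \<nu>. cycline_pair \<Lambda> \<mu> \<nu>}"


section \<open>C*-algebras\<close>

definition complex_field :: "complex ring" where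
  "complex_field = \<lparr>carrier = UNIV, mult = (*), one = 1, zero = 0, add = (+)\<rparr>"

text \<open>
  C*-algebras need not be unital: as for \<open>module\<close>, no axiom mentions the field \<open>one\<close>.
\<close>

record 'c cstar = "(complex, 'c) module" +
  star :: "'c \<Rightarrow> 'c"
  nrm :: "'c \<Rightarrow> real"

locale c_star_algebra =
  fixes B :: "'c cstar" (structure)
  assumes is_module: "Module.module complex_field B"
    and mult_closed: "\<lbrakk>x \<in> carrier B; y \<in> carrier B\<rbrakk> \<Longrightarrow> x \<otimes> y \<in> carrier B"
    and mult_assoc: "\<lbrakk>x \<in> carrier B; y \<in> carrier B; z \<in> carrier B\<rbrakk> \<Longrightarrow> (x \<otimes> y) \<otimes> z = x \<otimes> (y \<otimes> z)"
    and distr_left: "\<lbrakk>x \<in> carrier B; y \<in> carrier B; z \<in> carrier B\<rbrakk>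
      \<Longrightarrow> (x \<oplus> y) \<otimes> z = (x \<otimes> z) \<oplus> (y \<otimes> z)"
    and distr_right: "\<lbrakk>x \<in> carrier B; y \<in> carrier B; z \<in> carrier B\<rbrakk>
      \<Longrightarrow> x \<otimes> (y \<oplus> z) = (x \<otimes> y) \<oplus> (x \<otimes> z)"
    and smult_mult_left: "\<lbrakk>x \<in> carrier B; y \<in> carrier B\<rbrakk> \<Longrightarrow> (c \<odot> x) \<otimes> y = c \<odot> (x \<otimes> y)"
    and smult_mult_right: "\<lbrakk>x \<in> carrier B; y \<in> carrier B\<rbrakk> \<Longrightarrow> x \<otimes> (c \<odot> y) = c \<odot> (x \<otimes> y)"
    and star_closed: "x \<in> carrier B \<Longrightarrow> star B x \<in> carrier B"
    and star_star: "x \<in> carrier B \<Longrightarrow> star B (star B x) = x"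
    and star_add: "\<lbrakk>x \<in> carrier B; y \<in> carrier B\<rbrakk> \<Longrightarrow> star B (x \<oplus> y) = star B x \<oplus> star B y"
    and star_smult: "x \<in> carrier B \<Longrightarrow> star B (c \<odot> x) = cnj c \<odot> star B x"
    and star_mult: "\<lbrakk>x \<in> carrier B; y \<in> carrier B\<rbrakk> \<Longrightarrow> star B (x \<otimes> y) = star B y \<otimes> star B x"
    and nrm_zero_iff: "x \<in> carrier B \<Longrightarrow> nrm B x = 0 \<longleftrightarrow> x = \<zero>"
    and nrm_triangle: "\<lbrakk>x \<in> carrier B; y \<in> carrier B\<rbrakk> \<Longrightarrow> nrm B (x \<oplus> y) \<le> nrm B x + nrm B y"
    and nrm_smult: "x \<in> carrier B \<Longrightarrow> nrm B (c \<odot> x) = cmod c * nrm B x"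
    and nrm_mult: "\<lbrakk>x \<in> carrier B; y \<in> carrier B\<rbrakk> \<Longrightarrow> nrm B (x \<otimes> y) \<le> nrm B x * nrm B y"
    and c_star_identity: "x \<in> carrier B \<Longrightarrow> nrm B (star B x \<otimes> x) = (nrm B x)\<^sup>2"
    and complete: "\<lbrakk>\<And>n. u n \<in> carrier B; \<And>e. e > 0 \<Longrightarrow> \<exists>N. \<forall>m\<ge>N. \<forall>n\<ge>N. nrm B (u m \<ominus> u n) < e\<rbrakk>
      \<Longrightarrow> \<exists>l \<in> carrier B. (\<lambda>n. nrm B (u n \<ominus> l)) \<longlonglongrightarrow> 0"

definition star_hom :: "'c cstar \<Rightarrow> 'd cstar \<Rightarrow> ('c \<Rightarrow> 'd) set" where
  "star_hom A B = {\<psi> \<in> carrier A \<rightarrow> carrier B.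
     (\<forall>x \<in> carrier A. \<forall>y \<in> carrier A. \<psi> (x \<oplus>\<^bsub>A\<^esub> y) = \<psi> x \<oplus>\<^bsub>B\<^esub> \<psi> y) \<and>
     (\<forall>c. \<forall>x \<in> carrier A. \<psi> (c \<odot>\<^bsub>A\<^esub> x) = c \<odot>\<^bsub>B\<^esub> \<psi> x) \<and>
     (\<forall>x \<in> carrier A. \<forall>y \<in> carrier A. \<psi> (x \<otimes>\<^bsub>A\<^esub> y) = \<psi> x \<otimes>\<^bsub>B\<^esub> \<psi> y) \<and>
     (\<forall>x \<in> carrier A. \<psi> (star A x) = star B (\<psi> x))}"

definition closed_star_subalgebra :: "'c cstar \<Rightarrow> 'c set \<Rightarrow> bool" where
  "closed_star_subalgebra B S \<longleftrightarrow> S \<subseteq> carrier B \<and> \<zero>\<^bsub>B\<^esub> \<in> S \<and>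
     (\<forall>x \<in> S. \<forall>y \<in> S. x \<oplus>\<^bsub>B\<^esub> y \<in> S \<and> x \<otimes>\<^bsub>B\<^esub> y \<in> S) \<and>
     (\<forall>c. \<forall>x \<in> S. c \<odot>\<^bsub>B\<^esub> x \<in> S) \<and> (\<forall>x \<in> S. star B x \<in> S) \<and>
     (\<forall>u l. (\<forall>n::nat. u n \<in> S) \<and> l \<in> carrier B \<and> (\<lambda>n. nrm B (u n \<ominus>\<^bsub>B\<^esub> l)) \<longlonglongrightarrow> 0 \<longrightarrow> l \<in> S)"


section \<open>The C*-algebra of a single-vertex 2-graph\<close>

text \<open>
  The relations defining the C*-algebra of a 2-graph with one vertex \<open>v\<close>.  The sums are finite when
  both \<open>paths \<Lambda> (1, 0)\<close> and \<open>paths \<Lambda> (0, 1)\<close> are finite; \<open>finsum\<close> over an infinite set is zero.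
\<close>

definition cuntz_krieger_family :: "'a graded_category \<Rightarrow> 'a \<Rightarrow> 'c cstar \<Rightarrow> ('a \<Rightarrow> 'c) \<Rightarrow> bool" where
  "cuntz_krieger_family \<Lambda> v B t \<longleftrightarrow>
     (\<forall>\<mu> \<in> mor \<Lambda>. t \<mu> \<in> carrier B \<and> t \<mu> \<otimes>\<^bsub>B\<^esub> star B (t \<mu>) \<otimes>\<^bsub>B\<^esub> t \<mu> = t \<mu>) \<and>
     star B (t v) = t v \<and> t v \<otimes>\<^bsub>B\<^esub> t v = t v \<and>
     (\<forall>\<mu> \<in> mor \<Lambda>. \<forall>\<nu> \<in> mor \<Lambda>. src \<Lambda> \<mu> = rng \<Lambda> \<nu> \<longrightarrow> t (cmp \<Lambda> \<mu> \<nu>) = t \<mu> \<otimes>\<^bsub>B\<^esub> t \<nu>) \<and>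
     (\<forall>\<mu> \<in> mor \<Lambda>. star B (t \<mu>) \<otimes>\<^bsub>B\<^esub> t \<mu> = t v) \<and>
     (\<forall>n. t v = finsum B (\<lambda>\<mu>. t \<mu> \<otimes>\<^bsub>B\<^esub> star B (t \<mu>)) (paths \<Lambda> n))"

text \<open>
  \<open>A\<close> with the family \<open>s\<close> is the universal C*-algebra generated by a family satisfying the relations.
  The test algebras \<open>B\<close> range over all C*-algebras with carrier in the type of \<open>A\<close>.  This is no
  restriction once \<open>A\<close> is nonzero: \<open>A\<close> then contains a copy of the complex numbers, while the
  C*-subalgebra of an arbitrary C*-algebra generated by a countable family is separable, hence has at most
  continuum many elements and is isomorphic to a C*-algebra with carrier in \<open>'c\<close>.
  Uniqueness of \<open>\<psi>\<close> on the carrier follows from generation.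
\<close>

definition universal_graph_algebra :: "'a graded_category \<Rightarrow> 'a \<Rightarrow> 'c cstar \<Rightarrow> ('a \<Rightarrow> 'c) \<Rightarrow> bool" where
  "universal_graph_algebra \<Lambda> v A s \<longleftrightarrow>
     c_star_algebra A \<and> cuntz_krieger_family \<Lambda> v A s \<and>
     (\<forall>S. closed_star_subalgebra A S \<and> s ` mor \<Lambda> \<subseteq> S \<longrightarrow> S = carrier A) \<and>
     (\<forall>(B :: 'c cstar) t. c_star_algebra B \<and> cuntz_krieger_family \<Lambda> v B t \<longrightarrow>
        (\<exists>\<psi> \<in> star_hom A B. \<forall>\<mu> \<in> mor \<Lambda>. \<psi> (s \<mu>) = t \<mu>))"


section \<open>Bounded operators on \<open>L\<^sup>2\<close>\<close>

text \<open>An inner product space; the fields \<open>mult\<close> and \<open>one\<close> of the module record play no role.\<close>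

record 'h inner_space = "(complex, 'h) module" +
  cinner :: "'h \<Rightarrow> 'h \<Rightarrow> complex"

definition hnorm :: "'h inner_space \<Rightarrow> 'h \<Rightarrow> real" where
  "hnorm H x = sqrt (Re (cinner H x x))"

definition bounded_ops :: "'h inner_space \<Rightarrow> ('h \<Rightarrow> 'h) set" where
  "bounded_ops H = {T \<in> carrier H \<rightarrow>\<^sub>E carrier H.
     (\<forall>x \<in> carrier H. \<forall>y \<in> carrier H. T (x \<oplus>\<^bsub>H\<^esub> y) = T x \<oplus>\<^bsub>H\<^esub> T y) \<and>
     (\<forall>c. \<forall>x \<in> carrier H. T (c \<odot>\<^bsub>H\<^esub> x) = c \<odot>\<^bsub>H\<^esub> T x) \<and>
     (\<exists>K. \<forall>x \<in> carrier H. hnorm H (T x) \<le> K * hnorm H x)}"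

definition operator_algebra :: "'h inner_space \<Rightarrow> ('h \<Rightarrow> 'h) cstar" where
  "operator_algebra H =
     \<lparr>carrier = bounded_ops H,
      mult = compose (carrier H),
      one = (\<lambda>x \<in> carrier H. x),
      zero = (\<lambda>x \<in> carrier H. \<zero>\<^bsub>H\<^esub>),
      add = (\<lambda>S T. \<lambda>x \<in> carrier H. S x \<oplus>\<^bsub>H\<^esub> T x),
      smult = (\<lambda>c T. \<lambda>x \<in> carrier H. c \<odot>\<^bsub>H\<^esub> T x),
      star = (\<lambda>T. THE S. S \<in> bounded_ops H \<and>
                (\<forall>x \<in> carrier H. \<forall>y \<in> carrier H. cinner H (S x) y = cinner H x (T y))),
      nrm = (\<lambda>T. SUP x \<in> {x \<in> carrier H. hnorm H x \<le> 1}. hnorm H (T x))\<rparr>"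

definition l2_functions :: "'x measure \<Rightarrow> ('x \<Rightarrow> complex) set" where
  "l2_functions \<eta> = {\<phi> \<in> borel_measurable \<eta>. integrable \<eta> (\<lambda>x. (cmod (\<phi> x))\<^sup>2)}"

definition l2_class :: "'x measure \<Rightarrow> ('x \<Rightarrow> complex) \<Rightarrow> ('x \<Rightarrow> complex) set" where
  "l2_class \<eta> \<phi> = {\<psi> \<in> l2_functions \<eta>. AE x in \<eta>. \<psi> x = \<phi> x}"

definition l2_rep :: "('x \<Rightarrow> complex) set \<Rightarrow> 'x \<Rightarrow> complex" where
  "l2_rep u = (SOME \<phi>. \<phi> \<in> u)"

definition L2 :: "'x measure \<Rightarrow> ('x \<Rightarrow> complex) set inner_space" where
  "L2 \<eta> =
     \<lparr>carrier = l2_class \<eta> ` l2_functions \<eta>,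
      mult = undefined,
      one = undefined,
      zero = l2_class \<eta> (\<lambda>x. 0),
      add = (\<lambda>u w. l2_class \<eta> (\<lambda>x. l2_rep u x + l2_rep w x)),
      smult = (\<lambda>c u. l2_class \<eta> (\<lambda>x. c * l2_rep u x)),
      cinner = (\<lambda>u w. \<integral>x. l2_rep u x * cnj (l2_rep w x) \<partial>\<eta>)\<rparr>"


section \<open>Branching systems\<close>

text \<open>
  \<open>bdom\<close> is the set attached to the single vertex, \<open>bran \<mu>\<close> the set attached to the edge \<open>\<mu>\<close>;
  \<open>binv \<mu>\<close> is the almost everywhere inverse of \<open>bmap \<mu>\<close>.  The values of \<open>bmap \<mu>\<close> off \<open>bdom\<close> and of
  \<open>binv \<mu>\<close> off \<open>bran \<mu>\<close> are irrelevant.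
\<close>

record ('a, 'x) branching =
  bdom :: "'x set"
  bran :: "'a \<Rightarrow> 'x set"
  bmap :: "'a \<Rightarrow> 'x \<Rightarrow> 'x"
  binv :: "'a \<Rightarrow> 'x \<Rightarrow> 'x"

definition branching_system :: "'a graded_category \<Rightarrow> 'x measure \<Rightarrow> ('a, 'x) branching \<Rightarrow> bool" where
  "branching_system \<Lambda> \<eta> \<B> \<longleftrightarrow>
     bdom \<B> \<in> sets \<eta> \<and> (\<forall>\<mu> \<in> edges \<Lambda>. bran \<B> \<mu> \<in> sets \<eta>) \<and>
     (\<forall>e \<in> {(1, 0), (0, 1)}. \<forall>\<mu> \<in> paths \<Lambda> e. \<forall>\<nu> \<in> paths \<Lambda> e.
        \<mu> \<noteq> \<nu> \<longrightarrow> emeasure \<eta> (bran \<B> \<mu> \<inter> bran \<B> \<nu>) = 0) \<and>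
     (\<forall>\<mu> \<in> edges \<Lambda>.
        let D = restrict_space \<eta> (bdom \<B>); R = restrict_space \<eta> (bran \<B> \<mu>) in
        bmap \<B> \<mu> \<in> D \<rightarrow>\<^sub>M R \<and> binv \<B> \<mu> \<in> R \<rightarrow>\<^sub>M D \<and>
        (AE y in R. bmap \<B> \<mu> (binv \<B> \<mu> y) = y) \<and>
        (AE x in D. binv \<B> \<mu> (bmap \<B> \<mu> x) = x) \<and>
        absolutely_continuous D (distr R D (binv \<B> \<mu>)) \<and>
        absolutely_continuous R (distr D R (bmap \<B> \<mu>))) \<and>
     (\<forall>\<mu> \<in> edges \<Lambda>. \<forall>\<nu> \<in> edges \<Lambda>. \<forall>\<alpha> \<in> edges \<Lambda>. \<forall>\<beta> \<in> edges \<Lambda>.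
        src \<Lambda> \<mu> = rng \<Lambda> \<nu> \<and> src \<Lambda> \<alpha> = rng \<Lambda> \<beta> \<and> cmp \<Lambda> \<mu> \<nu> = cmp \<Lambda> \<alpha> \<beta> \<longrightarrow>
        (AE x in restrict_space \<eta> (bdom \<B>). bmap \<B> \<mu> (bmap \<B> \<nu> x) = bmap \<B> \<alpha> (bmap \<B> \<beta> x))) \<and>
     (\<forall>e \<in> {(1, 0), (0, 1)}. AE x in \<eta>. x \<in> (\<Union>\<mu> \<in> paths \<Lambda> e. bran \<B> \<mu>) \<longleftrightarrow> x \<in> bdom \<B>)"

text \<open>The Radon-Nikodym derivative of \<open>\<eta> \<circ> f\<^sub>\<mu>\<^sup>-\<^sup>1\<close>, the pushforward under \<open>f\<^sub>\<mu>\<close>, on \<open>R\<^sub>\<mu>\<close>.\<close>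

definition branching_density :: "'x measure \<Rightarrow> ('a, 'x) branching \<Rightarrow> 'a \<Rightarrow> 'x \<Rightarrow> real" where
  "branching_density \<eta> \<B> \<mu> y =
     (let D = restrict_space \<eta> (bdom \<B>); R = restrict_space \<eta> (bran \<B> \<mu>)
      in enn2real (RN_deriv R (distr D R (bmap \<B> \<mu>)) y))"

definition induced_representation :: "'a graded_category \<Rightarrow> 'a \<Rightarrow> 'x measure \<Rightarrow> ('a, 'x) branching
    \<Rightarrow> 'c cstar \<Rightarrow> ('a \<Rightarrow> 'c) \<Rightarrow> ('c \<Rightarrow> ('x \<Rightarrow> complex) set \<Rightarrow> ('x \<Rightarrow> complex) set) \<Rightarrow> bool" where
  "induced_representation \<Lambda> v \<eta> \<B> A s \<pi> \<longleftrightarrow>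
     \<pi> \<in> star_hom A (operator_algebra (L2 \<eta>)) \<and>
     (\<forall>\<mu> \<in> edges \<Lambda>. \<forall>\<phi> \<in> l2_functions \<eta>.
        \<pi> (s \<mu>) (l2_class \<eta> \<phi>) = l2_class \<eta> (\<lambda>y. if y \<in> bran \<B> \<mu>
          then complex_of_real (sqrt (branching_density \<eta> \<B> \<mu> y)) * \<phi> (binv \<B> \<mu> y) else 0)) \<and>
     (\<forall>\<phi> \<in> l2_functions \<eta>.
        \<pi> (s v) (l2_class \<eta> \<phi>) = l2_class \<eta> (\<lambda>x. indicator (bdom \<B>) x * \<phi> x))"

text \<open>
  \<open>edge_word \<Lambda> v \<mu>\<close> writes \<open>\<mu>\<close> as a product of edges.  The word is unique if \<open>\<mu>\<close> has degree
  \<open>(a, 0)\<close> or \<open>(0, b)\<close>; in general the maps below depend on its choice only up to null sets.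
\<close>

definition edge_word :: "'a graded_category \<Rightarrow> 'a \<Rightarrow> 'a \<Rightarrow> 'a list" where
  "edge_word \<Lambda> v \<mu> = (SOME ws. set ws \<subseteq> edges \<Lambda> \<and> foldr (cmp \<Lambda>) ws v = \<mu>)"

definition path_map :: "'a graded_category \<Rightarrow> 'a \<Rightarrow> ('a, 'x) branching \<Rightarrow> 'a \<Rightarrow> 'x \<Rightarrow> 'x" where
  "path_map \<Lambda> v \<B> \<mu> = foldr (\<lambda>e F. bmap \<B> e \<circ> F) (edge_word \<Lambda> v \<mu>) id"

definition path_inv :: "'a graded_category \<Rightarrow> 'a \<Rightarrow> ('a, 'x) branching \<Rightarrow> 'a \<Rightarrow> 'x \<Rightarrow> 'x" where
  "path_inv \<Lambda> v \<B> \<mu> = foldr (\<lambda>e F. F \<circ> binv \<B> e) (edge_word \<Lambda> v \<mu>) id"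

text \<open>
  Images of sets.  The maps are only determined almost everywhere, and the pointwise image of a null
  set under them may have positive measure; so the image of a set \<open>S\<close> under an almost everywhere
  invertible map is read as the preimage of \<open>S\<close> under the almost everywhere inverse, which is well
  defined up to null sets.  In particular \<open>path_range \<Lambda> v \<B> \<mu>\<close> is the (measurable) set \<open>f\<^sub>\<mu>(D\<^sub>v)\<close>.
\<close>

definition path_range :: "'a graded_category \<Rightarrow> 'a \<Rightarrow> ('a, 'x) branching \<Rightarrow> 'a \<Rightarrow> 'x set" where
  "path_range \<Lambda> v \<B> \<mu> =
     foldr (\<lambda>e S. {y \<in> bran \<B> e. binv \<B> e y \<in> S}) (edge_word \<Lambda> v \<mu>) (bdom \<B>)"

text \<open>The power \<open>(f\<^sub>\<mu> \<circ> f\<^sub>\<nu>\<^sup>-\<^sup>1)\<^sup>n\<close>, and the image of \<open>E\<close> under it (using \<open>T\<^sup>n(E) = (T\<^sup>-\<^sup>n)\<^sup>-\<^sup>1(E)\<close>).\<close>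

definition transfer_power ::
    "'a graded_category \<Rightarrow> 'a \<Rightarrow> ('a, 'x) branching \<Rightarrow> 'a \<Rightarrow> 'a \<Rightarrow> int \<Rightarrow> 'x \<Rightarrow> 'x" where
  "transfer_power \<Lambda> v \<B> \<mu> \<nu> n =
     (if n \<ge> 0 then (path_map \<Lambda> v \<B> \<mu> \<circ> path_inv \<Lambda> v \<B> \<nu>) ^^ nat n
      else (path_map \<Lambda> v \<B> \<nu> \<circ> path_inv \<Lambda> v \<B> \<mu>) ^^ nat (- n))"

definition transfer_image ::
    "'a graded_category \<Rightarrow> 'a \<Rightarrow> ('a, 'x) branching \<Rightarrow> 'a \<Rightarrow> 'a \<Rightarrow> int \<Rightarrow> 'x set \<Rightarrow> 'x set" where
  "transfer_image \<Lambda> v \<B> \<mu> \<nu> n E =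
     {y \<in> path_range \<Lambda> v \<B> \<mu>. transfer_power \<Lambda> v \<B> \<mu> \<nu> (- n) y \<in> E}"

end

theory Submission
  imports Defs "HOL-Real_Asymp.Real_Asymp"
begin

text \<open>
  Write \<open>A\<^sub>0\<close> for the span of the monomials \<open>s \<mu> (s \<nu>)\<^sup>*\<close>, a dense *-subalgebra graded by the differences
  \<open>deg \<mu> - deg \<nu>\<close> in \<open>\<int>\<^sup>2\<close>.  The proof shows that the norm of every \<open>w\<close> in \<open>A\<^sub>0\<close> is at most the operator
  norm of \<open>\<pi> w\<close> (\<open>nrm_le_op_bound\<close>).  An element of the kernel is a limit of elements of \<open>A\<^sub>0\<close>, and
  faithfulness follows once the operators of these approximants are known to be small
  (\<open>op_bound_gram\<close>, \<open>kernel_trivial\<close>).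

  The comparison of norms rests on the identity \<open>nrm (h\<^sup>n) = (nrm h)\<^sup>n\<close> for self-adjoint \<open>h\<close> and \<open>n = 2\<^sup>k\<close>.
  It turns an inequality between norms with a constant that grows subexponentially in \<open>n\<close> into the same
  inequality with constant one.  The group \<open>\<int>\<^sup>2\<close> has polynomial growth, so the \<open>n\<close>-th power of an element of
  \<open>A\<^sub>0\<close> has only polynomially many homogeneous components, and it suffices to bound each of them
  (\<open>nrm_component_le\<close>).  Replacing \<open>w\<close> by \<open>w\<^sub>m\<^sup>* w\<close> reduces this to the component \<open>w\<^sub>0\<close> of degree zero
  (\<open>nrm_zero_component_le\<close>), which lies in a matrix algebra spanned by the monomials with \<open>\<mu>\<close> and \<open>\<nu>\<close> of
  one degree \<open>q\<close>.

  To recover \<open>w\<^sub>0\<close> from the operator \<open>\<pi> w\<close>, one needs a vector \<open>\<zeta>\<close> such that \<open>\<pi> (s \<mu>) \<zeta>\<close> and \<open>\<pi> (s \<nu>) \<zeta>\<close>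
  are orthogonal whenever \<open>\<nu>\<close> has degree \<open>q\<close> and \<open>\<mu>\<close> has one of finitely many other degrees
  (\<open>separating_vector\<close>): the compression of \<open>\<pi> w\<close> to the span of the \<open>\<pi> (s \<nu>) \<zeta>\<close> is then the matrix of
  \<open>w\<^sub>0\<close>.  If the difference of the degrees is not a period, then \<open>\<mu>\<close> and \<open>\<nu>\<close> are not a cycline pair, and
  both can be prolonged by one path so that the prolongations have no common extension and hence
  orthogonal ranges (\<open>incomparable_extension_exists\<close>).  For the periods \<open>k (a, - b)\<close> one uses
  the unitary \<open>W = \<Sum>\<^sub>\<mu> s \<mu> (s (h \<mu>))\<^sup>*\<close>, which commutes with \<open>s \<rho>\<close> if \<open>\<rho>\<close> has degree \<open>(i a, j b)\<close>, and the
  normal form \<open>s \<rho> = W\<^sup>i s \<nu>\<close> with \<open>\<nu>\<close> of degree \<open>(0, (i + j) b)\<close> (\<open>normal_form\<close>).  These reduce the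
  orthogonality to that of \<open>\<pi> (W\<^sup>k) \<zeta>\<close> and \<open>\<zeta>\<close> for \<open>1 \<le> k \<le> N\<close>.  On \<open>f\<^sub>\<mu>(D\<^sub>v)\<close> the operator
  \<open>\<pi> W\<close> is a weighted composition operator over the map \<open>f\<^sub>\<mu> \<circ> f\<^sub>h\<^sub>(\<^sub>\<mu>\<^sub>)\<^sup>-\<^sup>1\<close>, so the indicator function of a
  set that is disjoint from its images under the first \<open>N\<close> powers of this map is such a vector
  (\<open>wandering_vector\<close>).

  Two facts of C*-algebra theory are obtained by elementary means.  The ranges of the \<open>s \<mu>\<close> of one degree
  are orthogonal because the unit is an extreme point of the unit ball (\<open>unit_extreme\<close>), which takes the place of
  the theory of positive elements.  The operators \<open>\<pi> x\<close> are compared with the elements \<open>x\<close> by means of the geometric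
  series and approximate eigenvectors (\<open>op_bound_gram\<close>).
\<close>

section \<open>Calculus in C*-algebras\<close>

context c_star_algebra
begin

lemma additive_group: "abelian_group B"
  using is_module by (rule module.axioms)

end

sublocale c_star_algebra \<subseteq> abelian_group B
  by (rule additive_group)

context c_star_algebra
begin

lemma smult_closed [simp, intro]: "x \<in> carrier B \<Longrightarrow> c \<odot> x \<in> carrier B"
  using module.smult_closed[OF is_module] by (simp add: complex_field_def)

lemma smult_add_left: "x \<in> carrier B \<Longrightarrow> (c + d) \<odot> x = c \<odot> x \<oplus> d \<odot> x"
  using module.smult_l_distr[OF is_module] by (simp add: complex_field_def)

lemma smult_add_right:
  "\<lbrakk>x \<in> carrier B; y \<in> carrier B\<rbrakk> \<Longrightarrow> c \<odot> (x \<oplus> y) = c \<odot> x \<oplus> c \<odot> y"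
  using module.smult_r_distr[OF is_module] by (simp add: complex_field_def)

lemma smult_smult [simp]: "x \<in> carrier B \<Longrightarrow> c \<odot> (d \<odot> x) = (c * d) \<odot> x"
  using module.smult_assoc1[OF is_module] by (simp add: complex_field_def)

lemma smult_1 [simp]: "x \<in> carrier B \<Longrightarrow> 1 \<odot> x = x"
  using module.smult_one[OF is_module] by (simp add: complex_field_def)

lemma smult_0 [simp]: "x \<in> carrier B \<Longrightarrow> 0 \<odot> x = \<zero>"
  using module.smult_l_null[OF is_module] by (simp add: complex_field_def)

lemma smult_zero [simp]: "c \<odot> \<zero> = \<zero>"
  using module.smult_r_null[OF is_module] by (simp add: complex_field_def)

lemmas closed [simp, intro] = mult_closed star_closed

lemma neg_eq_smult: "x \<in> carrier B \<Longrightarrow> \<ominus> x = (- 1) \<odot> x"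
  by (rule minus_equality) (use smult_add_left[of x "-1" 1] in auto)

lemma minus_eq_smult: "\<lbrakk>x \<in> carrier B; y \<in> carrier B\<rbrakk> \<Longrightarrow> x \<ominus> y = x \<oplus> (- 1) \<odot> y"
  by (simp add: minus_eq neg_eq_smult)

lemma mult_zero_left [simp]: "x \<in> carrier B \<Longrightarrow> \<zero> \<otimes> x = \<zero>"
  using smult_mult_left[of \<zero> x 0] by simp

lemma mult_zero_right [simp]: "x \<in> carrier B \<Longrightarrow> x \<otimes> \<zero> = \<zero>"
  using smult_mult_right[of x \<zero> 0] by simp

lemma star_zero [simp]: "star B \<zero> = \<zero>"
  using star_smult[of \<zero> 0] by simp

lemma minus_mult_left:
  "\<lbrakk>x \<in> carrier B; y \<in> carrier B; z \<in> carrier B\<rbrakk> \<Longrightarrow> (x \<ominus> y) \<otimes> z = x \<otimes> z \<ominus> y \<otimes> z"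
  by (simp add: minus_eq_smult distr_left smult_mult_left)

lemma minus_mult_right:
  "\<lbrakk>x \<in> carrier B; y \<in> carrier B; z \<in> carrier B\<rbrakk> \<Longrightarrow> x \<otimes> (y \<ominus> z) = x \<otimes> y \<ominus> x \<otimes> z"
  by (simp add: minus_eq_smult distr_right smult_mult_right)

lemma star_minus: "\<lbrakk>x \<in> carrier B; y \<in> carrier B\<rbrakk> \<Longrightarrow> star B (x \<ominus> y) = star B x \<ominus> star B y"
  by (simp add: minus_eq_smult star_add star_smult)

lemma smult_minus: "\<lbrakk>x \<in> carrier B; y \<in> carrier B\<rbrakk> \<Longrightarrow> c \<odot> (x \<ominus> y) = c \<odot> x \<ominus> c \<odot> y"
  by (simp add: minus_eq_smult smult_add_right)

lemma minus_self [simp]: "x \<in> carrier B \<Longrightarrow> x \<ominus> x = \<zero>"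
  by (simp add: minus_eq r_neg)

lemma minus_zero_right [simp]: "x \<in> carrier B \<Longrightarrow> x \<ominus> \<zero> = x"
  by (simp add: minus_eq_smult)

lemma minus_add_cancel: "\<lbrakk>x \<in> carrier B; y \<in> carrier B\<rbrakk> \<Longrightarrow> (x \<ominus> y) \<oplus> y = x"
  by (simp add: minus_eq a_assoc l_neg)

lemma minus_eq_zero_iff: "\<lbrakk>x \<in> carrier B; y \<in> carrier B\<rbrakk> \<Longrightarrow> x \<ominus> y = \<zero> \<longleftrightarrow> x = y"
  by (metis minus_add_cancel l_zero minus_self)

lemma minus_minus_telescope:
  "\<lbrakk>x \<in> carrier B; y \<in> carrier B; z \<in> carrier B\<rbrakk> \<Longrightarrow> (x \<ominus> y) \<oplus> (y \<ominus> z) = x \<ominus> z"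
  by (metis a_assoc minus_add_cancel minus_closed minus_eq a_inv_closed)

lemma nrm_zero [simp]: "nrm B \<zero> = 0"
  by (simp add: nrm_zero_iff)

lemma nrm_neg [simp]: "x \<in> carrier B \<Longrightarrow> nrm B (\<ominus> x) = nrm B x"
  by (simp add: neg_eq_smult nrm_smult)

lemma nrm_minus_commute:
  "\<lbrakk>x \<in> carrier B; y \<in> carrier B\<rbrakk> \<Longrightarrow> nrm B (x \<ominus> y) = nrm B (y \<ominus> x)"
proof -
  assume "x \<in> carrier B" "y \<in> carrier B"
  then have "x \<ominus> y = (- 1) \<odot> (y \<ominus> x)"
    by (simp add: minus_eq_smult smult_add_right a_comm)
  then show ?thesis using \<open>x \<in> carrier B\<close> \<open>y \<in> carrier B\<close> by (simp add: nrm_smult)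
qed

lemma nrm_minus_le: "\<lbrakk>x \<in> carrier B; y \<in> carrier B\<rbrakk> \<Longrightarrow> nrm B (x \<ominus> y) \<le> nrm B x + nrm B y"
  using nrm_triangle[of x "\<ominus> y"] by (simp add: minus_eq)

lemma nrm_nonneg [simp]: "x \<in> carrier B \<Longrightarrow> 0 \<le> nrm B x"
  using nrm_minus_le[of x x] by simp

lemma nrm_le_add_minus:
  "\<lbrakk>x \<in> carrier B; y \<in> carrier B\<rbrakk> \<Longrightarrow> nrm B x \<le> nrm B (x \<ominus> y) + nrm B y"
  using nrm_triangle[of "x \<ominus> y" y] by (simp add: minus_add_cancel)

lemma nrm_star [simp]: "x \<in> carrier B \<Longrightarrow> nrm B (star B x) = nrm B x"
proof -
  have le: "nrm B x \<le> nrm B (star B x)" if x: "x \<in> carrier B" for x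
  proof (cases "nrm B x = 0")
    case False
    have "nrm B x * nrm B x \<le> nrm B (star B x) * nrm B x"
      using nrm_mult[of "star B x" x] c_star_identity[OF x] x by (simp add: power2_eq_square)
    then show ?thesis using False nrm_nonneg[OF x] by (simp add: mult_le_cancel_right)
  qed (use x in simp)
  assume x: "x \<in> carrier B"
  show ?thesis using le[OF x] le[of "star B x"] x star_star[OF x] by simp
qed

lemma nrm_star_self_adjoint_square:
  assumes "h \<in> carrier B" and "star B h = h"
  shows "nrm B (h \<otimes> h) = (nrm B h)\<^sup>2"
  using c_star_identity[of h] assms by simp

lemma nrm_projection_le_1:
  assumes "p \<in> carrier B" and "star B p = p" and "p \<otimes> p = p"
  shows "nrm B p \<le> 1"
proof -
  have "(nrm B p)\<^sup>2 = nrm B p" using nrm_star_self_adjoint_square[of p] assms by simp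
  then show ?thesis by (auto simp: power2_eq_square)
qed

lemma finsum_mult_left:
  assumes "finite I" and "x \<in> carrier B" and "\<And>i. i \<in> I \<Longrightarrow> f i \<in> carrier B"
  shows "x \<otimes> finsum B f I = finsum B (\<lambda>i. x \<otimes> f i) I"
  using assms(1,3)
proof (induction rule: finite_induct)
  case (insert i I)
  then have "f \<in> I \<rightarrow> carrier B" "(\<lambda>i. x \<otimes> f i) \<in> I \<rightarrow> carrier B" using assms(2) by auto
  then show ?case using insert assms(2) by (simp add: distr_right)
qed (use assms(2) in simp)

lemma finsum_mult_right:
  assumes "finite I" and "x \<in> carrier B" and "\<And>i. i \<in> I \<Longrightarrow> f i \<in> carrier B"
  shows "finsum B f I \<otimes> x = finsum B (\<lambda>i. f i \<otimes> x) I"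
  using assms(1,3)
proof (induction rule: finite_induct)
  case (insert i I)
  then have "f \<in> I \<rightarrow> carrier B" "(\<lambda>i. f i \<otimes> x) \<in> I \<rightarrow> carrier B" using assms(2) by auto
  then show ?case using insert assms(2) by (simp add: distr_left)
qed (use assms(2) in simp)

lemma star_finsum:
  assumes "finite I" and "\<And>i. i \<in> I \<Longrightarrow> f i \<in> carrier B"
  shows "star B (finsum B f I) = finsum B (\<lambda>i. star B (f i)) I"
  using assms
proof (induction rule: finite_induct)
  case (insert i I)
  then have "f \<in> I \<rightarrow> carrier B" "(\<lambda>i. star B (f i)) \<in> I \<rightarrow> carrier B" by auto
  then show ?case using insert by (simp add: star_add)
qed simp

lemma nrm_finsum_le:
  assumes "finite I" and "\<And>i. i \<in> I \<Longrightarrow> f i \<in> carrier B"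
  shows "nrm B (finsum B f I) \<le> (\<Sum>i\<in>I. nrm B (f i))"
  using assms
proof (induction rule: finite_induct)
  case (insert i I)
  then have "f \<in> I \<rightarrow> carrier B" by auto
  then show ?case
    using insert nrm_triangle[of "f i" "finsum B f I"] by simp
qed simp

lemma finsum_eq_single:
  assumes "finite I" and "j \<in> I" and "f j \<in> carrier B" and "\<And>i. \<lbrakk>i \<in> I; i \<noteq> j\<rbrakk> \<Longrightarrow> f i = \<zero>"
  shows "finsum B f I = f j"
proof -
  have f: "f i \<in> carrier B" if "i \<in> I" for i using assms(3,4) that by (cases "i = j") auto
  have "finsum B f I = finsum B (\<lambda>i. if j = i then f i else \<zero>) I"
    using assms f by (intro finsum_cong') auto
  also have "\<dots> = f j" using assms f by (intro finsum_singleton) auto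
  finally show ?thesis .
qed

section \<open>The unit is an extreme point of the unit ball\<close>

text \<open>
  With \<open>x c = c e + n z\<close>, the element \<open>c e + (n + 1) z\<close> is the average of \<open>(e + z) (x (c + 1))\<close> and
  \<open>(e - z) (x (c - 1))\<close>.  The recursion is that of the simple random walk started at \<open>c\<close>, and the bound is
  the root mean square of its position after \<open>n\<close> steps.
\<close>

lemma nrm_scalar_plus_multiple_le:
  assumes e: "e \<in> carrier B" "nrm B e \<le> 1" and z: "z \<in> carrier B"
    and unit: "e \<otimes> e = e" "e \<otimes> z = z" "z \<otimes> e = z"
    and plus: "nrm B (e \<oplus> z) \<le> 1" and minus: "nrm B (e \<ominus> z) \<le> 1"
  shows "nrm B (complex_of_real c \<odot> e \<oplus> complex_of_nat n \<odot> z) \<le> sqrt (c\<^sup>2 + n)"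
proof (induction n arbitrary: c)
  case 0
  have "\<bar>c\<bar> * nrm B e \<le> \<bar>c\<bar> * 1" using e by (intro mult_left_mono) auto
  then show ?case using e z by (simp add: nrm_smult)
next
  case (Suc n)
  let ?x = "\<lambda>c. complex_of_real c \<odot> e \<oplus> complex_of_nat n \<odot> z"
  have x: "?x c \<in> carrier B" for c using e z by simp
  have "(1/2) \<odot> ((e \<oplus> z) \<otimes> ?x (c + 1)) \<oplus> (1/2) \<odot> ((e \<ominus> z) \<otimes> ?x (c - 1))
     = complex_of_real c \<odot> e \<oplus> complex_of_nat (Suc n) \<odot> z" (is "?L = ?R")
  proof -
    let ?q = "\<lambda>a b d. a \<odot> e \<oplus> (b \<odot> z \<oplus> d \<odot> (z \<otimes> z))"
    have add: "?q a b d \<oplus> ?q a' b' d' = ?q (a + a') (b + b') (d + d')" for a b d a' b' d'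
      using e z by (simp add: smult_add_left a_ac)
    have 1: "(1/2) \<odot> ((e \<oplus> z) \<otimes> ?x (c + 1)) = ?q ((c+1)/2) (n/2 + (c+1)/2) (n/2)"
      using e z unit
      by (simp add: distr_left distr_right smult_mult_left smult_mult_right smult_add_right
          smult_add_left a_ac add_divide_distrib)
    have 2: "(1/2) \<odot> ((e \<ominus> z) \<otimes> ?x (c - 1)) = ?q ((c-1)/2) (n/2 + -(c-1)/2) (- n/2)"
      using e z unit
      by (simp add: minus_eq_smult distr_left distr_right smult_mult_left smult_mult_right
          smult_add_right smult_add_left[symmetric] a_ac)
        (simp add: smult_add_left a_ac diff_divide_distrib)
    have "?L = ?q c (1 + n) 0" unfolding 1 2 add by (simp add: add_divide_distrib diff_divide_distrib add.commute)
    then show ?thesis using e z by simp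
  qed
  then have "nrm B ?R \<le> nrm B ((1/2) \<odot> ((e \<oplus> z) \<otimes> ?x (c + 1))) + nrm B ((1/2) \<odot> ((e \<ominus> z) \<otimes> ?x (c - 1)))"
    using nrm_triangle[of "(1/2) \<odot> ((e \<oplus> z) \<otimes> ?x (c + 1))" "(1/2) \<odot> ((e \<ominus> z) \<otimes> ?x (c - 1))"] e z by simp
  also have "\<dots> \<le> (sqrt ((c+1)\<^sup>2 + n) + sqrt ((c-1)\<^sup>2 + n)) / 2"
  proof -
    have "nrm B ((e \<oplus> z) \<otimes> ?x (c + 1)) \<le> 1 * sqrt ((c+1)\<^sup>2 + n)"
      using nrm_mult[of "e \<oplus> z" "?x (c+1)"] mult_mono[OF plus Suc.IH[of "c+1"]] e z x by force
    moreover have "nrm B ((e \<ominus> z) \<otimes> ?x (c - 1)) \<le> 1 * sqrt ((c-1)\<^sup>2 + n)"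
      using nrm_mult[of "e \<ominus> z" "?x (c-1)"] mult_mono[OF minus Suc.IH[of "c-1"]] e z x by force
    ultimately show ?thesis using e z by (simp add: nrm_smult norm_divide)
  qed
  also have "\<dots> \<le> sqrt (c\<^sup>2 + Suc n)"
  proof -
    have "((x + y) / 2)\<^sup>2 \<le> (x\<^sup>2 + y\<^sup>2) / 2" for x y :: real
      using zero_le_power2[of "x - y"] by (simp add: power2_eq_square field_simps)
    then have "((sqrt ((c+1)\<^sup>2 + n) + sqrt ((c-1)\<^sup>2 + n)) / 2)\<^sup>2
        \<le> ((sqrt ((c+1)\<^sup>2 + n))\<^sup>2 + (sqrt ((c-1)\<^sup>2 + n))\<^sup>2) / 2" .
    also have "\<dots> = (((c+1)\<^sup>2 + n) + ((c-1)\<^sup>2 + n)) / 2"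
      by (simp only: real_sqrt_pow2 add_nonneg_nonneg zero_le_power2 of_nat_0_le_iff)
    also have "\<dots> = c\<^sup>2 + Suc n" by (simp add: power2_eq_square field_simps)
    finally show ?thesis by (rule real_le_rsqrt)
  qed
  finally show ?case .
qed

text \<open>
  The norm of \<open>n z\<close> grows only like the square root of \<open>n\<close>, by the preceding estimate with \<open>c = 0\<close>.
\<close>

lemma unit_extreme:
  assumes e: "e \<in> carrier B" "nrm B e \<le> 1" and z: "z \<in> carrier B"
    and unit: "e \<otimes> e = e" "e \<otimes> z = z" "z \<otimes> e = z"
    and plus: "nrm B (e \<oplus> z) \<le> 1" and minus: "nrm B (e \<ominus> z) \<le> 1"
  shows "z = \<zero>"
proof -
  have "nrm B z \<le> 1 / sqrt n" if "0 < n" for n :: nat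
  proof -
    have "n * nrm B z \<le> sqrt n"
      using nrm_scalar_plus_multiple_le[OF assms, of 0 n] e z by (simp add: nrm_smult)
    then have "nrm B z \<le> sqrt n / n" using that by (simp add: field_simps)
    then show ?thesis by (simp add: sqrt_divide_self_eq inverse_eq_divide)
  qed
  moreover have "(\<lambda>n. 1 / sqrt (real n)) \<longlonglongrightarrow> 0" by real_asymp
  ultimately have "nrm B z \<le> 0"
    by (intro tendsto_lowerbound[of "\<lambda>n. 1 / sqrt (real n)" 0 sequentially])
      (auto intro: eventually_sequentiallyI[of 1])
  then show ?thesis using nrm_nonneg[OF z] nrm_zero_iff[OF z] by simp
qed

section \<open>Geometric series\<close>

lemma limit_unique:
  assumes "\<And>n. u n \<in> carrier B" "l \<in> carrier B" "m \<in> carrier B"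
    and "(\<lambda>n. nrm B (u n \<ominus> l)) \<longlonglongrightarrow> 0" and "(\<lambda>n. nrm B (u n \<ominus> m)) \<longlonglongrightarrow> 0"
  shows "l = m"
proof -
  have "nrm B (l \<ominus> m) \<le> nrm B (u n \<ominus> l) + nrm B (u n \<ominus> m)" for n
    using nrm_triangle[of "l \<ominus> u n" "u n \<ominus> m"] assms(1-3)
    by (simp add: minus_minus_telescope nrm_minus_commute[of l])
  moreover have "(\<lambda>n. nrm B (u n \<ominus> l) + nrm B (u n \<ominus> m)) \<longlonglongrightarrow> 0 + 0"
    using assms(4,5) by (rule tendsto_add)
  ultimately have "nrm B (l \<ominus> m) \<le> 0 + 0" by (intro tendsto_lowerbound) auto
  then show ?thesis using assms(2,3)
    by (metis add.right_neutral minus_closed minus_eq_zero_iff nrm_nonneg nrm_zero_iff order_antisym)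
qed

text \<open>
  The element \<open>d\<close> is \<open>c + c\<^sup>2 + c\<^sup>3 + \<dots>\<close>.  The equation says that \<open>(1 + d) (1 - c) = 1\<close> in the
  algebra with a unit adjoined.
\<close>

lemma geometric_series:
  assumes c: "c \<in> carrier B" and lt: "nrm B c < 1"
  obtains d where "d \<in> carrier B" and "d = c \<oplus> d \<otimes> c"
proof -
  define u where "u n = ((\<lambda>x. c \<oplus> x \<otimes> c) ^^ n) \<zero>" for n
  have u_Suc: "u (Suc n) = c \<oplus> u n \<otimes> c" for n by (simp add: u_def)
  have u: "u n \<in> carrier B" for n by (induction n) (use c in \<open>simp_all add: u_def\<close>)
  have diff: "u (Suc n) \<ominus> u (Suc m) = (u n \<ominus> u m) \<otimes> c" for n m
    using c u by (simp add: u_Suc minus_eq_smult distr_left smult_mult_left smult_add_right a_ac)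
       (metis a_lcomm add.m_assoc a_closed closed(1) l_neg l_zero neg_eq_smult smult_closed)
  have step: "nrm B (u (n + k) \<ominus> u n) \<le> nrm B c ^ n * (1 / (1 - nrm B c))" for n k
  proof (induction n)
    case 0
    have "nrm B (u k) \<le> 1 / (1 - nrm B c)"
    proof (induction k)
      case (Suc k)
      have "nrm B (u (Suc k)) \<le> nrm B c + nrm B (u k) * nrm B c"
        using nrm_triangle[of c "u k \<otimes> c"] nrm_mult[of "u k" c] c u by (simp add: u_Suc)
      also have "\<dots> \<le> 1 + 1 / (1 - nrm B c) * nrm B c"
        using Suc lt nrm_nonneg[OF c] by (intro add_mono mult_right_mono) auto
      also have "\<dots> = 1 / (1 - nrm B c)" using lt by (simp add: field_simps)
      finally show ?case .
    qed (use lt in \<open>simp add: u_def\<close>)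
    then show ?case using u by (simp add: u_def)
  next
    case (Suc n)
    have "nrm B (u (Suc n + k) \<ominus> u (Suc n)) \<le> nrm B (u (n + k) \<ominus> u n) * nrm B c"
      using nrm_mult[of "u (n + k) \<ominus> u n" c] c u by (simp add: diff)
    also have "\<dots> \<le> (nrm B c ^ n * (1 / (1 - nrm B c))) * nrm B c"
      using Suc c by (intro mult_right_mono) auto
    finally show ?case by (simp add: mult_ac)
  qed
  have cauchy: "\<exists>N. \<forall>m\<ge>N. \<forall>n\<ge>N. nrm B (u m \<ominus> u n) < e" if e: "e > 0" for e :: real
  proof -
    have "(\<lambda>n. nrm B c ^ n * (1 / (1 - nrm B c))) \<longlonglongrightarrow> 0 * (1 / (1 - nrm B c))"
      using lt nrm_nonneg[OF c] by (intro tendsto_mult LIMSEQ_power_zero tendsto_const) auto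
    then have "\<forall>\<^sub>F n in sequentially. nrm B c ^ n * (1 / (1 - nrm B c)) < e"
      using e by (intro order_tendstoD) auto
    then obtain N where N: "\<And>n. n \<ge> N \<Longrightarrow> nrm B c ^ n * (1 / (1 - nrm B c)) < e"
      by (auto simp: eventually_sequentially)
    have "nrm B (u m \<ominus> u n) < e" if "m \<ge> n" "n \<ge> N" for m n
      using step[of n "m - n"] N[of n] that by simp
    then have "nrm B (u m \<ominus> u n) < e" if "m \<ge> N" "n \<ge> N" for m n
      using that nrm_minus_commute[OF u u, of m n] by (cases "m \<ge> n") force+
    then show ?thesis by blast
  qed
  obtain d where d: "d \<in> carrier B" and lim: "(\<lambda>n. nrm B (u n \<ominus> d)) \<longlonglongrightarrow> 0"
    using complete[of u] u cauchy by metis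
  have "(\<lambda>n. nrm B (u (Suc n) \<ominus> (c \<oplus> d \<otimes> c))) \<longlonglongrightarrow> 0"
  proof (rule Lim_null_comparison)
    have eq: "u (Suc n) \<ominus> (c \<oplus> d \<otimes> c) = (u n \<ominus> d) \<otimes> c" for n
      using c u d by (simp add: u_Suc minus_eq_smult distr_left smult_mult_left smult_add_right a_ac)
       (metis a_lcomm add.m_assoc a_closed closed(1) l_neg l_zero neg_eq_smult smult_closed)
    show "\<forall>\<^sub>F n in sequentially. norm (nrm B (u (Suc n) \<ominus> (c \<oplus> d \<otimes> c))) \<le> nrm B (u n \<ominus> d) * nrm B c"
      using nrm_mult[of "u _ \<ominus> d" c] c u d by (intro always_eventually) (simp add: eq)
    show "(\<lambda>n. nrm B (u n \<ominus> d) * nrm B c) \<longlonglongrightarrow> 0"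
      using tendsto_mult_left_zero[OF lim] .
  qed
  moreover have "(\<lambda>n. nrm B (u (Suc n) \<ominus> d)) \<longlonglongrightarrow> 0" using lim by (rule LIMSEQ_Suc)
  ultimately have "d = c \<oplus> d \<otimes> c" using c d u by (intro limit_unique[of "\<lambda>n. u (Suc n)"]) auto
  with d show thesis by (rule that)
qed

end

section \<open>Representations on inner product spaces\<close>

locale semi_inner_product =
  fixes H :: "'h inner_space" (structure)
  assumes hadd_closed [simp]: "\<lbrakk>x \<in> carrier H; y \<in> carrier H\<rbrakk> \<Longrightarrow> x \<oplus> y \<in> carrier H"
    and hsmult_closed [simp]: "x \<in> carrier H \<Longrightarrow> c \<odot> x \<in> carrier H"
    and cinner_add: "\<lbrakk>x \<in> carrier H; y \<in> carrier H; z \<in> carrier H\<rbrakk>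
      \<Longrightarrow> cinner H (x \<oplus> y) z = cinner H x z + cinner H y z"
    and cinner_smult: "\<lbrakk>x \<in> carrier H; y \<in> carrier H\<rbrakk> \<Longrightarrow> cinner H (c \<odot> x) y = c * cinner H x y"
    and cinner_cnj: "\<lbrakk>x \<in> carrier H; y \<in> carrier H\<rbrakk> \<Longrightarrow> cinner H x y = cnj (cinner H y x)"
    and cinner_nonneg: "x \<in> carrier H \<Longrightarrow> 0 \<le> Re (cinner H x x)"
begin

definition nsq :: "'h \<Rightarrow> real" where
  "nsq x = Re (cinner H x x)"

lemma nsq_nonneg [simp]: "x \<in> carrier H \<Longrightarrow> 0 \<le> nsq x"
  by (simp add: nsq_def cinner_nonneg)

lemma cinner_self: "x \<in> carrier H \<Longrightarrow> cinner H x x = complex_of_real (nsq x)"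
proof -
  assume "x \<in> carrier H"
  then have "Im (cinner H x x) = - Im (cinner H x x)" by (subst cinner_cnj) auto
  then show ?thesis by (simp add: nsq_def complex_eq_iff)
qed

lemma cinner_add_right: "\<lbrakk>x \<in> carrier H; y \<in> carrier H; z \<in> carrier H\<rbrakk>
      \<Longrightarrow> cinner H z (x \<oplus> y) = cinner H z x + cinner H z y"
  by (metis cinner_add cinner_cnj complex_cnj_add hadd_closed)

lemma cinner_smult_right:
  "\<lbrakk>x \<in> carrier H; y \<in> carrier H\<rbrakk> \<Longrightarrow> cinner H y (c \<odot> x) = cnj c * cinner H y x"
  by (metis cinner_smult cinner_cnj complex_cnj_mult hsmult_closed)

lemma hnorm_square: "x \<in> carrier H \<Longrightarrow> (hnorm H x)\<^sup>2 = nsq x"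
  using nsq_nonneg[of x] by (simp add: hnorm_def nsq_def)

lemma nsq_add_smult:
  assumes x: "x \<in> carrier H" and y: "y \<in> carrier H"
  shows "nsq (x \<oplus> c \<odot> y) = nsq x + 2 * Re (c * cinner H y x) + (cmod c)\<^sup>2 * nsq y"
proof -
  have "cinner H x y = cnj (cinner H y x)" using x y by (rule cinner_cnj)
  then have "cinner H (x \<oplus> c \<odot> y) (x \<oplus> c \<odot> y)
      = cinner H x x + (c * cinner H y x + cnj (c * cinner H y x)) + c * cnj c * cinner H y y"
    using x y by (simp add: cinner_add cinner_add_right cinner_smult cinner_smult_right algebra_simps)
  also have "\<dots> = of_real (nsq x + 2 * Re (c * cinner H y x) + (cmod c)\<^sup>2 * nsq y)"
    unfolding complex_add_cnj complex_norm_square[symmetric] using x y by (simp add: cinner_self)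
  finally have "complex_of_real (nsq (x \<oplus> c \<odot> y))
      = complex_of_real (nsq x + 2 * Re (c * cinner H y x) + (cmod c)\<^sup>2 * nsq y)"
    using x y by (simp only: cinner_self hadd_closed hsmult_closed)
  then show ?thesis by (simp only: of_real_eq_iff)
qed

lemma cauchy_schwarz:
  assumes x: "x \<in> carrier H" and y: "y \<in> carrier H"
  shows "(cmod (cinner H x y))\<^sup>2 \<le> nsq x * nsq y"
proof (cases "nsq y = 0")
  case False
  then have y0: "nsq y > 0" using nsq_nonneg[OF y] by linarith
  define c where "c = - (cinner H x y / nsq y)"
  have "Re (c * cinner H y x) = - ((cmod (cinner H x y))\<^sup>2 / nsq y)"
    by (simp add: c_def cinner_cnj[OF y x] complex_norm_square[symmetric] flip: of_real_divide of_real_power)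
  moreover have "(cmod c)\<^sup>2 * nsq y = (cmod (cinner H x y))\<^sup>2 / nsq y"
    using y0 by (simp add: c_def norm_divide power2_eq_square)
  ultimately have "0 \<le> nsq x - (cmod (cinner H x y))\<^sup>2 / nsq y"
    using nsq_nonneg[of "x \<oplus> c \<odot> y"] nsq_add_smult[OF x y, of c] x y by simp
  then show ?thesis using y0 by (simp add: field_simps)
next
  case True
  have "cmod (cinner H x y) = 0"
  proof (rule ccontr)
    assume nz: "cmod (cinner H x y) \<noteq> 0"
    define t where "t = (nsq x + 1) / (2 * (cmod (cinner H x y))\<^sup>2)"
    define c where "c = - complex_of_real t * cinner H x y"
    have "Re (c * cinner H y x) = - t * (cmod (cinner H x y))\<^sup>2"
      by (simp add: c_def cinner_cnj[OF y x] mult.assoc complex_norm_square[symmetric] flip: of_real_power of_real_mult)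
    then have "0 \<le> nsq x - 2 * (t * (cmod (cinner H x y))\<^sup>2)"
      using nsq_nonneg[of "x \<oplus> c \<odot> y"] nsq_add_smult[OF x y, of c] x y True by simp
    also have "2 * (t * (cmod (cinner H x y))\<^sup>2) = nsq x + 1" using nz by (simp add: t_def)
    finally show False by simp
  qed
  then show ?thesis using True by simp
qed

end

locale hilbert_representation = c_star_algebra A + semi_inner_product H
  for A :: "'c cstar" (structure) and H :: "'h inner_space" +
  fixes \<pi> :: "'c \<Rightarrow> 'h \<Rightarrow> 'h"
  assumes rep_closed [simp]: "\<lbrakk>x \<in> carrier A; \<xi> \<in> carrier H\<rbrakk> \<Longrightarrow> \<pi> x \<xi> \<in> carrier H"
    and rep_add: "\<lbrakk>x \<in> carrier A; y \<in> carrier A; \<xi> \<in> carrier H\<rbrakk> \<Longrightarrow> \<pi> (x \<oplus> y) \<xi> = \<pi> x \<xi> \<oplus>\<^bsub>H\<^esub> \<pi> y \<xi>"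
    and rep_smult: "\<lbrakk>x \<in> carrier A; \<xi> \<in> carrier H\<rbrakk> \<Longrightarrow> \<pi> (c \<odot> x) \<xi> = c \<odot>\<^bsub>H\<^esub> \<pi> x \<xi>"
    and rep_mult: "\<lbrakk>x \<in> carrier A; y \<in> carrier A; \<xi> \<in> carrier H\<rbrakk> \<Longrightarrow> \<pi> (x \<otimes> y) \<xi> = \<pi> x (\<pi> y \<xi>)"
    and rep_bounded: "x \<in> carrier A \<Longrightarrow> \<exists>K. \<forall>\<xi> \<in> carrier H. hnorm H (\<pi> x \<xi>) \<le> K * hnorm H \<xi>"
begin

text \<open>The number \<open>K\<close> bounds the square of the operator norm, which is more convenient for squared norms of vectors.\<close>

definition op_bound :: "'c \<Rightarrow> real \<Rightarrow> bool" where
  "op_bound x K \<longleftrightarrow> 0 \<le> K \<and> (\<forall>\<xi> \<in> carrier H. nsq (\<pi> x \<xi>) \<le> K * nsq \<xi>)"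

text \<open>
  Adjointness is a relation between elements of the algebra: in a space that need not be complete a
  bounded operator need not have an adjoint.
\<close>

definition adjoints :: "'c \<Rightarrow> 'c \<Rightarrow> bool" where
  "adjoints x y \<longleftrightarrow> (\<forall>\<xi> \<in> carrier H. \<forall>\<zeta> \<in> carrier H. cinner H (\<pi> x \<xi>) \<zeta> = cinner H \<xi> (\<pi> y \<zeta>))"

lemma op_boundD: "\<lbrakk>op_bound x K; \<xi> \<in> carrier H\<rbrakk> \<Longrightarrow> nsq (\<pi> x \<xi>) \<le> K * nsq \<xi>"
  by (simp add: op_bound_def)

lemma op_bound_nonneg: "op_bound x K \<Longrightarrow> 0 \<le> K"
  by (simp add: op_bound_def)

lemma adjointsD: "\<lbrakk>adjoints x y; \<xi> \<in> carrier H; \<zeta> \<in> carrier H\<rbrakk>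
    \<Longrightarrow> cinner H (\<pi> x \<xi>) \<zeta> = cinner H \<xi> (\<pi> y \<zeta>)"
  by (simp add: adjoints_def)

lemma op_bound_exists:
  assumes x: "x \<in> carrier A"
  obtains K where "op_bound x K"
proof -
  obtain K where K: "\<forall>\<xi> \<in> carrier H. hnorm H (\<pi> x \<xi>) \<le> K * hnorm H \<xi>" using rep_bounded[OF x] by blast
  have "nsq (\<pi> x \<xi>) \<le> K\<^sup>2 * nsq \<xi>" if \<xi>: "\<xi> \<in> carrier H" for \<xi>
  proof -
    have "0 \<le> hnorm H (\<pi> x \<xi>)" using x \<xi> cinner_nonneg by (simp add: hnorm_def)
    then have "(hnorm H (\<pi> x \<xi>))\<^sup>2 \<le> (K * hnorm H \<xi>)\<^sup>2" using K \<xi> by (intro power_mono) auto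
    then show ?thesis using x \<xi> by (simp add: hnorm_square power_mult_distrib)
  qed
  then have "op_bound x (K\<^sup>2)" by (simp add: op_bound_def)
  then show thesis by (rule that)
qed

lemma op_bound_mult:
  assumes "x \<in> carrier A" "y \<in> carrier A" "op_bound x K" "op_bound y L"
  shows "op_bound (x \<otimes> y) (K * L)"
  unfolding op_bound_def
proof (intro conjI ballI)
  fix \<xi> assume \<xi>: "\<xi> \<in> carrier H"
  have "nsq (\<pi> x (\<pi> y \<xi>)) \<le> K * nsq (\<pi> y \<xi>)" using assms \<xi> by (intro op_boundD) auto
  also have "\<dots> \<le> K * (L * nsq \<xi>)" using assms \<xi> by (intro mult_left_mono op_boundD op_bound_nonneg) auto
  finally show "nsq (\<pi> (x \<otimes> y) \<xi>) \<le> K * L * nsq \<xi>" using assms \<xi> by (simp add: rep_mult mult.assoc)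
qed (use assms op_bound_nonneg in simp)

lemma adjoints_sym: "\<lbrakk>x \<in> carrier A; y \<in> carrier A; adjoints x y\<rbrakk> \<Longrightarrow> adjoints y x"
  unfolding adjoints_def by (metis cinner_cnj rep_closed)

lemma adjoints_add:
  "\<lbrakk>x \<in> carrier A; y \<in> carrier A; x' \<in> carrier A; y' \<in> carrier A; adjoints x y; adjoints x' y'\<rbrakk>
    \<Longrightarrow> adjoints (x \<oplus> x') (y \<oplus> y')"
  by (simp add: adjoints_def rep_add cinner_add cinner_add_right)

lemma adjoints_smult:
  "\<lbrakk>x \<in> carrier A; y \<in> carrier A; adjoints x y\<rbrakk> \<Longrightarrow> adjoints (c \<odot> x) (cnj c \<odot> y)"
  by (simp add: adjoints_def rep_smult cinner_smult cinner_smult_right)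

lemma adjoints_mult:
  "\<lbrakk>x \<in> carrier A; y \<in> carrier A; x' \<in> carrier A; y' \<in> carrier A; adjoints x y; adjoints x' y'\<rbrakk>
    \<Longrightarrow> adjoints (x \<otimes> x') (y' \<otimes> y)"
  by (simp add: adjoints_def rep_mult)

lemma op_bound_adjoint:
  assumes x: "x \<in> carrier A" and y: "y \<in> carrier A" and adj: "adjoints x y" and K: "op_bound x K"
  shows "op_bound y K"
  unfolding op_bound_def
proof (intro conjI ballI)
  show "0 \<le> K" using K by (rule op_bound_nonneg)
  fix \<xi> assume \<xi>: "\<xi> \<in> carrier H"
  let ?a = "nsq (\<pi> y \<xi>)"
  have "of_real ?a = cinner H (\<pi> x (\<pi> y \<xi>)) \<xi>"
    using adjointsD[OF adj, of "\<pi> y \<xi>" \<xi>] x y \<xi> by (simp add: cinner_self)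
  then have "?a\<^sup>2 = (cmod (cinner H (\<pi> x (\<pi> y \<xi>)) \<xi>))\<^sup>2"
    by (metis norm_of_real power2_abs)
  also have "\<dots> \<le> nsq (\<pi> x (\<pi> y \<xi>)) * nsq \<xi>" using x y \<xi> by (intro cauchy_schwarz) auto
  also have "\<dots> \<le> (K * ?a) * nsq \<xi>" using x y \<xi> K by (intro mult_right_mono op_boundD) auto
  finally have "?a * ?a \<le> ?a * (K * nsq \<xi>)" by (simp add: power2_eq_square mult_ac)
  moreover have "0 \<le> ?a" "0 \<le> K * nsq \<xi>" using x y \<xi> \<open>0 \<le> K\<close> by auto
  ultimately show "?a \<le> K * nsq \<xi>" by (cases "?a = 0") (auto simp: mult_le_cancel_left)
qed

lemma cinner_rep_zero: "\<lbrakk>\<xi> \<in> carrier H; \<zeta> \<in> carrier H\<rbrakk> \<Longrightarrow> cinner H (\<pi> \<zero> \<xi>) \<zeta> = 0"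
  using rep_smult[of \<zero> \<xi> 0] cinner_smult[of "\<pi> \<zero> \<xi>" \<zeta> 0] by (simp del: smult_0)

lemma cinner_rep_finsum:
  assumes "finite I" and "\<And>i. i \<in> I \<Longrightarrow> f i \<in> carrier A" and "\<xi> \<in> carrier H" "\<zeta> \<in> carrier H"
  shows "cinner H (\<pi> (finsum A f I) \<xi>) \<zeta> = (\<Sum>i\<in>I. cinner H (\<pi> (f i) \<xi>) \<zeta>)"
  using assms(1,2)
proof (induction rule: finite_induct)
  case (insert i I)
  then have "f \<in> I \<rightarrow> carrier A" by auto
  then show ?case using insert assms(3,4) by (simp add: rep_add cinner_add)
qed (use assms(3,4) in \<open>simp add: cinner_rep_zero\<close>)

text \<open>
  Let \<open>t\<close> be the squared norm of \<open>\<pi> w\<close> and suppose that \<open>nrm A k < t\<close>.  Then \<open>1 - k / t\<close> is invertible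
  by the geometric series, so that \<open>1 - \<pi> k / t\<close> is bounded below.  But \<open>\<pi> k\<close> is the positive operator
  \<open>\<pi> (w\<^sup>* w)\<close> of norm \<open>t\<close>, and \<open>\<pi> k / t\<close> almost fixes the vectors at which \<open>\<pi> w\<close> almost attains its norm.

  For \<open>k = w\<^sup>* w\<close> the conclusion says that \<open>\<pi>\<close> does not increase the norm of \<open>w\<close>.  The freedom in \<open>k\<close> allows
  \<open>k = w\<^sup>* (w - x)\<close> with \<open>x\<close> in the kernel of \<open>\<pi>\<close>, which makes \<open>\<pi> w\<close> small if \<open>w\<close> is close to \<open>x\<close>.
\<close>

lemma op_bound_gram:
  assumes w: "w \<in> carrier A" and w': "w' \<in> carrier A" and k: "k \<in> carrier A" and p: "p \<in> carrier A"
    and adj: "adjoints w w'" and pp: "adjoints p p" "p \<otimes> p = p" and wp: "w \<otimes> p = w"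
    and eq: "\<And>\<xi>. \<xi> \<in> carrier H \<Longrightarrow> \<pi> k \<xi> = \<pi> (w' \<otimes> w) \<xi>"
  shows "op_bound w (nrm A k)"
proof -
  define t where "t = Inf {K. op_bound w K}"
  have ne: "{K. op_bound w K} \<noteq> {}" using op_bound_exists[OF w] by blast
  have bdd: "bdd_below {K. op_bound w K}" using op_bound_nonneg by (intro bdd_belowI[of _ 0]) auto
  have t0: "0 \<le> t" unfolding t_def using ne op_bound_nonneg by (intro cInf_greatest) auto
  have t: "op_bound w t"
    unfolding op_bound_def
  proof (intro conjI ballI t0)
    fix \<xi> assume \<xi>: "\<xi> \<in> carrier H"
    show "nsq (\<pi> w \<xi>) \<le> t * nsq \<xi>"
    proof (cases "nsq \<xi> = 0")
      case True
      obtain K where "op_bound w K" using op_bound_exists[OF w] .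
      from op_boundD[OF this \<xi>] show ?thesis using True by simp
    next
      case False
      then have pos: "nsq \<xi> > 0" using \<xi> nsq_nonneg[of \<xi>] by linarith
      have "nsq (\<pi> w \<xi>) / nsq \<xi> \<le> t"
        unfolding t_def using ne pos \<xi> by (intro cInf_greatest) (auto dest: op_boundD simp: divide_le_eq)
      then show ?thesis using pos by (simp add: divide_le_eq)
    qed
  qed
  have "t \<le> nrm A k"
  proof (rule ccontr)
    assume "\<not> t \<le> nrm A k"
    then have lt: "nrm A k < t" by simp
    then have tpos: "0 < t" using nrm_nonneg[OF k] by linarith
    define c where "c = complex_of_real (1 / t) \<odot> k"
    have c: "c \<in> carrier A" using k by (simp add: c_def)
    have "nrm A c < 1" using lt tpos k by (simp add: c_def nrm_smult norm_divide)
    with c obtain d where d: "d \<in> carrier A" and dc: "d = c \<oplus> d \<otimes> c" by (rule geometric_series)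
    obtain L where L: "op_bound d L" using op_bound_exists[OF d] .
    have L0: "0 \<le> L" using L by (rule op_bound_nonneg)
    \<comment> \<open>This makes \<open>2 L \<delta> \<le> 1/2 < (1 - \<delta>)\<^sup>2\<close>, which contradicts the estimates below.\<close>
    define \<delta> where "\<delta> = 1 / (4 + 4 * L)"
    have \<delta>: "0 < \<delta>" "\<delta> \<le> 1/4" "2 * L * \<delta> \<le> 1/2" using L0 by (auto simp: \<delta>_def field_simps)
    have "\<not> op_bound w (t * (1 - \<delta>))"
    proof
      assume "op_bound w (t * (1 - \<delta>))"
      then have "t \<le> t * (1 - \<delta>)" unfolding t_def using bdd by (intro cInf_lower) auto
      then show False using mult_pos_pos[OF tpos \<delta>(1)] by (simp add: right_diff_distrib)
    qed
    moreover have "0 \<le> t * (1 - \<delta>)" using tpos \<delta> by simp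
    ultimately obtain \<xi>0 where \<xi>0: "\<xi>0 \<in> carrier H" "t * (1 - \<delta>) * nsq \<xi>0 < nsq (\<pi> w \<xi>0)"
      unfolding op_bound_def by force
    \<comment> \<open>The projection \<open>p\<close> acts as a unit on \<open>\<xi>\<close>, so that \<open>p - c\<close> serves for \<open>1 - c\<close>.\<close>
    define \<xi> where "\<xi> = \<pi> p \<xi>0"
    have \<xi>: "\<xi> \<in> carrier H" using p \<xi>0 by (simp add: \<xi>_def)
    have fix_\<xi>: "\<pi> p \<xi> = \<xi>" using p \<xi>0 pp(2) by (simp add: \<xi>_def rep_mult[symmetric])
    have w\<xi>: "\<pi> w \<xi> = \<pi> w \<xi>0" using p \<xi>0 w wp by (simp add: \<xi>_def rep_mult[symmetric])
    have "nsq \<xi> \<le> nsq \<xi>0"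
    proof -
      have "cinner H \<xi> \<xi>0 = cinner H \<xi> \<xi>"
        using adjointsD[OF pp(1), of \<xi> \<xi>0] \<xi> \<xi>0 fix_\<xi> by (simp add: \<xi>_def)
      then have "(nsq \<xi>)\<^sup>2 \<le> nsq \<xi> * nsq \<xi>0"
        using cauchy_schwarz[OF \<xi> \<xi>0(1)] \<xi> by (simp add: cinner_self)
      then show ?thesis using nsq_nonneg[OF \<xi>] nsq_nonneg[OF \<xi>0(1)]
        by (cases "nsq \<xi> = 0") (auto simp: power2_eq_square)
    qed
    then have "t * (1 - \<delta>) * nsq \<xi> \<le> t * (1 - \<delta>) * nsq \<xi>0" using tpos \<delta> by (intro mult_left_mono) auto
    then have big: "t * (1 - \<delta>) * nsq \<xi> < nsq (\<pi> w \<xi>)" using \<xi>0 w\<xi> by simp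
    have pos: "0 < nsq \<xi>"
      using big op_boundD[OF t \<xi>] nsq_nonneg[OF \<xi>] by (cases "nsq \<xi> = 0") auto
    define \<theta> where "\<theta> = \<pi> c \<xi>"
    have \<theta>: "\<theta> \<in> carrier H" using c \<xi> by (simp add: \<theta>_def)
    have \<theta>_eq: "\<theta> = complex_of_real (1 / t) \<odot>\<^bsub>H\<^esub> \<pi> w' (\<pi> w \<xi>)"
      using k \<xi> w w' by (simp add: \<theta>_def c_def rep_smult eq rep_mult)
    have inner: "cinner H \<theta> \<xi> = of_real (nsq (\<pi> w \<xi>) / t)"
      using adjointsD[OF adjoints_sym[OF w w' adj], of "\<pi> w \<xi>" \<xi>] w w' \<xi>
      by (simp add: \<theta>_eq cinner_smult cinner_self)
    have nsq_\<theta>: "nsq \<theta> \<le> nsq \<xi>"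
    proof -
      have "nsq \<theta> = (1 / t)\<^sup>2 * nsq (\<pi> w' (\<pi> w \<xi>))"
        using w w' \<xi> unfolding \<theta>_eq nsq_def by (simp add: cinner_smult cinner_smult_right power2_eq_square)
      also have "\<dots> \<le> (1 / t)\<^sup>2 * (t * (t * nsq \<xi>))"
        using op_boundD[OF op_bound_adjoint[OF w w' adj t], of "\<pi> w \<xi>"] op_boundD[OF t \<xi>] w \<xi> tpos
        by (intro mult_left_mono) (auto intro: order_trans)
      finally show ?thesis using tpos by (simp add: power2_eq_square)
    qed
    have r: "nsq (\<pi> (p \<ominus> c) \<xi>) \<le> 2 * \<delta> * nsq \<xi>"
    proof -
      have "\<pi> (p \<ominus> c) \<xi> = \<xi> \<oplus>\<^bsub>H\<^esub> (-1) \<odot>\<^bsub>H\<^esub> \<theta>"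
        using p c \<xi> by (simp add: minus_eq_smult rep_add rep_smult fix_\<xi> \<theta>_def)
      then have "nsq (\<pi> (p \<ominus> c) \<xi>) = nsq \<xi> - 2 * (nsq (\<pi> w \<xi>) / t) + nsq \<theta>"
        using nsq_add_smult[OF \<xi> \<theta>, of "-1"] inner by simp
      moreover have "(1 - \<delta>) * nsq \<xi> \<le> nsq (\<pi> w \<xi>) / t" using big tpos by (simp add: field_simps)
      ultimately show ?thesis using nsq_\<theta> by (simp add: algebra_simps)
    qed
    have cd: "c = d \<ominus> d \<otimes> c"
    proof -
      have "(c \<oplus> d \<otimes> c) \<ominus> d \<otimes> c = c" using c d by (simp add: minus_eq a_assoc r_neg)
      then show ?thesis using arg_cong[OF dc, of "\<lambda>x. x \<ominus> d \<otimes> c"] by simp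
    qed
    have "\<theta> = \<pi> (d \<ominus> d \<otimes> c) \<xi>" unfolding \<theta>_def by (rule arg_cong[OF cd, of "\<lambda>x. \<pi> x \<xi>"])
    also have "\<dots> = \<pi> d \<xi> \<oplus>\<^bsub>H\<^esub> (- 1) \<odot>\<^bsub>H\<^esub> \<pi> (d \<otimes> c) \<xi>"
      using c d \<xi> by (simp add: minus_eq_smult rep_add rep_smult)
    also have "\<pi> d \<xi> = \<pi> (d \<otimes> p) \<xi>" using d p \<xi> fix_\<xi> by (simp add: rep_mult)
    also have "\<pi> (d \<otimes> p) \<xi> \<oplus>\<^bsub>H\<^esub> (- 1) \<odot>\<^bsub>H\<^esub> \<pi> (d \<otimes> c) \<xi> = \<pi> (d \<otimes> (p \<ominus> c)) \<xi>"
      using d p c \<xi> by (simp add: minus_mult_right minus_eq_smult[of "d \<otimes> p"] rep_add rep_smult)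
    also have "\<dots> = \<pi> d (\<pi> (p \<ominus> c) \<xi>)" using d p c \<xi> by (simp add: rep_mult)
    finally have "\<theta> = \<pi> d (\<pi> (p \<ominus> c) \<xi>)" .
    then have "nsq \<theta> \<le> (2 * L * \<delta>) * nsq \<xi>"
      using op_boundD[OF L, of "\<pi> (p \<ominus> c) \<xi>"] mult_left_mono[OF r L0] p c \<xi> by (simp add: mult_ac)
    also have "\<dots> \<le> 1/2 * nsq \<xi>" using \<delta>(3) pos by (intro mult_right_mono) auto
    finally have up: "nsq \<theta> \<le> 1/2 * nsq \<xi>" .
    have "((1 - \<delta>) * nsq \<xi>)\<^sup>2 \<le> (cmod (cinner H \<theta> \<xi>))\<^sup>2"
    proof (rule power_mono)
      have "(1 - \<delta>) * nsq \<xi> \<le> nsq (\<pi> w \<xi>) / t" using big tpos by (simp add: field_simps)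
      then show "(1 - \<delta>) * nsq \<xi> \<le> cmod (cinner H \<theta> \<xi>)" unfolding inner by (simp only: norm_of_real)
      show "0 \<le> (1 - \<delta>) * nsq \<xi>" using \<delta> pos by simp
    qed
    also have "\<dots> \<le> nsq \<theta> * nsq \<xi>" using \<theta> \<xi> by (rule cauchy_schwarz)
    also have "\<dots> \<le> 1/2 * nsq \<xi> * nsq \<xi>" using up pos by (intro mult_right_mono) auto
    finally have "(1 - \<delta>)\<^sup>2 * (nsq \<xi> * nsq \<xi>) \<le> 1/2 * (nsq \<xi> * nsq \<xi>)"
      by (simp add: power2_eq_square mult_ac)
    then have "(1 - \<delta>)\<^sup>2 \<le> 1/2" using pos by (simp only: mult_le_cancel_right) auto
    moreover have "(3/4)\<^sup>2 \<le> (1 - \<delta>)\<^sup>2" using \<delta> by (intro power_mono) auto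
    ultimately show False by (simp add: power2_eq_square)
  qed
  then have "t * nsq \<xi> \<le> nrm A k * nsq \<xi>" if "\<xi> \<in> carrier H" for \<xi> using that by (simp add: mult_right_mono)
  then show ?thesis using op_boundD[OF t] nrm_nonneg[OF k] unfolding op_bound_def by (meson order_trans)
qed

end

section \<open>Spans\<close>

inductive_set lspan :: "'c cstar \<Rightarrow> 'c set \<Rightarrow> 'c set" for B :: "'c cstar" and G :: "'c set" where
  zero: "\<zero>\<^bsub>B\<^esub> \<in> lspan B G"
| add: "\<lbrakk>g \<in> G; x \<in> lspan B G\<rbrakk> \<Longrightarrow> (c \<odot>\<^bsub>B\<^esub> g) \<oplus>\<^bsub>B\<^esub> x \<in> lspan B G"

context c_star_algebra
begin

lemma lspan_closed: "\<lbrakk>x \<in> lspan B G; G \<subseteq> carrier B\<rbrakk> \<Longrightarrow> x \<in> carrier B"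
  by (induction rule: lspan.induct) auto

lemma lspan_gen: "\<lbrakk>g \<in> G; G \<subseteq> carrier B\<rbrakk> \<Longrightarrow> g \<in> lspan B G"
  using lspan.add[OF _ lspan.zero, of g G B 1] by (auto simp: subset_iff)

lemma lspan_add:
  assumes G: "G \<subseteq> carrier B" and x: "x \<in> lspan B G" and y: "y \<in> lspan B G"
  shows "x \<oplus> y \<in> lspan B G"
  using x
proof (induction rule: lspan.induct)
  case (add g x c)
  then have "((c \<odot> g) \<oplus> x) \<oplus> y = (c \<odot> g) \<oplus> (x \<oplus> y)"
    using G lspan_closed[OF _ G] y by (intro a_assoc) auto
  then show ?case using add lspan.add by metis
qed (use y lspan_closed[OF y G] in simp)

lemma lspan_smult:
  assumes G: "G \<subseteq> carrier B" and x: "x \<in> lspan B G"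
  shows "c \<odot> x \<in> lspan B G"
  using x
proof (induction rule: lspan.induct)
  case (add g x d)
  then have "c \<odot> ((d \<odot> g) \<oplus> x) = ((c * d) \<odot> g) \<oplus> (c \<odot> x)"
    using G lspan_closed[OF _ G] by (subst smult_add_right) auto
  then show ?case using add lspan.add by metis
qed (simp add: lspan.zero)

lemma lspan_finsum:
  assumes G: "G \<subseteq> carrier B" and "finite I" and "\<And>i. i \<in> I \<Longrightarrow> f i \<in> lspan B G"
  shows "finsum B f I \<in> lspan B G"
  using assms(2,3)
proof (induction rule: finite_induct)
  case (insert i I)
  then have "f \<in> I \<rightarrow> carrier B" "f i \<in> carrier B" using lspan_closed[OF _ G] by auto
  then show ?case using insert by (simp add: lspan_add[OF G])
qed (simp add: lspan.zero)

text \<open>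
  The function \<open>k\<close> allows conjugate linear maps, such as the adjoint.
\<close>

lemma lspan_linear_image:
  assumes G: "G \<subseteq> carrier B" and G': "G' \<subseteq> carrier B"
    and F0: "F \<zero> = \<zero>"
    and F: "\<And>c x y. \<lbrakk>x \<in> carrier B; y \<in> carrier B\<rbrakk> \<Longrightarrow> F ((c \<odot> x) \<oplus> y) = (k c \<odot> F x) \<oplus> F y"
    and gen: "\<And>g. g \<in> G \<Longrightarrow> F g \<in> lspan B G'" and x: "x \<in> lspan B G"
  shows "F x \<in> lspan B G'"
  using x
proof (induction rule: lspan.induct)
  case (add g x c)
  then have "F ((c \<odot> g) \<oplus> x) = (k c \<odot> F g) \<oplus> F x" using G lspan_closed[OF _ G] by (intro F) auto
  then show ?case using add gen lspan_add[OF G'] lspan_smult[OF G'] by auto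
qed (simp add: F0 lspan.zero)

lemma lspan_subset:
  assumes "G \<subseteq> carrier B" "G' \<subseteq> carrier B" "\<And>g. g \<in> G \<Longrightarrow> g \<in> lspan B G'" "x \<in> lspan B G"
  shows "x \<in> lspan B G'"
  by (rule lspan_linear_image[where F = "\<lambda>x. x" and k = "\<lambda>c. c"]) (use assms in auto)

lemma lspan_sandwich:
  assumes "G \<subseteq> carrier B" "G' \<subseteq> carrier B" "a \<in> carrier B" "b \<in> carrier B"
    and "\<And>g. g \<in> G \<Longrightarrow> a \<otimes> g \<otimes> b \<in> lspan B G'" and "x \<in> lspan B G"
  shows "a \<otimes> x \<otimes> b \<in> lspan B G'"
  by (rule lspan_linear_image[where F = "\<lambda>x. a \<otimes> x \<otimes> b" and k = "\<lambda>c. c"])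
    (use assms in \<open>auto simp: distr_left distr_right smult_mult_left smult_mult_right\<close>)

lemma lspan_star:
  assumes "G \<subseteq> carrier B" "G' \<subseteq> carrier B"
    and "\<And>g. g \<in> G \<Longrightarrow> star B g \<in> lspan B G'" and "x \<in> lspan B G"
  shows "star B x \<in> lspan B G'"
  by (rule lspan_linear_image[where F = "star B" and k = cnj])
    (use assms in \<open>auto simp: star_add star_smult\<close>)

lemma lspan_mult:
  assumes G: "G \<subseteq> carrier B" and G': "G' \<subseteq> carrier B" and K: "K \<subseteq> carrier B"
    and gen: "\<And>g g'. \<lbrakk>g \<in> G; g' \<in> G'\<rbrakk> \<Longrightarrow> g \<otimes> g' \<in> lspan B K"
    and x: "x \<in> lspan B G" and y: "y \<in> lspan B G'"
  shows "x \<otimes> y \<in> lspan B K"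
proof (rule lspan_linear_image[where F = "\<lambda>x. x \<otimes> y" and k = "\<lambda>c. c", OF G K _ _ _ x])
  have yc: "y \<in> carrier B" using y G' by (rule lspan_closed)
  then show "\<zero> \<otimes> y = \<zero>" by simp
  show "((c \<odot> x) \<oplus> z) \<otimes> y = (c \<odot> (x \<otimes> y)) \<oplus> (z \<otimes> y)" if "x \<in> carrier B" "z \<in> carrier B" for c x z
    using that yc by (simp add: distr_left smult_mult_left)
  show "g \<otimes> y \<in> lspan B K" if g: "g \<in> G" for g
    by (rule lspan_linear_image[where F = "\<lambda>y. g \<otimes> y" and k = "\<lambda>c. c", OF G' K _ _ _ y])
      (use g G gen in \<open>auto simp: distr_right smult_mult_right subset_iff\<close>)
qed

section \<open>Vanishing sums of positive contractions\<close>

lemma finsum_unit_minus: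
  assumes "finite R" and "e \<in> carrier B" and "\<And>j. j \<in> R \<Longrightarrow> Y j \<in> carrier B"
  shows "finsum B (\<lambda>j. e \<ominus> Y j) R = of_nat (card R) \<odot> e \<ominus> finsum B Y R"
  using assms(1,3)
proof (induction rule: finite_induct)
  case (insert j R)
  then have "Y \<in> R \<rightarrow> carrier B" "(\<lambda>j. e \<ominus> Y j) \<in> R \<rightarrow> carrier B" "finsum B Y R \<in> carrier B"
    using assms(2) by (auto intro!: finsum_closed)
  then show ?case using insert assms(2)
    by (simp add: minus_eq_smult smult_add_left smult_add_right a_ac)
qed (use assms(2) in simp)

text \<open>
  The conditions on \<open>Y j\<close> hold for positive contractions.  If the other summands are \<open>M\<close> in number, then
  \<open>e + Y j / M\<close> is the average of the elements \<open>e - Y i\<close> for \<open>i \<noteq> j\<close>, because \<open>Y j\<close> is minus the sum of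
  the \<open>Y i\<close>, and \<open>e - Y j / M\<close> is a convex combination of \<open>e\<close> and \<open>e - Y j\<close>.  Both lie in the unit ball,
  and \<open>e\<close> is an extreme point.
\<close>

lemma vanishing_sum:
  assumes e: "e \<in> carrier B" "nrm B e \<le> 1" "e \<otimes> e = e" and Q: "finite Q"
    and Y: "\<And>j. j \<in> Q \<Longrightarrow> Y j \<in> carrier B" "\<And>j. j \<in> Q \<Longrightarrow> e \<otimes> Y j = Y j" "\<And>j. j \<in> Q \<Longrightarrow> Y j \<otimes> e = Y j"
    and le: "\<And>j. j \<in> Q \<Longrightarrow> nrm B (e \<ominus> Y j) \<le> 1"
    and sum: "finsum B Y Q = \<zero>" and j: "j \<in> Q"
  shows "Y j = \<zero>"
proof -
  define R where "R = Q - {j}"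
  have R: "finite R" "j \<notin> R" "Q = insert j R" using Q j by (auto simp: R_def)
  have YR: "Y \<in> R \<rightarrow> carrier B" using Y(1) R by auto
  then have cl: "finsum B Y R \<in> carrier B" by (rule finsum_closed)
  have "Y j \<oplus> finsum B Y R = \<zero>" using sum R YR Y(1)[OF j] by simp
  then have Yj: "Y j = \<ominus> finsum B Y R" using Y(1)[OF j] cl by (metis minus_equality a_comm minus_minus)
  show ?thesis
  proof (cases "R = {}")
    case False
    define M where "M = real (card R)"
    have M: "M \<ge> 1" using False R(1) by (simp add: M_def Suc_le_eq card_gt_0_iff)
    define z where "z = complex_of_real (1 / M) \<odot> Y j"
    have z: "z \<in> carrier B" using Y(1)[OF j] by (simp add: z_def)
    have "e \<oplus> z = complex_of_real (1 / M) \<odot> finsum B (\<lambda>j. e \<ominus> Y j) R"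
    proof -
      have "finsum B (\<lambda>j. e \<ominus> Y j) R = complex_of_real M \<odot> e \<oplus> Y j"
        using finsum_unit_minus[OF R(1) e(1), of Y] Y(1) R cl e(1) unfolding Yj by (simp add: M_def minus_eq)
      then show ?thesis using M e(1) Y(1)[OF j] by (simp add: z_def smult_add_right flip: of_real_mult)
    qed
    moreover have "nrm B (finsum B (\<lambda>j. e \<ominus> Y j) R) \<le> M"
    proof -
      have "nrm B (finsum B (\<lambda>j. e \<ominus> Y j) R) \<le> (\<Sum>j\<in>R. nrm B (e \<ominus> Y j))"
        using R e(1) Y(1) by (intro nrm_finsum_le) auto
      also have "\<dots> \<le> (\<Sum>j\<in>R. 1)" using le R by (intro sum_mono) auto
      finally show ?thesis by (simp add: M_def)
    qed
    moreover have "finsum B (\<lambda>j. e \<ominus> Y j) R \<in> carrier B" using e(1) Y(1) R by (intro finsum_closed) auto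
    ultimately have plus: "nrm B (e \<oplus> z) \<le> 1" using M by (simp add: nrm_smult norm_divide)
    have "e \<ominus> z = complex_of_real (1 - 1 / M) \<odot> e \<oplus> complex_of_real (1 / M) \<odot> (e \<ominus> Y j)"
    proof -
      have "complex_of_real (1 - 1 / M) \<odot> e \<oplus> complex_of_real (1 / M) \<odot> e = e"
        using e(1) by (simp flip: smult_add_left)
      then show ?thesis using e(1) Y(1)[OF j]
        by (simp add: z_def minus_eq_smult smult_add_right del: of_real_diff of_real_divide flip: a_assoc)
    qed
    then have "nrm B (e \<ominus> z) \<le> \<bar>1 - 1 / M\<bar> * nrm B e + \<bar>1 / M\<bar> * nrm B (e \<ominus> Y j)"
      using nrm_triangle[of "complex_of_real (1 - 1 / M) \<odot> e" "complex_of_real (1 / M) \<odot> (e \<ominus> Y j)"]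
        e(1) Y(1)[OF j] by (simp only: nrm_smult norm_of_real smult_closed minus_closed)
    also have "\<dots> \<le> \<bar>1 - 1 / M\<bar> * 1 + \<bar>1 / M\<bar> * 1"
      using e(2) le[OF j] by (intro add_mono mult_left_mono) auto
    also have "\<dots> = 1" using M by simp
    finally have minus: "nrm B (e \<ominus> z) \<le> 1" .
    have "z = \<zero>"
      using e(1,2) z e(3) _ _ plus minus by (rule unit_extreme)
        (use e(1) Y[OF j] in \<open>simp_all add: z_def smult_mult_left smult_mult_right\<close>)
    moreover have "Y j = complex_of_real M \<odot> z"
      using M Y(1)[OF j] by (simp add: z_def flip: of_real_mult)
    ultimately show ?thesis by simp
  qed (simp add: Yj)
qed

end

section \<open>Single-vertex 2-graphs\<close>

definition zdeg :: "nat \<times> nat \<Rightarrow> int \<times> int" where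
  "zdeg n = (int (fst n), int (snd n))"

lemma zdeg_add: "zdeg (n + m) = zdeg n + zdeg m"
  by (simp add: zdeg_def)

lemma zdeg_eq_iff [simp]: "zdeg n = zdeg m \<longleftrightarrow> n = m"
  by (auto simp: zdeg_def prod_eq_iff)

lemma pair_le_addE:
  fixes n m :: "nat \<times> nat"
  assumes "n \<le> m"
  obtains l where "m = n + l"
proof (rule that)
  show "m = n + (m - n)" using assms by (auto simp: less_eq_prod_def prod_eq_iff)
qed

lemma pair_le_add [simp]:
  fixes n m :: "nat \<times> nat"
  shows "n \<le> n + m" "n \<le> m + n"
  by (auto simp: less_eq_prod_def)

locale single_vertex_graph = two_graph \<Lambda> for \<Lambda> :: "'a graded_category" +
  fixes v :: 'a
  assumes vertex: "paths \<Lambda> (0, 0) = {v}"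
    and finite_edges: "finite (paths \<Lambda> (1, 0))" "finite (paths \<Lambda> (0, 1))"
    and edges_nonempty: "paths \<Lambda> (1, 0) \<noteq> {}" "paths \<Lambda> (0, 1) \<noteq> {}"
begin

abbreviation conc (infixl "\<cdot>" 75) where "conc \<equiv> cmp \<Lambda>"

lemma mem_pathsD: "\<mu> \<in> paths \<Lambda> n \<Longrightarrow> \<mu> \<in> mor \<Lambda>" "\<mu> \<in> paths \<Lambda> n \<Longrightarrow> deg \<Lambda> \<mu> = n"
  by (auto simp: paths_def)

lemma mem_paths_deg [simp]: "\<mu> \<in> mor \<Lambda> \<Longrightarrow> \<mu> \<in> paths \<Lambda> (deg \<Lambda> \<mu>)"
  by (simp add: paths_def)

lemma vertex_mor [simp]: "v \<in> mor \<Lambda>" and deg_vertex [simp]: "deg \<Lambda> v = 0"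
  using vertex by (auto simp: paths_def zero_prod_def)

lemma rng_eq [simp]: "\<mu> \<in> mor \<Lambda> \<Longrightarrow> rng \<Lambda> \<mu> = v"
  using vertex rng_closed deg_id by (auto simp: paths_def zero_prod_def)

lemma src_eq [simp]: "\<mu> \<in> mor \<Lambda> \<Longrightarrow> src \<Lambda> \<mu> = v"
  by (metis rng_eq rng_src src_closed)

lemma conc_closed [simp]: "\<lbrakk>\<mu> \<in> mor \<Lambda>; \<nu> \<in> mor \<Lambda>\<rbrakk> \<Longrightarrow> \<mu> \<cdot> \<nu> \<in> mor \<Lambda>"
  by (simp add: cmp_closed)

lemma conc_assoc: "\<lbrakk>\<mu> \<in> mor \<Lambda>; \<nu> \<in> mor \<Lambda>; \<alpha> \<in> mor \<Lambda>\<rbrakk> \<Longrightarrow> \<mu> \<cdot> \<nu> \<cdot> \<alpha> = \<mu> \<cdot> (\<nu> \<cdot> \<alpha>)"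
  by (simp add: cmp_assoc)

lemma conc_vertex [simp]: "\<mu> \<in> mor \<Lambda> \<Longrightarrow> v \<cdot> \<mu> = \<mu>" "\<mu> \<in> mor \<Lambda> \<Longrightarrow> \<mu> \<cdot> v = \<mu>"
  using cmp_id_left cmp_id_right by force+

lemma deg_conc [simp]: "\<lbrakk>\<mu> \<in> mor \<Lambda>; \<nu> \<in> mor \<Lambda>\<rbrakk> \<Longrightarrow> deg \<Lambda> (\<mu> \<cdot> \<nu>) = deg \<Lambda> \<mu> + deg \<Lambda> \<nu>"
  by (simp add: deg_cmp)

lemma conc_paths: "\<lbrakk>\<mu> \<in> paths \<Lambda> n; \<nu> \<in> paths \<Lambda> m\<rbrakk> \<Longrightarrow> \<mu> \<cdot> \<nu> \<in> paths \<Lambda> (n + m)"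
  by (simp add: paths_def)

lemma factor_path:
  assumes "\<mu> \<in> paths \<Lambda> (n + m)"
  obtains \<nu> \<alpha> where "\<nu> \<in> paths \<Lambda> n" "\<alpha> \<in> paths \<Lambda> m" "\<mu> = \<nu> \<cdot> \<alpha>"
  using ex1_implies_ex[OF factorization[of \<mu> n m]] assms that by (auto simp: paths_def)

lemma conc_eq_iff:
  assumes "\<mu> \<in> mor \<Lambda>" "\<nu> \<in> mor \<Lambda>" "\<mu>' \<in> mor \<Lambda>" "\<nu>' \<in> mor \<Lambda>" "deg \<Lambda> \<mu> = deg \<Lambda> \<mu>'"
  shows "\<mu> \<cdot> \<nu> = \<mu>' \<cdot> \<nu>' \<longleftrightarrow> \<mu> = \<mu>' \<and> \<nu> = \<nu>'"
proof
  assume eq: "\<mu> \<cdot> \<nu> = \<mu>' \<cdot> \<nu>'"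
  then have "deg \<Lambda> \<nu> = deg \<Lambda> \<nu>'" using assms by (metis add_left_cancel deg_conc)
  let ?P = "\<lambda>(\<alpha>, \<beta>). \<alpha> \<in> mor \<Lambda> \<and> \<beta> \<in> mor \<Lambda> \<and> deg \<Lambda> \<alpha> = deg \<Lambda> \<mu> \<and> deg \<Lambda> \<beta> = deg \<Lambda> \<nu>
            \<and> src \<Lambda> \<alpha> = rng \<Lambda> \<beta> \<and> \<mu> \<cdot> \<nu> = \<alpha> \<cdot> \<beta>"
  have "\<exists>!x. ?P x" using factorization[of "\<mu> \<cdot> \<nu>" "deg \<Lambda> \<mu>" "deg \<Lambda> \<nu>"] assms by simp
  moreover have "?P (\<mu>, \<nu>)" "?P (\<mu>', \<nu>')" using assms eq \<open>deg \<Lambda> \<nu> = deg \<Lambda> \<nu>'\<close> by simp_all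
  ultimately have "(\<mu>, \<nu>) = (\<mu>', \<nu>')" by blast
  then show "\<mu> = \<mu>' \<and> \<nu> = \<nu>'" by simp
qed auto

lemma finite_paths [simp, intro]: "finite (paths \<Lambda> n)"
proof -
  have step: "finite (paths \<Lambda> (n + m))" if "finite (paths \<Lambda> n)" "finite (paths \<Lambda> m)" for n m
  proof (rule finite_subset)
    show "paths \<Lambda> (n + m) \<subseteq> (\<lambda>(\<mu>, \<nu>). \<mu> \<cdot> \<nu>) ` (paths \<Lambda> n \<times> paths \<Lambda> m)"
      by (auto elim!: factor_path)
  qed (use that in blast)
  have "finite (paths \<Lambda> (i, 0))" for i
    by (induction i) (use step[of "(1, 0)" "(_, 0)"] finite_edges vertex in simp_all)
  moreover have "finite (paths \<Lambda> (0, j))" for j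
    by (induction j) (use step[of "(0, 1)" "(0, _)"] finite_edges vertex in simp_all)
  ultimately show ?thesis using step[of "(fst n, 0)" "(0, snd n)"] by simp
qed

lemma paths_nonempty [simp]: "paths \<Lambda> n \<noteq> {}"
proof -
  have step: "paths \<Lambda> (n + m) \<noteq> {}" if "paths \<Lambda> n \<noteq> {}" "paths \<Lambda> m \<noteq> {}" for n m
    using that conc_paths by blast
  have "paths \<Lambda> (i, 0) \<noteq> {}" for i
    by (induction i) (use step[of "(1, 0)" "(_, 0)"] edges_nonempty vertex in simp_all)
  moreover have "paths \<Lambda> (0, j) \<noteq> {}" for j
    by (induction j) (use step[of "(0, 1)" "(0, _)"] edges_nonempty vertex in simp_all)
  ultimately show ?thesis using step[of "(fst n, 0)" "(0, snd n)"] by simp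
qed

end

section \<open>Cuntz-Krieger families\<close>

locale ck_algebra = single_vertex_graph \<Lambda> v + c_star_algebra A
  for \<Lambda> :: "'a graded_category" and v :: 'a and A :: "'c cstar" (structure) +
  fixes s :: "'a \<Rightarrow> 'c"
  assumes ck: "cuntz_krieger_family \<Lambda> v A s"
begin

lemma s_closed [simp]: "\<mu> \<in> mor \<Lambda> \<Longrightarrow> s \<mu> \<in> carrier A"
  using ck by (simp add: cuntz_krieger_family_def)

lemma s_conc: "\<lbrakk>\<mu> \<in> mor \<Lambda>; \<nu> \<in> mor \<Lambda>\<rbrakk> \<Longrightarrow> s (\<mu> \<cdot> \<nu>) = s \<mu> \<otimes> s \<nu>"
  using ck by (simp add: cuntz_krieger_family_def)

lemma star_s_s [simp]: "\<mu> \<in> mor \<Lambda> \<Longrightarrow> star A (s \<mu>) \<otimes> s \<mu> = s v"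
  using ck by (simp add: cuntz_krieger_family_def)

lemma star_unit [simp]: "star A (s v) = s v"
  using ck by (simp add: cuntz_krieger_family_def)

lemma unit_sum: "finsum A (\<lambda>\<mu>. s \<mu> \<otimes> star A (s \<mu>)) (paths \<Lambda> n) = s v"
  using ck by (cases n) (simp add: cuntz_krieger_family_def)

lemma s_unit [simp]:
  assumes "\<mu> \<in> mor \<Lambda>"
  shows "s v \<otimes> s \<mu> = s \<mu>" "s \<mu> \<otimes> s v = s \<mu>"
    "s v \<otimes> star A (s \<mu>) = star A (s \<mu>)" "star A (s \<mu>) \<otimes> s v = star A (s \<mu>)"
proof -
  show 1: "s v \<otimes> s \<mu> = s \<mu>" "s \<mu> \<otimes> s v = s \<mu>" using assms s_conc[of v \<mu>] s_conc[of \<mu> v] by simp_all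
  show "s v \<otimes> star A (s \<mu>) = star A (s \<mu>)" "star A (s \<mu>) \<otimes> s v = star A (s \<mu>)"
    using assms star_mult[of "s \<mu>" "s v"] star_mult[of "s v" "s \<mu>"] 1 by simp_all
qed

lemma nrm_s_le_1: "\<mu> \<in> mor \<Lambda> \<Longrightarrow> nrm A (s \<mu>) \<le> 1"
proof -
  assume \<mu>: "\<mu> \<in> mor \<Lambda>"
  have "nrm A (s v) \<le> 1" by (rule nrm_projection_le_1) auto
  then have "(nrm A (s \<mu>))\<^sup>2 \<le> 1\<^sup>2" using c_star_identity[of "s \<mu>"] \<mu> by simp
  then show ?thesis by (rule power2_le_imp_le) simp
qed

lemma s_unit_left [simp]: "\<lbrakk>\<mu> \<in> mor \<Lambda>; x \<in> carrier A\<rbrakk> \<Longrightarrow> s v \<otimes> (s \<mu> \<otimes> x) = s \<mu> \<otimes> x"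
  "\<lbrakk>\<mu> \<in> mor \<Lambda>; x \<in> carrier A\<rbrakk> \<Longrightarrow> s v \<otimes> (star A (s \<mu>) \<otimes> x) = star A (s \<mu>) \<otimes> x"
  by (simp_all flip: mult_assoc)

lemma star_s_s_left [simp]:
  "\<lbrakk>\<mu> \<in> mor \<Lambda>; x \<in> carrier A\<rbrakk> \<Longrightarrow> star A (s \<mu>) \<otimes> (s \<mu> \<otimes> x) = s v \<otimes> x"
  by (simp flip: mult_assoc)

text \<open>
  Compressing \<open>\<Sum>\<^sub>j s j (s j)\<^sup>* = s v\<close> by \<open>s \<nu>\<close> gives \<open>\<Sum>\<^sub>j Y j = s v\<close>, where \<open>Y \<nu> = s v\<close> already.  Hence the
  positive contractions \<open>Y j\<close> with \<open>j \<noteq> \<nu>\<close> add up to zero, so \<open>Y \<mu> = 0\<close>.  But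
  \<open>Y \<mu> = x\<^sup>* x\<close> with \<open>x = (s \<mu>)\<^sup>* s \<nu>\<close>.
\<close>

theorem star_s_s_orthogonal:
  assumes \<mu>: "\<mu> \<in> paths \<Lambda> n" and \<nu>: "\<nu> \<in> paths \<Lambda> n" and "\<mu> \<noteq> \<nu>"
  shows "star A (s \<mu>) \<otimes> s \<nu> = \<zero>"
proof -
  let ?P = "paths \<Lambda> n"
  define Y where "Y j = star A (s \<nu>) \<otimes> ((s j \<otimes> star A (s j)) \<otimes> s \<nu>)" for j
  note [simp] = mem_pathsD(1)[OF \<mu>] mem_pathsD(1)[OF \<nu>]
  have mor: "j \<in> mor \<Lambda>" if "j \<in> ?P" for j using that by (rule mem_pathsD)
  have Y: "Y j \<in> carrier A" if "j \<in> ?P" for j using mor[OF that] by (simp add: Y_def)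
  have "finsum A Y ?P = star A (s \<nu>) \<otimes> (finsum A (\<lambda>j. s j \<otimes> star A (s j)) ?P \<otimes> s \<nu>)"
    unfolding Y_def using mor by (simp add: finsum_mult_left finsum_mult_right)
  also have "\<dots> = s v" by (simp add: unit_sum)
  finally have sum: "finsum A Y ?P = s v" .
  have "?P = insert \<nu> (?P - {\<nu>})" using \<nu> by auto
  then have "finsum A Y ?P = Y \<nu> \<oplus> finsum A Y (?P - {\<nu>})"
    using Y \<nu> by (metis Diff_iff Pi_I finite_Diff finite_paths finsum_insert insertCI insert_Diff_single)
  moreover have "Y \<nu> = s v" by (simp add: Y_def mult_assoc)
  moreover have "finsum A Y (?P - {\<nu>}) \<in> carrier A" using Y by (intro finsum_closed) auto
  ultimately have zero: "finsum A Y (?P - {\<nu>}) = \<zero>" using sum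
    by (metis add.l_cancel_one' s_closed vertex_mor)
  have "Y \<mu> = \<zero>"
  proof (rule vanishing_sum[of "s v" "?P - {\<nu>}" Y])
    show "nrm A (s v) \<le> 1" by (rule nrm_s_le_1) simp
    fix j assume j: "j \<in> ?P - {\<nu>}"
    then have jm [simp]: "j \<in> mor \<Lambda>" using mor by auto
    show "s v \<otimes> Y j = Y j" "Y j \<otimes> s v = Y j" by (simp_all add: Y_def mult_assoc)
    let ?q = "s v \<ominus> s j \<otimes> star A (s j)"
    have q: "nrm A ?q \<le> 1"
    proof (rule nrm_projection_le_1)
      show "star A ?q = ?q" by (simp add: star_minus star_mult star_star)
      show "?q \<otimes> ?q = ?q" by (simp add: minus_mult_left minus_mult_right mult_assoc)
    qed simp
    have "s v \<ominus> Y j = star A (s \<nu>) \<otimes> (?q \<otimes> s \<nu>)"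
      by (simp add: Y_def minus_mult_left minus_mult_right)
    then have "nrm A (s v \<ominus> Y j) \<le> nrm A (star A (s \<nu>)) * (nrm A ?q * nrm A (s \<nu>))"
      using nrm_mult[of "star A (s \<nu>)" "?q \<otimes> s \<nu>"] nrm_mult[of ?q "s \<nu>"]
      by (simp add: mult_left_mono order_trans[OF nrm_mult])
    also have "\<dots> \<le> 1 * (1 * 1)" using q nrm_s_le_1[of \<nu>] by (intro mult_mono) auto
    finally show "nrm A (s v \<ominus> Y j) \<le> 1" by simp
  qed (use assms zero Y in \<open>auto simp: s_conc[symmetric]\<close>)
  then have "(nrm A (star A (s \<mu>) \<otimes> s \<nu>))\<^sup>2 = 0"
    using c_star_identity[of "star A (s \<mu>) \<otimes> s \<nu>"]
    by (simp add: Y_def star_mult star_star mult_assoc)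
  then show ?thesis by (simp add: nrm_zero_iff)
qed

end

section \<open>Blocks and degrees\<close>

text \<open>
  The factor \<open>4\<^sup>k\<close> is quadratic in the exponent \<open>2\<^sup>k\<close>, which reflects the growth of balls in \<open>\<int>\<^sup>2\<close>; any
  subexponential function of the exponent would do.
\<close>

lemma power_two_power_compare:
  fixes x y C :: real
  assumes "0 \<le> x" "0 \<le> y" and le: "\<And>k. x ^ (2 ^ k) \<le> C * 4 ^ k * y ^ (2 ^ k)"
  shows "x \<le> y"
proof (rule ccontr)
  assume "\<not> x \<le> y"
  then have xy: "y < x" by simp
  show False
  proof (cases "y = 0")
    case False
    then have y: "0 < y" using assms by simp
    define r where "r = x / y"
    have r: "1 < r" using xy y by (simp add: r_def)
    have "(\<lambda>n::nat. C * real n ^ 2 / r ^ n) \<longlonglongrightarrow> 0" using r by real_asymp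
    then have "\<forall>\<^sub>F n in sequentially. C * real n ^ 2 / r ^ n < 1" by (rule order_tendstoD) simp
    then obtain N where N: "\<And>n. n \<ge> N \<Longrightarrow> C * real n ^ 2 / r ^ n < 1" by (auto simp: eventually_sequentially)
    have "N \<le> 2 ^ N" using less_exp[of N] by simp
    from N[OF this] have "C * (2 ^ N)\<^sup>2 < r ^ (2 ^ N)" using r by (simp add: divide_less_eq)
    also have "r ^ (2 ^ N) \<le> C * 4 ^ N"
      using le[of N] y by (simp add: r_def power_divide divide_le_eq)
    also have "\<dots> = C * (2 ^ N)\<^sup>2" by (simp add: power2_eq_square flip: power_mult_distrib)
    finally show False by simp
  qed (use le[of 0] xy in simp)
qed

context ck_algebra
begin

text \<open>
  A \<open>block p q\<close> consists of matrices over \<open>paths \<Lambda> p \<times> paths \<Lambda> q\<close>, with matrix units \<open>s \<mu> (s \<nu>)\<^sup>*\<close>.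
\<close>

definition block :: "nat \<times> nat \<Rightarrow> nat \<times> nat \<Rightarrow> 'c set" where
  "block p q = lspan A {s \<mu> \<otimes> star A (s \<nu>) | \<mu> \<nu>. \<mu> \<in> paths \<Lambda> p \<and> \<nu> \<in> paths \<Lambda> q}"

text \<open>
  For a single degree \<open>m\<close> this is the spectral subspace of the gauge action inside the span of the monomials.
\<close>

definition graded :: "(int \<times> int) set \<Rightarrow> 'c set" where
  "graded S = lspan A {s \<mu> \<otimes> star A (s \<nu>) | \<mu> \<nu>.
     \<mu> \<in> mor \<Lambda> \<and> \<nu> \<in> mor \<Lambda> \<and> zdeg (deg \<Lambda> \<mu>) - zdeg (deg \<Lambda> \<nu>) \<in> S}"

lemma block_gens: "{s \<mu> \<otimes> star A (s \<nu>) | \<mu> \<nu>. \<mu> \<in> paths \<Lambda> p \<and> \<nu> \<in> paths \<Lambda> q} \<subseteq> carrier A"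
  by (auto simp: paths_def)

lemma graded_gens: "{s \<mu> \<otimes> star A (s \<nu>) | \<mu> \<nu>.
     \<mu> \<in> mor \<Lambda> \<and> \<nu> \<in> mor \<Lambda> \<and> zdeg (deg \<Lambda> \<mu>) - zdeg (deg \<Lambda> \<nu>) \<in> S} \<subseteq> carrier A"
  by auto

lemma block_closed: "x \<in> block p q \<Longrightarrow> x \<in> carrier A"
  unfolding block_def by (rule lspan_closed[OF _ block_gens])

lemma graded_closed: "x \<in> graded S \<Longrightarrow> x \<in> carrier A"
  unfolding graded_def by (rule lspan_closed[OF _ graded_gens])

lemma block_gen: "\<lbrakk>\<mu> \<in> paths \<Lambda> p; \<nu> \<in> paths \<Lambda> q\<rbrakk> \<Longrightarrow> s \<mu> \<otimes> star A (s \<nu>) \<in> block p q"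
  unfolding block_def by (rule lspan_gen[OF _ block_gens]) auto

lemma graded_gen:
  "\<lbrakk>\<mu> \<in> mor \<Lambda>; \<nu> \<in> mor \<Lambda>; zdeg (deg \<Lambda> \<mu>) - zdeg (deg \<Lambda> \<nu>) \<in> S\<rbrakk> \<Longrightarrow> s \<mu> \<otimes> star A (s \<nu>) \<in> graded S"
  unfolding graded_def by (rule lspan_gen[OF _ graded_gens]) auto

lemma s_in_block: "\<mu> \<in> paths \<Lambda> p \<Longrightarrow> s \<mu> \<in> block p 0"
  using block_gen[of \<mu> p v 0] by (auto simp: paths_def)

lemma graded_mono:
  assumes "x \<in> graded S" and "S \<subseteq> T"
  shows "x \<in> graded T"
  unfolding graded_def
proof (rule lspan_subset[OF graded_gens[of S] graded_gens[of T] _ assms(1)[unfolded graded_def]])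
  fix g assume "g \<in> {s \<mu> \<otimes> star A (s \<nu>) | \<mu> \<nu>.
     \<mu> \<in> mor \<Lambda> \<and> \<nu> \<in> mor \<Lambda> \<and> zdeg (deg \<Lambda> \<mu>) - zdeg (deg \<Lambda> \<nu>) \<in> S}"
  then show "g \<in> lspan A {s \<mu> \<otimes> star A (s \<nu>) | \<mu> \<nu>.
     \<mu> \<in> mor \<Lambda> \<and> \<nu> \<in> mor \<Lambda> \<and> zdeg (deg \<Lambda> \<mu>) - zdeg (deg \<Lambda> \<nu>) \<in> T}"
    using assms(2) by (intro lspan_gen[OF _ graded_gens]) blast
qed

lemma block_graded: "x \<in> block p q \<Longrightarrow> x \<in> graded {zdeg p - zdeg q}"
  unfolding block_def graded_def
proof (erule lspan_subset[OF block_gens graded_gens, rotated], elim CollectE exE conjE)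
  fix g \<mu> \<nu> assume "g = s \<mu> \<otimes> star A (s \<nu>)" "\<mu> \<in> paths \<Lambda> p" "\<nu> \<in> paths \<Lambda> q"
  then show "g \<in> lspan A {s \<mu> \<otimes> star A (s \<nu>) | \<mu> \<nu>.
     \<mu> \<in> mor \<Lambda> \<and> \<nu> \<in> mor \<Lambda> \<and> zdeg (deg \<Lambda> \<mu>) - zdeg (deg \<Lambda> \<nu>) \<in> {zdeg p - zdeg q}}"
    by (intro lspan_gen[OF _ graded_gens]) (auto simp: paths_def)
qed

text \<open>
  Multiplication by the units \<open>\<Sum>\<^sub>\<kappa> s \<kappa> (s \<kappa>)\<^sup>*\<close> and \<open>\<Sum>\<^sub>\<tau> s \<tau> (s \<tau>)\<^sup>*\<close> prolongs both paths to the degree \<open>q + p\<close>, where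
  the orthogonality of ranges leaves only the common extensions.
\<close>

lemma star_s_s_expand:
  assumes \<nu>: "\<nu> \<in> paths \<Lambda> q" and \<alpha>: "\<alpha> \<in> paths \<Lambda> p"
  shows "star A (s \<nu>) \<otimes> s \<alpha> \<in> lspan A {s \<kappa> \<otimes> star A (s \<tau>) | \<kappa> \<tau>.
    \<kappa> \<in> paths \<Lambda> p \<and> \<tau> \<in> paths \<Lambda> q \<and> \<nu> \<cdot> \<kappa> = \<alpha> \<cdot> \<tau>}" (is "?X \<in> lspan A ?G")
proof -
  note [simp] = mem_pathsD(1)[OF \<nu>] mem_pathsD(1)[OF \<alpha>]
  have G: "?G \<subseteq> carrier A" by (auto simp: paths_def)
  have X: "?X \<in> carrier A" "s v \<otimes> ?X = ?X" "?X \<otimes> s v = ?X" by (simp_all add: mult_assoc)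
  let ?t = "\<lambda>\<kappa> \<tau>. (s \<kappa> \<otimes> star A (s \<kappa>) \<otimes> ?X) \<otimes> (s \<tau> \<otimes> star A (s \<tau>))"
  have pm: "\<kappa> \<in> mor \<Lambda>" if "\<kappa> \<in> paths \<Lambda> r" for \<kappa> r using that by (rule mem_pathsD)
  have inner: "finsum A (?t \<kappa>) (paths \<Lambda> q) = s \<kappa> \<otimes> star A (s \<kappa>) \<otimes> ?X" if "\<kappa> \<in> paths \<Lambda> p" for \<kappa>
  proof -
    have "finsum A (?t \<kappa>) (paths \<Lambda> q)
        = (s \<kappa> \<otimes> star A (s \<kappa>) \<otimes> ?X) \<otimes> finsum A (\<lambda>\<tau>. s \<tau> \<otimes> star A (s \<tau>)) (paths \<Lambda> q)"
      using pm that X(1) by (intro finsum_mult_left[symmetric]) auto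
    then show ?thesis using pm[OF that] X by (simp add: unit_sum mult_assoc)
  qed
  have "?X = finsum A (\<lambda>\<kappa>. s \<kappa> \<otimes> star A (s \<kappa>)) (paths \<Lambda> p) \<otimes> ?X" using X by (simp add: unit_sum)
  also have "\<dots> = finsum A (\<lambda>\<kappa>. s \<kappa> \<otimes> star A (s \<kappa>) \<otimes> ?X) (paths \<Lambda> p)"
    using pm X(1) by (intro finsum_mult_right) auto
  also have "\<dots> = finsum A (\<lambda>\<kappa>. finsum A (?t \<kappa>) (paths \<Lambda> q)) (paths \<Lambda> p)"
    using pm X(1) by (intro finsum_cong') (auto simp: inner)
  also have "\<dots> \<in> lspan A ?G"
  proof (intro lspan_finsum[OF G] finite_paths)
    fix \<kappa> \<tau> assume \<kappa>: "\<kappa> \<in> paths \<Lambda> p" and \<tau>: "\<tau> \<in> paths \<Lambda> q"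
    note [simp] = mem_pathsD(1)[OF \<kappa>] mem_pathsD(1)[OF \<tau>]
    have eq: "?t \<kappa> \<tau> = s \<kappa> \<otimes> ((star A (s (\<nu> \<cdot> \<kappa>)) \<otimes> s (\<alpha> \<cdot> \<tau>)) \<otimes> star A (s \<tau>))"
      by (simp add: s_conc star_mult mult_assoc)
    show "?t \<kappa> \<tau> \<in> lspan A ?G"
    proof (cases "\<nu> \<cdot> \<kappa> = \<alpha> \<cdot> \<tau>")
      case True
      then have "?t \<kappa> \<tau> = s \<kappa> \<otimes> star A (s \<tau>)" unfolding eq by simp
      then show ?thesis using True \<kappa> \<tau> by (auto intro!: lspan_gen[OF _ G])
    next
      case False
      have "star A (s (\<nu> \<cdot> \<kappa>)) \<otimes> s (\<alpha> \<cdot> \<tau>) = \<zero>"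
        using conc_paths[OF \<nu> \<kappa>] conc_paths[OF \<alpha> \<tau>] False
        by (intro star_s_s_orthogonal[of _ "q + p"]) (simp_all add: add.commute)
      then show ?thesis unfolding eq by (simp add: lspan.zero)
    qed
  qed
  finally show ?thesis .
qed

lemma star_s_s_no_common_extension:
  assumes "\<nu> \<in> mor \<Lambda>" "\<alpha> \<in> mor \<Lambda>" and "\<And>\<kappa> \<tau>. \<lbrakk>\<kappa> \<in> mor \<Lambda>; \<tau> \<in> mor \<Lambda>\<rbrakk> \<Longrightarrow> \<nu> \<cdot> \<kappa> \<noteq> \<alpha> \<cdot> \<tau>"
  shows "star A (s \<nu>) \<otimes> s \<alpha> = \<zero>"
proof -
  have empty: "{s \<kappa> \<otimes> star A (s \<tau>) | \<kappa> \<tau>. \<kappa> \<in> paths \<Lambda> (deg \<Lambda> \<alpha>) \<and> \<tau> \<in> paths \<Lambda> (deg \<Lambda> \<nu>) \<and> \<nu> \<cdot> \<kappa> = \<alpha> \<cdot> \<tau>} = {}"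
    using assms(3) by (auto simp: paths_def)
  have "star A (s \<nu>) \<otimes> s \<alpha> \<in> lspan A {}"
    using star_s_s_expand[OF mem_paths_deg[OF assms(1)] mem_paths_deg[OF assms(2)]] by (simp only: empty)
  then show ?thesis by (cases rule: lspan.cases) auto
qed

lemma block_mult:
  assumes "x \<in> block p q" "y \<in> block q r"
  shows "x \<otimes> y \<in> block p r"
  unfolding block_def
proof (rule lspan_mult[OF block_gens block_gens block_gens _ assms[unfolded block_def]])
  fix g g'
  assume "g \<in> {s \<mu> \<otimes> star A (s \<nu>) | \<mu> \<nu>. \<mu> \<in> paths \<Lambda> p \<and> \<nu> \<in> paths \<Lambda> q}"
    and "g' \<in> {s \<mu> \<otimes> star A (s \<nu>) | \<mu> \<nu>. \<mu> \<in> paths \<Lambda> q \<and> \<nu> \<in> paths \<Lambda> r}"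
  then obtain \<mu> \<nu> \<alpha> \<beta> where g: "g = s \<mu> \<otimes> star A (s \<nu>)" "g' = s \<alpha> \<otimes> star A (s \<beta>)"
    and p: "\<mu> \<in> paths \<Lambda> p" "\<nu> \<in> paths \<Lambda> q" "\<alpha> \<in> paths \<Lambda> q" "\<beta> \<in> paths \<Lambda> r" by blast
  note [simp] = p[THEN mem_pathsD(1)]
  have eq: "g \<otimes> g' = s \<mu> \<otimes> ((star A (s \<nu>) \<otimes> s \<alpha>) \<otimes> star A (s \<beta>))" by (simp add: g mult_assoc)
  have "g \<otimes> g' \<in> block p r"
  proof (cases "\<nu> = \<alpha>")
    case True
    then show ?thesis unfolding eq using p by (simp add: block_gen)
  next
    case False
    then have "star A (s \<nu>) \<otimes> s \<alpha> = \<zero>" using p by (intro star_s_s_orthogonal)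
    then show ?thesis unfolding eq by (simp add: block_def lspan.zero)
  qed
  then show "g \<otimes> g' \<in> lspan A {s \<mu> \<otimes> star A (s \<nu>) | \<mu> \<nu>. \<mu> \<in> paths \<Lambda> p \<and> \<nu> \<in> paths \<Lambda> r}"
    by (simp add: block_def)
qed

lemma block_star: "x \<in> block p q \<Longrightarrow> star A x \<in> block q p"
  unfolding block_def
proof (erule lspan_star[OF block_gens block_gens, rotated], elim CollectE exE conjE)
  fix g \<mu> \<nu> assume "g = s \<mu> \<otimes> star A (s \<nu>)" and p: "\<mu> \<in> paths \<Lambda> p" "\<nu> \<in> paths \<Lambda> q"
  then have "star A g = s \<nu> \<otimes> star A (s \<mu>)" by (simp add: paths_def star_mult star_star)
  then show "star A g \<in> lspan A {s \<mu> \<otimes> star A (s \<nu>) | \<mu> \<nu>. \<mu> \<in> paths \<Lambda> q \<and> \<nu> \<in> paths \<Lambda> p}"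
    using p by (intro lspan_gen[OF _ block_gens]) blast
qed

lemma graded_star: "x \<in> graded S \<Longrightarrow> star A x \<in> graded (uminus ` S)"
  unfolding graded_def
proof (erule lspan_star[OF graded_gens graded_gens, rotated], elim CollectE exE conjE)
  fix g \<mu> \<nu> assume "g = s \<mu> \<otimes> star A (s \<nu>)" and p: "\<mu> \<in> mor \<Lambda>" "\<nu> \<in> mor \<Lambda>"
    "zdeg (deg \<Lambda> \<mu>) - zdeg (deg \<Lambda> \<nu>) \<in> S"
  then have "star A g = s \<nu> \<otimes> star A (s \<mu>)" by (simp add: star_mult star_star)
  moreover have "zdeg (deg \<Lambda> \<nu>) - zdeg (deg \<Lambda> \<mu>) \<in> uminus ` S"
    using imageI[OF p(3), of uminus] by (simp only: minus_diff_eq)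
  ultimately show "star A g \<in> lspan A {s \<mu> \<otimes> star A (s \<nu>) | \<mu> \<nu>.
     \<mu> \<in> mor \<Lambda> \<and> \<nu> \<in> mor \<Lambda> \<and> zdeg (deg \<Lambda> \<mu>) - zdeg (deg \<Lambda> \<nu>) \<in> uminus ` S}"
    using p(1,2) by (intro lspan_gen[OF _ graded_gens]) blast
qed

text \<open>
  The middle factor \<open>(s \<nu>)\<^sup>* s \<alpha>\<close> of a product of two monomials expands into monomials of degree
  \<open>deg \<alpha> - deg \<nu>\<close>.
\<close>

lemma graded_mult:
  assumes "x \<in> graded S" "y \<in> graded T"
  shows "x \<otimes> y \<in> graded {m + n | m n. m \<in> S \<and> n \<in> T}"
  unfolding graded_def
proof (rule lspan_mult[OF graded_gens graded_gens graded_gens _ assms[unfolded graded_def]], elim CollectE exE conjE)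
  fix g g' \<mu> \<nu> \<alpha> \<beta>
  assume g: "g = s \<mu> \<otimes> star A (s \<nu>)" "g' = s \<alpha> \<otimes> star A (s \<beta>)"
    and [simp]: "\<mu> \<in> mor \<Lambda>" "\<nu> \<in> mor \<Lambda>" "\<alpha> \<in> mor \<Lambda>" "\<beta> \<in> mor \<Lambda>"
    and S: "zdeg (deg \<Lambda> \<mu>) - zdeg (deg \<Lambda> \<nu>) \<in> S" and T: "zdeg (deg \<Lambda> \<alpha>) - zdeg (deg \<Lambda> \<beta>) \<in> T"
  let ?K = "{s \<mu> \<otimes> star A (s \<nu>) | \<mu> \<nu>. \<mu> \<in> mor \<Lambda> \<and> \<nu> \<in> mor \<Lambda> \<and>
     zdeg (deg \<Lambda> \<mu>) - zdeg (deg \<Lambda> \<nu>) \<in> {m + n | m n. m \<in> S \<and> n \<in> T}}"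
  have eq: "g \<otimes> g' = s \<mu> \<otimes> (star A (s \<nu>) \<otimes> s \<alpha>) \<otimes> star A (s \<beta>)" by (simp add: g mult_assoc)
  show "g \<otimes> g' \<in> lspan A ?K"
    unfolding eq
  proof (rule lspan_sandwich[OF _ graded_gens _ _ _ star_s_s_expand[of \<nu> "deg \<Lambda> \<nu>" \<alpha> "deg \<Lambda> \<alpha>"]],
      goal_cases)
    case (4 g)
    then obtain \<kappa> \<tau> where g: "g = s \<kappa> \<otimes> star A (s \<tau>)" and \<kappa>: "\<kappa> \<in> paths \<Lambda> (deg \<Lambda> \<alpha>)"
      and \<tau>: "\<tau> \<in> paths \<Lambda> (deg \<Lambda> \<nu>)" by blast
    note [simp] = mem_pathsD[OF \<kappa>] mem_pathsD[OF \<tau>]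
    have "s \<mu> \<otimes> g \<otimes> star A (s \<beta>) = s (\<mu> \<cdot> \<kappa>) \<otimes> star A (s (\<beta> \<cdot> \<tau>))"
      by (simp add: g s_conc star_mult mult_assoc)
    moreover have mem: "zdeg (deg \<Lambda> (\<mu> \<cdot> \<kappa>)) - zdeg (deg \<Lambda> (\<beta> \<cdot> \<tau>)) \<in> {m + n | m n. m \<in> S \<and> n \<in> T}"
      using S T by (intro CollectI exI[of _ "zdeg (deg \<Lambda> \<mu>) - zdeg (deg \<Lambda> \<nu>)"]
          exI[of _ "zdeg (deg \<Lambda> \<alpha>) - zdeg (deg \<Lambda> \<beta>)"]) (simp add: zdeg_add)
    have "s (\<mu> \<cdot> \<kappa>) \<otimes> star A (s (\<beta> \<cdot> \<tau>)) \<in> graded {m + n | m n. m \<in> S \<and> n \<in> T}"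
      by (rule graded_gen[OF conc_closed conc_closed mem]) simp_all
    ultimately show ?case by (simp only: graded_def)
  qed (auto simp: paths_def)
qed

lemma graded_add: "\<lbrakk>x \<in> graded S; y \<in> graded S\<rbrakk> \<Longrightarrow> x \<oplus> y \<in> graded S"
  unfolding graded_def by (rule lspan_add[OF graded_gens])

lemma graded_smult: "x \<in> graded S \<Longrightarrow> c \<odot> x \<in> graded S"
  unfolding graded_def by (rule lspan_smult[OF graded_gens])

lemma graded_unit:
  assumes "x \<in> graded S"
  shows "x \<otimes> s v = x"
  using assms unfolding graded_def
proof (induction rule: lspan.induct)
  case (add g x c)
  then have "x \<in> carrier A" using lspan_closed[OF _ graded_gens] by blast
  with add show ?case by (auto simp: distr_left smult_mult_left mult_assoc)
qed simp

lemma graded_finite_support: "x \<in> graded S \<Longrightarrow> \<exists>T. finite T \<and> T \<subseteq> S \<and> x \<in> graded T"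
  unfolding graded_def[of S]
proof (induction rule: lspan.induct)
  case zero
  then show ?case by (intro exI[of _ "{}"]) (simp add: graded_def lspan.zero)
next
  case (add g x c)
  then obtain T \<mu> \<nu> where T: "finite T" "T \<subseteq> S" "x \<in> graded T" and g: "g = s \<mu> \<otimes> star A (s \<nu>)"
    "\<mu> \<in> mor \<Lambda>" "\<nu> \<in> mor \<Lambda>" "zdeg (deg \<Lambda> \<mu>) - zdeg (deg \<Lambda> \<nu>) \<in> S" by blast
  let ?T = "insert (zdeg (deg \<Lambda> \<mu>) - zdeg (deg \<Lambda> \<nu>)) T"
  have "g \<in> graded ?T" using g by (auto intro!: graded_gen)
  moreover have "x \<in> graded ?T" using graded_mono[OF T(3)] by blast
  ultimately have "c \<odot> g \<oplus> x \<in> graded ?T" by (intro graded_add graded_smult)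
  then show ?case using T g by (intro exI[of _ ?T]) auto
qed

lemma graded_decompose:
  assumes "finite S" "x \<in> graded S"
  obtains f where "\<And>m. m \<in> S \<Longrightarrow> f m \<in> graded {m}" "x = finsum A f S"
proof -
  have "\<exists>f. (\<forall>m\<in>S. f m \<in> graded {m}) \<and> x = finsum A f S"
    using assms(2) unfolding graded_def[of S]
  proof (induction rule: lspan.induct)
    case zero
    show ?case by (intro exI[of _ "\<lambda>_. \<zero>"]) (simp add: graded_def lspan.zero)
  next
    case (add g x c)
    then obtain f \<mu> \<nu> where f: "\<And>m. m \<in> S \<Longrightarrow> f m \<in> graded {m}" "x = finsum A f S"
      and g: "g = s \<mu> \<otimes> star A (s \<nu>)" "\<mu> \<in> mor \<Lambda>" "\<nu> \<in> mor \<Lambda>" "zdeg (deg \<Lambda> \<mu>) - zdeg (deg \<Lambda> \<nu>) \<in> S"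
      by blast
    let ?m = "zdeg (deg \<Lambda> \<mu>) - zdeg (deg \<Lambda> \<nu>)"
    let ?g = "\<lambda>m. if ?m = m then c \<odot> g else \<zero>"
    have gm: "?g m \<in> graded {m}" for m
      using g by (auto intro!: graded_smult graded_gen) (simp add: graded_def lspan.zero)
    have "?g \<in> S \<rightarrow> carrier A" "f \<in> S \<rightarrow> carrier A"
      using graded_closed[OF gm] graded_closed[OF f(1)] by blast+
    then have "finsum A (\<lambda>m. ?g m \<oplus> f m) S = finsum A ?g S \<oplus> finsum A f S" by (rule finsum_addf)
    also have "finsum A ?g S = c \<odot> g" using assms(1) g by (intro finsum_singleton) auto
    finally have sum: "c \<odot> g \<oplus> x = finsum A (\<lambda>m. ?g m \<oplus> f m) S" using f by simp
    have "\<forall>m\<in>S. ?g m \<oplus> f m \<in> graded {m}" by (intro ballI graded_add[OF gm f(1)])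
    then show ?case using sum by (rule exI[of _ "\<lambda>m. ?g m \<oplus> f m", OF conjI])
  qed
  then show thesis using that by blast
qed

text \<open>
  Inserting \<open>\<Sum>\<^sub>\<kappa> s \<kappa> (s \<kappa>)\<^sup>*\<close> between \<open>s \<mu>\<close> and \<open>(s \<nu>)\<^sup>*\<close> prolongs both paths by \<open>\<kappa>\<close>.
\<close>

lemma block_refine:
  assumes "x \<in> block p q"
  shows "x \<in> block (p + l) (q + l)"
proof -
  have gen: "s \<mu> \<otimes> star A (s \<nu>) \<in> block (p + l) (q + l)" if "\<mu> \<in> paths \<Lambda> p" "\<nu> \<in> paths \<Lambda> q" for \<mu> \<nu>
  proof -
    note [simp] = that[THEN mem_pathsD(1)]
    have pm: "\<kappa> \<in> mor \<Lambda>" if "\<kappa> \<in> paths \<Lambda> l" for \<kappa> using that by (rule mem_pathsD)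
    have "s \<mu> \<otimes> star A (s \<nu>) = s \<mu> \<otimes> (finsum A (\<lambda>\<kappa>. s \<kappa> \<otimes> star A (s \<kappa>)) (paths \<Lambda> l) \<otimes> star A (s \<nu>))"
      by (simp add: unit_sum)
    also have "\<dots> = finsum A (\<lambda>\<kappa>. s \<mu> \<otimes> ((s \<kappa> \<otimes> star A (s \<kappa>)) \<otimes> star A (s \<nu>))) (paths \<Lambda> l)"
      using pm by (simp add: finsum_mult_left finsum_mult_right)
    also have "\<dots> = finsum A (\<lambda>\<kappa>. s (\<mu> \<cdot> \<kappa>) \<otimes> star A (s (\<nu> \<cdot> \<kappa>))) (paths \<Lambda> l)"
      using pm by (intro finsum_cong') (auto simp: s_conc star_mult mult_assoc)
    also have "\<dots> \<in> block (p + l) (q + l)"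
      unfolding block_def using that conc_paths
      by (intro lspan_finsum[OF block_gens] finite_paths lspan_gen[OF _ block_gens]) blast
    finally show ?thesis .
  qed
  show ?thesis
    using assms unfolding block_def
    by (rule lspan_subset[OF block_gens block_gens, rotated]) (use gen in \<open>auto simp: block_def\<close>)
qed

text \<open>
  After refinement, finitely many homogeneous elements have a common source degree \<open>q\<close>, which may be chosen
  as large as desired.
\<close>

lemma homogeneous_in_block:
  assumes "w \<in> graded {m}"
  shows "\<exists>q0. \<forall>q\<ge>q0. \<exists>p. zdeg p = zdeg q + m \<and> w \<in> block p q"
  using assms unfolding graded_def
proof (induction rule: lspan.induct)
  case zero
  have "\<exists>p. zdeg p = zdeg q + m \<and> \<zero> \<in> block p q" if "q \<ge> (nat \<bar>fst m\<bar>, nat \<bar>snd m\<bar>)" for q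
    using that by (intro exI[of _ "(nat (int (fst q) + fst m), nat (int (snd q) + snd m))"])
      (auto simp: zdeg_def prod_eq_iff less_eq_prod_def block_def lspan.zero)
  then show ?case by blast
next
  case (add g x c)
  then obtain q0 \<mu> \<nu> where q0: "\<And>q. q \<ge> q0 \<Longrightarrow> \<exists>p. zdeg p = zdeg q + m \<and> x \<in> block p q"
    and g: "g = s \<mu> \<otimes> star A (s \<nu>)" "\<mu> \<in> mor \<Lambda>" "\<nu> \<in> mor \<Lambda>" "zdeg (deg \<Lambda> \<mu>) - zdeg (deg \<Lambda> \<nu>) = m" by blast
  have "\<exists>p. zdeg p = zdeg q + m \<and> c \<odot> g \<oplus> x \<in> block p q" if q: "q \<ge> q0 + deg \<Lambda> \<nu>" for q
  proof -
    obtain l where l: "q = q0 + deg \<Lambda> \<nu> + l" using q by (rule pair_le_addE)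
    have "q0 \<le> q" using q by (auto simp: less_eq_prod_def)
    then obtain p where p: "zdeg p = zdeg q + m" "x \<in> block p q" using q0 by blast
    have "p = deg \<Lambda> \<mu> + (q0 + l)" using p(1) g(4) l
      by (subst zdeg_eq_iff[symmetric]) (auto simp: zdeg_add)
    moreover have "g \<in> block (deg \<Lambda> \<mu> + (q0 + l)) (deg \<Lambda> \<nu> + (q0 + l))"
      using g by (intro block_refine) (simp add: block_gen)
    ultimately have "g \<in> block p q" using l by (simp add: add_ac)
    with p show ?thesis
      unfolding block_def by (intro exI[of _ p] conjI lspan_add[OF block_gens] lspan_smult[OF block_gens])
  qed
  then show ?case by blast
qed

lemma block_entry:
  assumes m: "m \<in> block q q" and \<mu>: "\<mu> \<in> paths \<Lambda> q" and \<nu>: "\<nu> \<in> paths \<Lambda> q"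
  shows "\<exists>c. star A (s \<mu>) \<otimes> (m \<otimes> s \<nu>) = c \<odot> s v"
  using m unfolding block_def
proof (induction rule: lspan.induct)
  case zero
  then show ?case using \<mu> \<nu> by (intro exI[of _ 0]) (simp add: mem_pathsD)
next
  case (add g x c)
  note [simp] = mem_pathsD(1)[OF \<mu>] mem_pathsD(1)[OF \<nu>]
  obtain \<alpha> \<beta> where g: "g = s \<alpha> \<otimes> star A (s \<beta>)" and p: "\<alpha> \<in> paths \<Lambda> q" "\<beta> \<in> paths \<Lambda> q" using add by blast
  note [simp] = p[THEN mem_pathsD(1)]
  have x [simp]: "x \<in> carrier A" using add lspan_closed[OF _ block_gens] by blast
  obtain d where d: "star A (s \<mu>) \<otimes> (x \<otimes> s \<nu>) = d \<odot> s v" using add by blast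
  have "\<exists>e. star A (s \<mu>) \<otimes> (g \<otimes> s \<nu>) = e \<odot> s v"
  proof (cases "\<mu> = \<alpha> \<and> \<beta> = \<nu>")
    case True
    then show ?thesis by (intro exI[of _ 1]) (simp add: g mult_assoc)
  next
    case False
    have "star A (s \<mu>) \<otimes> (g \<otimes> s \<nu>) = (star A (s \<mu>) \<otimes> s \<alpha>) \<otimes> (star A (s \<beta>) \<otimes> s \<nu>)" by (simp add: g mult_assoc)
    also have "\<dots> = \<zero>" using False star_s_s_orthogonal[OF \<mu> p(1)] star_s_s_orthogonal[OF p(2) \<nu>] by auto
    finally show ?thesis by (intro exI[of _ 0]) simp
  qed
  then obtain e where e: "star A (s \<mu>) \<otimes> (g \<otimes> s \<nu>) = e \<odot> s v" by blast
  have "star A (s \<mu>) \<otimes> ((c \<odot> g \<oplus> x) \<otimes> s \<nu>) = (c * e + d) \<odot> s v"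
    using e d by (simp add: g distr_left distr_right smult_mult_left smult_mult_right smult_add_left)
  then show ?case by blast
qed

text \<open>
  The estimate by the number of entries is crude, but the number depends on \<open>q\<close> only and not on the matrix.
  It therefore disappears when the estimate is applied to high powers.
\<close>

lemma nrm_block_le:
  assumes m: "m \<in> block q q" and L: "0 \<le> L"
    and entry: "\<And>\<mu> \<nu> c. \<lbrakk>\<mu> \<in> paths \<Lambda> q; \<nu> \<in> paths \<Lambda> q; star A (s \<mu>) \<otimes> (m \<otimes> s \<nu>) = c \<odot> s v\<rbrakk> \<Longrightarrow> cmod c \<le> L"
  shows "nrm A m \<le> (real (card (paths \<Lambda> q)))\<^sup>2 * L"
proof -
  let ?P = "paths \<Lambda> q"
  have mc: "m \<in> carrier A" using m by (rule block_closed)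
  have pm: "\<kappa> \<in> mor \<Lambda>" if "\<kappa> \<in> ?P" for \<kappa> using that by (rule mem_pathsD)
  have m1: "m \<otimes> s v = m" using block_graded[OF m] by (rule graded_unit)
  have "star A m \<otimes> s v = star A m" using block_graded[OF block_star[OF m]] by (rule graded_unit)
  then have "star A (star A m \<otimes> s v) = star A (star A m)" by simp
  then have m2: "s v \<otimes> m = m" using mc by (simp add: star_mult star_star)
  let ?t = "\<lambda>\<mu> \<nu>. (s \<mu> \<otimes> star A (s \<mu>)) \<otimes> (m \<otimes> (s \<nu> \<otimes> star A (s \<nu>)))"
  have t: "nrm A (?t \<mu> \<nu>) \<le> L" "?t \<mu> \<nu> \<in> carrier A" if \<mu>: "\<mu> \<in> ?P" and \<nu>: "\<nu> \<in> ?P" for \<mu> \<nu>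
  proof -
    note [simp] = pm[OF \<mu>] pm[OF \<nu>]
    obtain c where c: "star A (s \<mu>) \<otimes> (m \<otimes> s \<nu>) = c \<odot> s v" using block_entry[OF m \<mu> \<nu>] by blast
    have "?t \<mu> \<nu> = s \<mu> \<otimes> ((star A (s \<mu>) \<otimes> (m \<otimes> s \<nu>)) \<otimes> star A (s \<nu>))" using mc by (simp add: mult_assoc)
    also have "\<dots> = c \<odot> (s \<mu> \<otimes> star A (s \<nu>))" unfolding c by (simp add: smult_mult_left smult_mult_right)
    finally have "nrm A (?t \<mu> \<nu>) = cmod c * nrm A (s \<mu> \<otimes> star A (s \<nu>))" by (simp add: nrm_smult)
    also have "\<dots> \<le> L * 1"
    proof (rule mult_mono[OF entry[OF \<mu> \<nu> c] _ L])
      have "nrm A (s \<mu>) * nrm A (s \<nu>) \<le> 1 * 1" by (intro mult_mono nrm_s_le_1) auto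
      then show "nrm A (s \<mu> \<otimes> star A (s \<nu>)) \<le> 1" using nrm_mult[of "s \<mu>" "star A (s \<nu>)"] by simp
    qed simp
    finally show "nrm A (?t \<mu> \<nu>) \<le> L" by simp
    show "?t \<mu> \<nu> \<in> carrier A" using mc by simp
  qed
  let ?u = "finsum A (\<lambda>\<kappa>. s \<kappa> \<otimes> star A (s \<kappa>)) ?P"
  have "m = ?u \<otimes> (m \<otimes> ?u)" using m1 m2 by (simp add: unit_sum)
  also have "\<dots> = finsum A (\<lambda>\<mu>. (s \<mu> \<otimes> star A (s \<mu>)) \<otimes> (m \<otimes> ?u)) ?P"
    using pm mc by (intro finsum_mult_right) (auto simp: unit_sum)
  also have "\<dots> = finsum A (\<lambda>\<mu>. finsum A (?t \<mu>) ?P) ?P"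
  proof (intro finsum_cong' refl)
    fix \<mu> assume \<mu>: "\<mu> \<in> ?P"
    have "m \<otimes> ?u = finsum A (\<lambda>\<nu>. m \<otimes> (s \<nu> \<otimes> star A (s \<nu>))) ?P" using pm mc by (intro finsum_mult_left) auto
    then show "(s \<mu> \<otimes> star A (s \<mu>)) \<otimes> (m \<otimes> ?u) = finsum A (?t \<mu>) ?P"
      using pm mc \<mu> by (simp add: finsum_mult_left)
  qed (use t in \<open>auto intro!: finsum_closed\<close>)
  finally have "nrm A m \<le> (\<Sum>\<mu>\<in>?P. nrm A (finsum A (?t \<mu>) ?P))"
    using t(2) nrm_finsum_le[of ?P "\<lambda>\<mu>. finsum A (?t \<mu>) ?P"] by (auto intro!: finsum_closed)
  also have "\<dots> \<le> (\<Sum>\<mu>\<in>?P. \<Sum>\<nu>\<in>?P. nrm A (?t \<mu> \<nu>))" using t(2) by (intro sum_mono nrm_finsum_le) auto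
  also have "\<dots> \<le> (\<Sum>\<mu>\<in>?P. \<Sum>\<nu>\<in>?P. L)" using t(1) by (intro sum_mono) auto
  finally show ?thesis by (simp add: power2_eq_square mult.assoc)
qed

end

section \<open>Comparison of the norm with the operator norm\<close>

lemma le_of_square_le_mult:
  fixes a b :: real
  assumes "a\<^sup>2 \<le> b * a" "0 \<le> a" "0 \<le> b"
  shows "a \<le> b"
proof (cases "a = 0")
  case False
  then show ?thesis using assms by (simp add: power2_eq_square)
qed (use assms in simp)

lemma cmod_square_of_real: "complex_of_real a = z \<Longrightarrow> (cmod z)\<^sup>2 = a\<^sup>2"
  by (auto simp: power2_abs)

locale ck_star_representation = ck_algebra \<Lambda> v A s + hilbert_representation A H \<pi>
  for \<Lambda> :: "'a graded_category" and v :: 'a and A :: "'c cstar" (structure) and s :: "'a \<Rightarrow> 'c"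
    and H :: "'h inner_space" and \<pi> :: "'c \<Rightarrow> 'h \<Rightarrow> 'h" +
  assumes adjoints_s: "\<mu> \<in> mor \<Lambda> \<Longrightarrow> adjoints (s \<mu>) (star A (s \<mu>))"
begin

lemma adjoints_graded: "x \<in> graded S \<Longrightarrow> adjoints x (star A x)"
  unfolding graded_def
proof (induction rule: lspan.induct)
  case zero
  show ?case by (auto simp: adjoints_def cinner_rep_zero cinner_cnj[of _ "\<pi> \<zero> _"])
next
  case (add g x c)
  then obtain \<mu> \<nu> where g: "g = s \<mu> \<otimes> star A (s \<nu>)" and [simp]: "\<mu> \<in> mor \<Lambda>" "\<nu> \<in> mor \<Lambda>" by blast
  have x: "x \<in> carrier A" using add lspan_closed[OF _ graded_gens] by blast
  have "adjoints (s \<mu> \<otimes> star A (s \<nu>)) (s \<nu> \<otimes> star A (s \<mu>))"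
    by (intro adjoints_mult adjoints_s adjoints_sym[OF _ _ adjoints_s]) auto
  then have "adjoints (c \<odot> g \<oplus> x) (cnj c \<odot> (s \<nu> \<otimes> star A (s \<mu>)) \<oplus> star A x)"
    unfolding g using x add by (intro adjoints_add adjoints_smult) auto
  then show ?case using x by (simp add: g star_add star_smult star_mult star_star)
qed

lemma cinner_rep_s_move:
  assumes "\<mu> \<in> mor \<Lambda>" "\<xi> \<in> carrier H" "\<zeta> \<in> carrier H"
  shows "cinner H (\<pi> (s \<mu>) \<xi>) \<zeta> = cinner H \<xi> (\<pi> (star A (s \<mu>)) \<zeta>)"
  using adjointsD[OF adjoints_s] assms by simp

lemma cinner_rep_s_s:
  assumes "\<mu> \<in> mor \<Lambda>" "\<xi> \<in> carrier H" "\<zeta> \<in> carrier H" "\<pi> (s v) \<zeta> = \<zeta>"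
  shows "cinner H (\<pi> (s \<mu>) \<xi>) (\<pi> (s \<mu>) \<zeta>) = cinner H \<xi> \<zeta>"
  using assms by (simp add: cinner_rep_s_move rep_mult[symmetric])

end

text \<open>
  A vector as in \<open>separating\<close> makes \<open>\<pi>\<close> restricted to elements of bounded degree look like a graded
  representation.  The lower bound \<open>q0\<close> allows \<open>q\<close> to be a level at which given elements are matrices, and \<open>n\<close>
  bounds the degrees of their components.
\<close>

locale ck_representation = ck_star_representation \<Lambda> v A s H \<pi>
  for \<Lambda> :: "'a graded_category" and v :: 'a and A :: "'c cstar" (structure) and s :: "'a \<Rightarrow> 'c"
    and H :: "'h inner_space" and \<pi> :: "'c \<Rightarrow> 'h \<Rightarrow> 'h" +
  assumes generating: "\<And>S. \<lbrakk>closed_star_subalgebra A S; s ` mor \<Lambda> \<subseteq> S\<rbrakk> \<Longrightarrow> S = carrier A"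
    and separating: "\<And>q0 n. \<exists>q\<ge>q0. \<exists>\<zeta> \<in> carrier H. \<pi> (s v) \<zeta> = \<zeta> \<and> 0 < nsq \<zeta> \<and>
      (\<forall>p \<mu> \<mu>'. p \<le> q + n \<and> p \<noteq> q \<and> \<mu> \<in> paths \<Lambda> p \<and> \<mu>' \<in> paths \<Lambda> q
        \<longrightarrow> cinner H (\<pi> (s \<mu>) \<zeta>) (\<pi> (s \<mu>') \<zeta>) = 0)"
begin

text \<open>
  The hypothesis on \<open>k\<close> says that \<open>k - w\<^sup>* w\<close> lies in the kernel of \<open>\<pi>\<close>.
\<close>

lemma op_bound_graded_of_kernel:
  assumes w: "w \<in> graded S" and k: "k \<in> carrier A"
    and "\<And>\<xi>. \<xi> \<in> carrier H \<Longrightarrow> \<pi> k \<xi> = \<pi> (star A w \<otimes> w) \<xi>"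
  shows "op_bound w (nrm A k)"
proof (rule op_bound_gram[of w "star A w" k "s v"])
  show "adjoints (s v) (s v)" using adjoints_s[of v] by simp
qed (use assms graded_closed[OF w] adjoints_graded[OF w] graded_unit[OF w] in auto)

lemma op_bound_graded: "w \<in> graded S \<Longrightarrow> op_bound w ((nrm A w)\<^sup>2)"
  using op_bound_graded_of_kernel[of w S "star A w \<otimes> w"] graded_closed[of w S] by (simp add: c_star_identity)

lemma block_orthogonal:
  assumes \<zeta>: "\<zeta> \<in> carrier H"
    and orth: "\<And>\<mu> \<mu>'. \<lbrakk>\<mu> \<in> paths \<Lambda> p; \<mu>' \<in> paths \<Lambda> q\<rbrakk> \<Longrightarrow> cinner H (\<pi> (s \<mu>) \<zeta>) (\<pi> (s \<mu>') \<zeta>) = 0"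
    and x: "x \<in> block p 0" and y: "y \<in> block q 0"
  shows "cinner H (\<pi> x \<zeta>) (\<pi> y \<zeta>) = 0"
proof -
  have gen: "s \<mu> \<otimes> star A (s \<nu>) = s \<mu>" if "\<mu> \<in> paths \<Lambda> r" "\<nu> \<in> paths \<Lambda> 0" for \<mu> \<nu> r
  proof -
    have "\<nu> = v" using that(2) vertex by (simp add: zero_prod_def)
    then show ?thesis using that(1) by (simp add: mem_pathsD)
  qed
  have 1: "cinner H (\<pi> x \<zeta>) (\<pi> (s \<mu>') \<zeta>) = 0" if \<mu>': "\<mu>' \<in> paths \<Lambda> q" for \<mu>'
    using x unfolding block_def
  proof (induction rule: lspan.induct)
    case zero
    then show ?case using \<zeta> \<mu>' by (simp add: cinner_rep_zero mem_pathsD)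
  next
    case (add g x c)
    then obtain \<mu> where \<mu>: "\<mu> \<in> paths \<Lambda> p" "g = s \<mu>" using gen by blast
    moreover have "x \<in> carrier A" using add lspan_closed[OF _ block_gens] by blast
    ultimately show ?case using add \<zeta> \<mu>' orth[OF \<mu>(1) \<mu>']
      by (simp add: rep_add rep_smult cinner_add cinner_smult mem_pathsD)
  qed
  have xc: "x \<in> carrier A" using x by (rule block_closed)
  show ?thesis
    using y unfolding block_def
  proof (induction rule: lspan.induct)
    case zero
    then show ?case using \<zeta> xc by (simp add: cinner_rep_zero cinner_cnj[of _ "\<pi> \<zero> _"])
  next
    case (add g y c)
    then obtain \<mu> where \<mu>: "\<mu> \<in> paths \<Lambda> q" "g = s \<mu>" using gen by blast
    moreover have "y \<in> carrier A" using add lspan_closed[OF _ block_gens] by blast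
    ultimately show ?case using add \<zeta> xc 1[OF \<mu>(1)]
      by (simp add: rep_add rep_smult cinner_add_right cinner_smult_right mem_pathsD)
  qed
qed

text \<open>
  Let \<open>w\<^sub>0 = f j\<close> be the component of degree zero and let \<open>V\<close> be the span of the vectors \<open>\<pi> (s \<nu>) \<zeta>\<close> with \<open>\<nu>\<close> of
  degree \<open>q\<close>.  The compression of \<open>\<pi> w\<close> to \<open>V\<close> is the restriction of \<open>\<pi> w\<^sub>0\<close>, because the other components
  map \<open>V\<close> to vectors orthogonal to it.  So \<open>\<pi> w\<^sub>0\<close> and its adjoint are bounded by \<open>sqrt K\<close> on \<open>V\<close>, and so are the entries of
  the matrices \<open>(w\<^sub>0\<^sup>* w\<^sub>0)\<^sup>n\<close> by \<open>K\<^sup>n\<close>.  As the size of these matrices does not depend on \<open>n\<close>, the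
  square of the norm of \<open>w\<^sub>0\<close> is at most \<open>K\<close>.

  The components are indexed by an arbitrary set, so that the lemma applies to \<open>w\<^sub>n\<^sup>* w\<close> without
  reindexing.
\<close>

lemma nrm_zero_component_le:
  fixes d :: "'i \<Rightarrow> int \<times> int"
  assumes I: "finite I" and j: "j \<in> I" "d j = 0" and d: "\<And>i. \<lbrakk>i \<in> I; i \<noteq> j\<rbrakk> \<Longrightarrow> d i \<noteq> 0"
    and f: "\<And>i. i \<in> I \<Longrightarrow> f i \<in> graded {d i}" and w: "w = finsum A f I" and K: "op_bound w K"
  shows "(nrm A (f j))\<^sup>2 \<le> K"
proof -
  have K0: "0 \<le> K" using K by (rule op_bound_nonneg)
  have fc: "f i \<in> carrier A" if "i \<in> I" for i using f[OF that] by (rule graded_closed)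
  then have wc: "w \<in> carrier A" unfolding w by (intro finsum_closed) auto
  have "\<forall>i\<in>I. \<exists>q0. \<forall>q\<ge>q0. \<exists>p. zdeg p = zdeg q + d i \<and> f i \<in> block p q"
    using f homogeneous_in_block by blast
  then obtain Q where Q: "\<And>i q. \<lbrakk>i \<in> I; Q i \<le> q\<rbrakk> \<Longrightarrow> \<exists>p. zdeg p = zdeg q + d i \<and> f i \<in> block p q" by metis
  define q0 where "q0 = (\<Sum>i\<in>I. fst (Q i), \<Sum>i\<in>I. snd (Q i))"
  define n where "n = (\<Sum>i\<in>I. nat \<bar>fst (d i)\<bar>, \<Sum>i\<in>I. nat \<bar>snd (d i)\<bar>)"
  obtain q \<zeta> where q: "q0 \<le> q" and \<zeta>: "\<zeta> \<in> carrier H" "\<pi> (s v) \<zeta> = \<zeta>" "0 < nsq \<zeta>"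
    and orth: "\<And>p \<mu> \<mu>'. \<lbrakk>p \<le> q + n; p \<noteq> q; \<mu> \<in> paths \<Lambda> p; \<mu>' \<in> paths \<Lambda> q\<rbrakk>
        \<Longrightarrow> cinner H (\<pi> (s \<mu>) \<zeta>) (\<pi> (s \<mu>') \<zeta>) = 0"
    using separating[of q0 n] by blast
  have blk: "\<exists>p. zdeg p = zdeg q + d i \<and> p \<le> q + n \<and> f i \<in> block p q" if i: "i \<in> I" for i
  proof -
    have "Q i \<le> q0" using I i unfolding q0_def less_eq_prod_def by (auto intro: member_le_sum)
    then obtain p where p: "zdeg p = zdeg q + d i" "f i \<in> block p q" using Q[OF i] q by (meson order_trans)
    have "nat \<bar>fst (d i)\<bar> \<le> fst n" "nat \<bar>snd (d i)\<bar> \<le> snd n"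
      using I i by (auto simp: n_def intro: member_le_sum[of i I "\<lambda>i. nat \<bar>fst (d i)\<bar>"]
          member_le_sum[of i I "\<lambda>i. nat \<bar>snd (d i)\<bar>"])
    then have "p \<le> q + n" using p(1) by (auto simp: less_eq_prod_def zdeg_def prod_eq_iff)
    with p show ?thesis by blast
  qed
  define w0 where "w0 = f j"
  have w0: "w0 \<in> block q q" using blk[OF j(1)] j(2) unfolding w0_def by (auto simp: zero_prod_def[symmetric])
  have w0c: "w0 \<in> carrier A" using w0 by (rule block_closed)
  have proj: "cinner H (\<pi> (w \<otimes> g) \<zeta>) (\<pi> g' \<zeta>) = cinner H (\<pi> (w0 \<otimes> g) \<zeta>) (\<pi> g' \<zeta>)"
    if g: "g \<in> block q 0" and g': "g' \<in> block q 0" for g g'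
  proof -
    have c: "g \<in> carrier A" "g' \<in> carrier A" using g g' by (auto intro: block_closed)
    have "w \<otimes> g = finsum A (\<lambda>i. f i \<otimes> g) I" unfolding w using I c fc by (intro finsum_mult_right) auto
    then have "cinner H (\<pi> (w \<otimes> g) \<zeta>) (\<pi> g' \<zeta>) = (\<Sum>i\<in>I. cinner H (\<pi> (f i \<otimes> g) \<zeta>) (\<pi> g' \<zeta>))"
      using I c fc \<zeta> by (simp add: cinner_rep_finsum)
    also have "\<dots> = (\<Sum>i\<in>I. if i = j then cinner H (\<pi> (w0 \<otimes> g) \<zeta>) (\<pi> g' \<zeta>) else 0)"
    proof (rule sum.cong[OF refl])
      fix i assume i: "i \<in> I"
      show "cinner H (\<pi> (f i \<otimes> g) \<zeta>) (\<pi> g' \<zeta>) = (if i = j then cinner H (\<pi> (w0 \<otimes> g) \<zeta>) (\<pi> g' \<zeta>) else 0)"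
      proof (cases "i = j")
        case False
        obtain p where p: "zdeg p = zdeg q + d i" "p \<le> q + n" "f i \<in> block p q" using blk[OF i] by blast
        have "zdeg p \<noteq> zdeg q" using p(1) d[OF i False] by simp
        then have "p \<noteq> q" by auto
        have "cinner H (\<pi> (f i \<otimes> g) \<zeta>) (\<pi> g' \<zeta>) = 0"
          by (rule block_orthogonal[OF \<zeta>(1) _ block_mult[OF p(3) g] g']) (rule orth[OF p(2) \<open>p \<noteq> q\<close>])
        then show ?thesis using False by simp
      qed (simp add: w0_def)
    qed
    also have "\<dots> = cinner H (\<pi> (w0 \<otimes> g) \<zeta>) (\<pi> g' \<zeta>)" using I j by simp
    finally show ?thesis .
  qed
  have bound0: "nsq (\<pi> (w0 \<otimes> g) \<zeta>) \<le> K * nsq (\<pi> g \<zeta>)" if g: "g \<in> block q 0" for g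
  proof -
    have gc: "g \<in> carrier A" using g by (rule block_closed)
    let ?a = "nsq (\<pi> (w0 \<otimes> g) \<zeta>)"
    have eq: "of_real ?a = cinner H (\<pi> (w \<otimes> g) \<zeta>) (\<pi> (w0 \<otimes> g) \<zeta>)"
      using proj[OF g block_mult[OF w0 g]] w0c gc \<zeta> by (simp add: cinner_self)
    have "?a\<^sup>2 \<le> nsq (\<pi> (w \<otimes> g) \<zeta>) * ?a"
      using cauchy_schwarz[of "\<pi> (w \<otimes> g) \<zeta>" "\<pi> (w0 \<otimes> g) \<zeta>"] cmod_square_of_real[OF eq] w0c gc wc \<zeta>(1)
      by simp
    also have "\<dots> \<le> (K * nsq (\<pi> g \<zeta>)) * ?a"
      using op_boundD[OF K, of "\<pi> g \<zeta>"] w0c gc wc \<zeta> by (intro mult_right_mono) (auto simp: rep_mult)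
    finally show ?thesis by (rule le_of_square_le_mult) (use w0c gc \<zeta>(1) K0 in auto)
  qed
  have bound1: "nsq (\<pi> (star A w0 \<otimes> g) \<zeta>) \<le> K * nsq (\<pi> g \<zeta>)" if g: "g \<in> block q 0" for g
  proof -
    have gc: "g \<in> carrier A" using g by (rule block_closed)
    have g1: "star A w0 \<otimes> g \<in> block q 0" using block_mult[OF block_star[OF w0] g] .
    let ?a = "nsq (\<pi> (star A w0 \<otimes> g) \<zeta>)" and ?\<xi> = "\<pi> (star A w0 \<otimes> g) \<zeta>"
    have "cinner H (\<pi> w0 ?\<xi>) (\<pi> g \<zeta>) = cinner H ?\<xi> (\<pi> (star A w0) (\<pi> g \<zeta>))"
      using w0c gc \<zeta>(1) by (intro adjointsD[OF adjoints_graded[OF block_graded[OF w0]]]) auto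
    also have "\<dots> = of_real ?a" using w0c gc \<zeta>(1) by (simp add: rep_mult[symmetric] cinner_self)
    finally have "?a\<^sup>2 = (cmod (cinner H (\<pi> w0 ?\<xi>) (\<pi> g \<zeta>)))\<^sup>2" using cmod_square_of_real by metis
    also have "\<dots> \<le> nsq (\<pi> w0 ?\<xi>) * nsq (\<pi> g \<zeta>)"
      using w0c gc \<zeta>(1) by (intro cauchy_schwarz) auto
    also have "\<pi> w0 ?\<xi> = \<pi> (w0 \<otimes> (star A w0 \<otimes> g)) \<zeta>" using w0c gc \<zeta>(1) by (simp add: rep_mult[of w0])
    also have "nsq (\<pi> (w0 \<otimes> (star A w0 \<otimes> g)) \<zeta>) * nsq (\<pi> g \<zeta>) \<le> (K * ?a) * nsq (\<pi> g \<zeta>)"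
      using bound0[OF g1] gc \<zeta>(1) by (intro mult_right_mono) auto
    also have "\<dots> = (K * nsq (\<pi> g \<zeta>)) * ?a" by (simp only: mult_ac)
    finally show ?thesis by (rule le_of_square_le_mult) (use w0c gc \<zeta>(1) K0 in auto)
  qed
  define h where "h k = ((\<lambda>x. x \<otimes> x) ^^ k) (star A w0 \<otimes> w0)" for k
  have h_Suc: "h (Suc k) = h k \<otimes> h k" for k by (simp add: h_def)
  have h: "h k \<in> block q q \<and> star A (h k) = h k \<and> nrm A (h k) = (nrm A w0)\<^sup>2 ^ (2 ^ k) \<and>
      (\<forall>g \<in> block q 0. nsq (\<pi> (h k \<otimes> g) \<zeta>) \<le> (K ^ (2 ^ k))\<^sup>2 * nsq (\<pi> g \<zeta>))" for k
  proof (induction k)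
    case 0
    have "nsq (\<pi> (star A w0 \<otimes> w0 \<otimes> g) \<zeta>) \<le> K\<^sup>2 * nsq (\<pi> g \<zeta>)" if g: "g \<in> block q 0" for g
    proof -
      have "nsq (\<pi> (star A w0 \<otimes> (w0 \<otimes> g)) \<zeta>) \<le> K * (K * nsq (\<pi> g \<zeta>))"
        using bound1[OF block_mult[OF w0 g]] mult_left_mono[OF bound0[OF g] K0] by simp
      then show ?thesis using w0c block_closed[OF g] by (simp add: mult_assoc power2_eq_square mult.assoc)
    qed
    then show ?case using block_mult[OF block_star[OF w0] w0] w0c
      by (simp add: h_def star_mult star_star c_star_identity)
  next
    case (Suc k)
    have c: "h k \<in> carrier A" using Suc block_closed by blast
    have "nsq (\<pi> (h k \<otimes> h k \<otimes> g) \<zeta>) \<le> (K ^ (2 ^ Suc k))\<^sup>2 * nsq (\<pi> g \<zeta>)" if g: "g \<in> block q 0" for g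
    proof -
      have "nsq (\<pi> (h k \<otimes> (h k \<otimes> g)) \<zeta>) \<le> (K ^ (2 ^ k))\<^sup>2 * nsq (\<pi> (h k \<otimes> g) \<zeta>)"
        using Suc block_mult[of "h k" q q g 0] g by blast
      also have "\<dots> \<le> (K ^ (2 ^ k))\<^sup>2 * ((K ^ (2 ^ k))\<^sup>2 * nsq (\<pi> g \<zeta>))"
        using Suc g by (intro mult_left_mono) auto
      finally show ?thesis using c block_closed[OF g]
        by (simp add: mult_assoc power2_eq_square mult.assoc power_mult power_mult_distrib mult_ac)
    qed
    moreover have "nrm A (h k \<otimes> h k) = (nrm A w0)\<^sup>2 ^ (2 ^ Suc k)"
      using nrm_star_self_adjoint_square[of "h k"] Suc c by (simp add: power_mult mult.commute[of 2])
    ultimately show ?case using Suc c block_mult[of "h k" q q "h k" q] by (simp add: h_Suc star_mult)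
  qed
  define C where "C = (real (card (paths \<Lambda> q)))\<^sup>2"
  have "(nrm A w0)\<^sup>2 ^ (2 ^ k) \<le> C * 4 ^ k * K ^ (2 ^ k)" for k
  proof -
    have "nrm A (h k) \<le> C * K ^ (2 ^ k)"
      unfolding C_def
    proof (rule nrm_block_le)
      show "h k \<in> block q q" using h by blast
      show "0 \<le> K ^ (2 ^ k)" using K0 by simp
      fix \<mu> \<nu> c
      assume \<mu>: "\<mu> \<in> paths \<Lambda> q" and \<nu>: "\<nu> \<in> paths \<Lambda> q" and c: "star A (s \<mu>) \<otimes> (h k \<otimes> s \<nu>) = c \<odot> s v"
      note [simp] = mem_pathsD(1)[OF \<mu>] mem_pathsD(1)[OF \<nu>]
      have hc: "h k \<in> carrier A" using h block_closed by blast
      have iso: "nsq (\<pi> (s \<kappa>) \<zeta>) = nsq \<zeta>" if "\<kappa> \<in> mor \<Lambda>" for \<kappa>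
        using cinner_rep_s_s[OF that \<zeta>(1,1,2)] by (simp add: nsq_def)
      have "cinner H (\<pi> (star A (s \<mu>) \<otimes> (h k \<otimes> s \<nu>)) \<zeta>) \<zeta> = c * of_real (nsq \<zeta>)"
        unfolding c using \<zeta> by (simp add: rep_smult cinner_smult cinner_self)
      moreover have "cinner H (\<pi> (star A (s \<mu>) \<otimes> (h k \<otimes> s \<nu>)) \<zeta>) \<zeta> = cinner H (\<pi> (h k \<otimes> s \<nu>) \<zeta>) (\<pi> (s \<mu>) \<zeta>)"
        using adjointsD[OF adjoints_sym[OF _ _ adjoints_s[of \<mu>]], of "\<pi> (h k \<otimes> s \<nu>) \<zeta>" \<zeta>] hc \<zeta>
        by (simp add: rep_mult[of "star A (s \<mu>)"])
      ultimately have "(cmod c * nsq \<zeta>)\<^sup>2 = (cmod (cinner H (\<pi> (h k \<otimes> s \<nu>) \<zeta>) (\<pi> (s \<mu>) \<zeta>)))\<^sup>2"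
        using \<zeta> by (simp add: norm_mult)
      also have "\<dots> \<le> nsq (\<pi> (h k \<otimes> s \<nu>) \<zeta>) * nsq (\<pi> (s \<mu>) \<zeta>)"
        using hc \<zeta> by (intro cauchy_schwarz) auto
      also have "\<dots> \<le> ((K ^ (2 ^ k))\<^sup>2 * nsq (\<pi> (s \<nu>) \<zeta>)) * nsq (\<pi> (s \<mu>) \<zeta>)"
        using h s_in_block[OF \<nu>] \<zeta> by (intro mult_right_mono) auto
      also have "\<dots> = (K ^ (2 ^ k) * nsq \<zeta>)\<^sup>2" by (simp add: iso power2_eq_square mult_ac)
      finally have "cmod c * nsq \<zeta> \<le> K ^ (2 ^ k) * nsq \<zeta>" by (rule power2_le_imp_le) (use K0 \<zeta> in simp)
      then show "cmod c \<le> K ^ (2 ^ k)" using \<zeta> by simp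
    qed
    also have "\<dots> = C * 1 * K ^ (2 ^ k)" by simp
    also have "\<dots> \<le> C * 4 ^ k * K ^ (2 ^ k)"
      using K0 by (intro mult_right_mono mult_left_mono) (auto simp: C_def)
    finally show ?thesis using h by simp
  qed
  from power_two_power_compare[OF zero_le_power2 K0 this] show ?thesis by (simp add: w0_def)
qed

text \<open>
  The component of degree zero of \<open>w\<^sub>n\<^sup>* w\<close> is \<open>w\<^sub>n\<^sup>* w\<^sub>n\<close>, and \<open>\<pi>\<close> does not increase the norm of \<open>w\<^sub>n\<^sup>*\<close>.  Hence the
  fourth power of the norm of \<open>w\<^sub>n\<close> is at most its square times \<open>K\<close>.
\<close>

lemma nrm_component_le:
  assumes S: "finite S" and n: "n \<in> S" and f: "\<And>m. m \<in> S \<Longrightarrow> f m \<in> graded {m}"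
    and w: "w = finsum A f S" and K: "op_bound w K"
  shows "(nrm A (f n))\<^sup>2 \<le> K"
proof -
  have fc: "f m \<in> carrier A" if "m \<in> S" for m using f[OF that] by (rule graded_closed)
  then have wc: "w \<in> carrier A" unfolding w by (intro finsum_closed) auto
  let ?a = "nrm A (f n)"
  have star_fn: "star A (f n) \<in> graded {- n}" using graded_star[OF f[OF n]] by simp
  have "op_bound (star A (f n) \<otimes> w) (?a\<^sup>2 * K)"
    using op_bound_graded[OF star_fn] K fc[OF n] wc by (intro op_bound_mult) auto
  moreover have "star A (f n) \<otimes> w = finsum A (\<lambda>m. star A (f n) \<otimes> f m) S"
    unfolding w using S fc n by (intro finsum_mult_left) auto
  moreover have "star A (f n) \<otimes> f m \<in> graded {m - n}" if "m \<in> S" for m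
    by (rule graded_mono[OF graded_mult[OF star_fn f[OF that]]])
      (use uminus_add_conv_diff[of n m] in blast)
  ultimately have "(nrm A (star A (f n) \<otimes> f n))\<^sup>2 \<le> ?a\<^sup>2 * K"
    using nrm_zero_component_le[where I = S and j = n and d = "\<lambda>m. m - n"
        and f = "\<lambda>m. star A (f n) \<otimes> f m" and w = "star A (f n) \<otimes> w" and K = "?a\<^sup>2 * K"] S n
    by simp
  then have le: "?a\<^sup>2 * ?a\<^sup>2 \<le> ?a\<^sup>2 * K"
    using fc[OF n] power2_eq_square[of "?a\<^sup>2"] by (simp add: c_star_identity)
  show ?thesis
  proof (cases "?a = 0")
    case False
    then have "0 < ?a\<^sup>2" by simp
    then show ?thesis using le by (simp only: mult_le_cancel_left_pos)
  qed (use op_bound_nonneg[OF K] in simp)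
qed

lemma nrm_le_card_times_bound:
  assumes S: "finite S" and w: "w \<in> graded S" and K: "op_bound w K"
  shows "nrm A w \<le> real (card S) * sqrt K"
proof -
  obtain f where f: "\<And>m. m \<in> S \<Longrightarrow> f m \<in> graded {m}" "w = finsum A f S"
    using graded_decompose[OF S w] by blast
  have "nrm A w \<le> (\<Sum>m\<in>S. nrm A (f m))" unfolding f(2) using S f(1) graded_closed by (intro nrm_finsum_le) auto
  also have "\<dots> \<le> (\<Sum>m\<in>S. sqrt K)"
    using nrm_component_le[OF S _ f K] by (intro sum_mono real_le_rsqrt) auto
  finally show ?thesis by simp
qed

text \<open>
  The degrees of \<open>(w\<^sup>* w)\<^sup>n\<close> fill a square whose side is linear in \<open>n\<close>.  So the estimate by the number of components
  loses only a quadratic factor for the power, and nothing in the limit.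
\<close>

theorem nrm_le_op_bound:
  assumes S: "finite S" and w: "w \<in> graded S" and K: "op_bound w K"
  shows "(nrm A w)\<^sup>2 \<le> K"
proof -
  have K0: "0 \<le> K" using K by (rule op_bound_nonneg)
  have wc: "w \<in> carrier A" using w by (rule graded_closed)
  define box where "box r = {- int r..int r} \<times> {- int r..int r}" for r
  have box_add: "m + m' \<in> box (r + r')" if "m \<in> box r" "m' \<in> box r'" for m m' r r'
    using that by (auto simp: box_def)
  define D where "D = (\<Sum>m\<in>S. nat \<bar>fst m\<bar> + nat \<bar>snd m\<bar>)"
  have "S \<subseteq> box D"
  proof
    fix m assume m: "m \<in> S"
    have "nat \<bar>fst m\<bar> + nat \<bar>snd m\<bar> \<le> D" unfolding D_def using S m
      by (intro member_le_sum[of m S "\<lambda>m. nat \<bar>fst m\<bar> + nat \<bar>snd m\<bar>"]) auto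
    then show "m \<in> box D" by (cases m) (auto simp: box_def)
  qed
  then have wD: "w \<in> graded (box D)" using graded_mono[OF w] by blast
  have "uminus ` box D \<subseteq> box D" by (auto simp: box_def)
  then have wD': "star A w \<in> graded (box D)" using graded_mono[OF graded_star[OF wD]] by blast
  have mult: "x \<otimes> y \<in> graded (box (r + r'))" if "x \<in> graded (box r)" "y \<in> graded (box r')" for x y r r'
    by (rule graded_mono[OF graded_mult[OF that]]) (use box_add in blast)
  define h where "h k = ((\<lambda>x. x \<otimes> x) ^^ k) (star A w \<otimes> w)" for k
  have h_Suc: "h (Suc k) = h k \<otimes> h k" for k by (simp add: h_def)
  have h: "h k \<in> graded (box (2 * D * 2 ^ k)) \<and> star A (h k) = h k \<and> nrm A (h k) = (nrm A w)\<^sup>2 ^ (2 ^ k) \<and>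
      op_bound (h k) ((K ^ (2 ^ k))\<^sup>2)" for k
  proof (induction k)
    case 0
    have "op_bound (star A w \<otimes> w) (K * K)"
      using op_bound_adjoint[OF wc _ adjoints_graded[OF w] K] K wc by (intro op_bound_mult) auto
    then show ?case using mult[OF wD' wD] wc
      by (simp add: h_def star_mult star_star c_star_identity mult_2 power2_eq_square)
  next
    case (Suc k)
    have c: "h k \<in> carrier A" using Suc graded_closed by blast
    have eq: "(K ^ (2 ^ Suc k))\<^sup>2 = (K ^ (2 ^ k))\<^sup>2 * (K ^ (2 ^ k))\<^sup>2"
      by (simp add: mult_2 power_add power2_eq_square mult_ac)
    have b: "op_bound (h k) ((K ^ (2 ^ k))\<^sup>2)" using Suc by blast
    have "op_bound (h k \<otimes> h k) ((K ^ (2 ^ Suc k))\<^sup>2)"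
      unfolding eq by (rule op_bound_mult[OF c c b b])
    moreover have "nrm A (h k \<otimes> h k) = (nrm A w)\<^sup>2 ^ (2 ^ Suc k)"
      using nrm_star_self_adjoint_square[of "h k"] Suc c by (simp add: power_mult mult.commute[of 2])
    moreover have "h k \<otimes> h k \<in> graded (box (2 * D * 2 ^ Suc k))"
      using mult[of "h k" "2 * D * 2 ^ k" "h k" "2 * D * 2 ^ k"] Suc by (simp add: algebra_simps)
    ultimately show ?case using Suc c by (simp add: h_Suc star_mult)
  qed
  have "(nrm A w)\<^sup>2 ^ (2 ^ k) \<le> (4 * real D + 1)\<^sup>2 * 4 ^ k * K ^ (2 ^ k)" for k
  proof -
    have "nrm A (h k) \<le> real (card (box (2 * D * 2 ^ k))) * sqrt ((K ^ (2 ^ k))\<^sup>2)"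
      using h by (intro nrm_le_card_times_bound) (auto simp: box_def)
    also have "sqrt ((K ^ (2 ^ k))\<^sup>2) = K ^ (2 ^ k)" using K0 by simp
    also have "real (card (box (2 * D * 2 ^ k))) = (4 * real D * 2 ^ k + 1)\<^sup>2"
      by (simp add: box_def card_cartesian_product power2_eq_square nat_add_distrib algebra_simps)
    also have "\<dots> \<le> ((4 * real D + 1) * 2 ^ k)\<^sup>2"
      by (intro power_mono) (auto simp: algebra_simps)
    also have "\<dots> = (4 * real D + 1)\<^sup>2 * 4 ^ k"
      by (simp add: power_mult_distrib power2_eq_square flip: power_mult_distrib)
    finally show ?thesis using h K0 by (simp add: mult_right_mono)
  qed
  from power_two_power_compare[OF zero_le_power2 K0 this] show ?thesis .
qed

text \<open>
  The closure of the span of the monomials is a closed *-subalgebra that contains the generators.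
\<close>

lemma graded_dense:
  assumes x: "x \<in> carrier A" and e: "0 < (e::real)"
  shows "\<exists>w \<in> graded UNIV. nrm A (x \<ominus> w) < e"
proof -
  define S where "S = {x \<in> carrier A. \<forall>e>0. \<exists>w \<in> graded UNIV. nrm A (x \<ominus> w) < e}"
  have approx: "\<exists>w \<in> graded UNIV. nrm A (x \<ominus> w) < e" if "x \<in> S" "0 < e" for x e
    using that by (simp add: S_def)
  have gS: "w \<in> S" if w: "w \<in> graded UNIV" for w
  proof -
    have "\<exists>z \<in> graded UNIV. nrm A (w \<ominus> z) < e" if "0 < e" for e
      using that w graded_closed[OF w] by (intro bexI[of _ w]) simp_all
    then show ?thesis using graded_closed[OF w] by (simp add: S_def)
  qed
  have "closed_star_subalgebra A S"
    unfolding closed_star_subalgebra_def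
  proof (intro conjI ballI allI impI)
    show "S \<subseteq> carrier A" by (auto simp: S_def)
    show "\<zero> \<in> S" by (rule gS) (simp add: graded_def lspan.zero)
  next
    fix x y assume x: "x \<in> S" and y: "y \<in> S"
    then have c: "x \<in> carrier A" "y \<in> carrier A" by (auto simp: S_def)
    have "\<exists>w \<in> graded UNIV. nrm A (x \<oplus> y \<ominus> w) < e" if e: "0 < e" for e
    proof -
      obtain w z where w: "w \<in> graded UNIV" "nrm A (x \<ominus> w) < e / 2" and z: "z \<in> graded UNIV" "nrm A (y \<ominus> z) < e / 2"
        using approx[OF x, of "e / 2"] approx[OF y, of "e / 2"] e by auto
      have wz: "w \<in> carrier A" "z \<in> carrier A" using w z by (auto intro: graded_closed)
      have "x \<oplus> y \<ominus> (w \<oplus> z) = (x \<ominus> w) \<oplus> (y \<ominus> z)" using c wz by (simp add: minus_eq_smult smult_add_right a_ac)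
      then have "nrm A (x \<oplus> y \<ominus> (w \<oplus> z)) < e" using nrm_triangle[of "x \<ominus> w" "y \<ominus> z"] c wz w z by simp
      then show ?thesis using graded_add[OF w(1) z(1)] by blast
    qed
    then show "x \<oplus> y \<in> S" using c by (auto simp: S_def)
    have "\<exists>w \<in> graded UNIV. nrm A (x \<otimes> y \<ominus> w) < e" if e: "0 < e" for e
    proof -
      let ?N = "nrm A x + nrm A y + 1"
      have N: "0 < ?N" using c nrm_nonneg[of x] nrm_nonneg[of y] by linarith
      define \<delta> where "\<delta> = min 1 (e / ?N)"
      have \<delta>: "0 < \<delta>" "\<delta> \<le> 1" using e N by (simp_all add: \<delta>_def)
      have "\<delta> \<le> e / ?N" by (simp add: \<delta>_def)
      then have \<delta>N: "\<delta> * ?N \<le> e" unfolding pos_le_divide_eq[OF N] .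
      obtain w z where w: "w \<in> graded UNIV" "nrm A (x \<ominus> w) < \<delta>" and z: "z \<in> graded UNIV" "nrm A (y \<ominus> z) < \<delta>"
        using approx[OF x \<delta>(1)] approx[OF y \<delta>(1)] by auto
      have wz: "w \<in> carrier A" "z \<in> carrier A" using w z by (auto intro: graded_closed)
      have "nrm A z \<le> nrm A y + \<delta>"
        using nrm_le_add_minus[of z y] nrm_minus_commute[of z y] c wz z by simp
      then have zN: "nrm A z \<le> nrm A y + 1" using \<delta> by simp
      have "x \<otimes> y \<ominus> w \<otimes> z = (x \<otimes> y \<ominus> x \<otimes> z) \<oplus> (x \<otimes> z \<ominus> w \<otimes> z)"
        using c wz by (simp add: minus_minus_telescope)
      also have "\<dots> = x \<otimes> (y \<ominus> z) \<oplus> (x \<ominus> w) \<otimes> z" using c wz by (simp add: minus_mult_left minus_mult_right)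
      finally have "nrm A (x \<otimes> y \<ominus> w \<otimes> z) \<le> nrm A (x \<otimes> (y \<ominus> z)) + nrm A ((x \<ominus> w) \<otimes> z)"
        using nrm_triangle[of "x \<otimes> (y \<ominus> z)" "(x \<ominus> w) \<otimes> z"] c wz by simp
      also have "\<dots> \<le> nrm A x * nrm A (y \<ominus> z) + nrm A (x \<ominus> w) * nrm A z" using c wz by (intro add_mono nrm_mult) auto
      also have "\<dots> \<le> nrm A x * \<delta> + nrm A (x \<ominus> w) * (nrm A y + 1)"
        using c wz z zN by (intro add_mono mult_left_mono) auto
      also have "\<dots> < nrm A x * \<delta> + \<delta> * (nrm A y + 1)"
        using w(2) nrm_nonneg[OF c(2)] by (intro add_strict_left_mono mult_strict_right_mono) linarith+
      also have "\<dots> \<le> e" using \<delta>N by (simp add: algebra_simps)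
      finally show ?thesis using graded_mult[OF w(1) z(1)] graded_mono by blast
    qed
    then show "x \<otimes> y \<in> S" using c by (auto simp: S_def)
  next
    fix c x assume x: "x \<in> S"
    then have xc: "x \<in> carrier A" by (auto simp: S_def)
    have "\<exists>w \<in> graded UNIV. nrm A (c \<odot> x \<ominus> w) < e" if e: "0 < e" for e
    proof -
      have pos: "0 < cmod c + 1" by (simp add: add_nonneg_pos)
      obtain w where w: "w \<in> graded UNIV" "nrm A (x \<ominus> w) < e / (cmod c + 1)"
        using approx[OF x divide_pos_pos[OF e pos]] by auto
      have wc: "w \<in> carrier A" using w(1) by (rule graded_closed)
      have "nrm A (c \<odot> x \<ominus> c \<odot> w) = cmod c * nrm A (x \<ominus> w)"
        using xc wc by (simp add: smult_minus[symmetric] nrm_smult)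
      also have "\<dots> \<le> (cmod c + 1) * nrm A (x \<ominus> w)" using xc wc by (intro mult_right_mono) auto
      also have "\<dots> < e" using w(2) pos by (simp add: field_simps)
      finally show ?thesis using graded_smult[OF w(1)] by blast
    qed
    then show "c \<odot> x \<in> S" using xc by (auto simp: S_def)
  next
    fix x assume x: "x \<in> S"
    then have xc: "x \<in> carrier A" by (auto simp: S_def)
    have "\<exists>w \<in> graded UNIV. nrm A (star A x \<ominus> w) < e" if e: "0 < e" for e
    proof -
      obtain w where w: "w \<in> graded UNIV" "nrm A (x \<ominus> w) < e" using approx[OF x e] by blast
      have wc: "w \<in> carrier A" using w(1) by (rule graded_closed)
      have "nrm A (star A x \<ominus> star A w) = nrm A (x \<ominus> w)"
        using xc wc by (simp add: star_minus[symmetric])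
      then show ?thesis using graded_mono[OF graded_star[OF w(1)]] w(2) by (metis subset_UNIV)
    qed
    then show "star A x \<in> S" using xc by (auto simp: S_def)
  next
    fix u l assume u: "(\<forall>n::nat. u n \<in> S) \<and> l \<in> carrier A \<and> (\<lambda>n. nrm A (u n \<ominus> l)) \<longlonglongrightarrow> 0"
    have "\<exists>w \<in> graded UNIV. nrm A (l \<ominus> w) < e" if e: "0 < e" for e
    proof -
      have "\<forall>\<^sub>F n in sequentially. nrm A (u n \<ominus> l) < e / 2" using u e by (intro order_tendstoD) auto
      then obtain n where n: "nrm A (u n \<ominus> l) < e / 2" by (meson eventually_happens sequentially_bot)
      obtain w where w: "w \<in> graded UNIV" "nrm A (u n \<ominus> w) < e / 2"
        using approx[of "u n" "e / 2"] u e by auto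
      have c: "w \<in> carrier A" "u n \<in> carrier A" "l \<in> carrier A" using w(1) u graded_closed by (auto simp: S_def)
      have "nrm A (l \<ominus> w) < e"
        using nrm_triangle[of "l \<ominus> u n" "u n \<ominus> w"] c n w nrm_minus_commute[of l "u n"]
        by (simp add: minus_minus_telescope)
      then show ?thesis using w(1) by blast
    qed
    then show "l \<in> S" using u by (auto simp: S_def)
  qed
  moreover have "s ` mor \<Lambda> \<subseteq> S"
  proof (intro image_subsetI gS)
    fix \<mu> assume "\<mu> \<in> mor \<Lambda>"
    then show "s \<mu> \<in> graded UNIV" using graded_gen[of \<mu> v UNIV] by simp
  qed
  ultimately have "S = carrier A" by (rule generating)
  then show ?thesis using x e by (auto simp: S_def)
qed

text \<open>
  If \<open>w\<close> approximates \<open>x\<close> up to \<open>e\<close>, then \<open>\<pi> (w\<^sup>* (w - x)) = \<pi> (w\<^sup>* w)\<close> bounds the square of the norm of \<open>\<pi> w\<close>, and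
  thus of \<open>w\<close>, by the norm of \<open>w\<close> times \<open>e\<close>.
\<close>

theorem kernel_trivial:
  assumes x: "x \<in> carrier A" and ker: "\<And>\<xi>. \<xi> \<in> carrier H \<Longrightarrow> \<pi> x \<xi> = \<pi> \<zero> \<xi>"
  shows "x = \<zero>"
proof -
  have "nrm A x \<le> 2 * e" if e: "0 < e" for e
  proof -
    obtain w where w: "w \<in> graded UNIV" and xw: "nrm A (x \<ominus> w) < e" using graded_dense[OF x e] by blast
    obtain S where S: "finite S" "w \<in> graded S" using graded_finite_support[OF w] by blast
    have wc: "w \<in> carrier A" using w by (rule graded_closed)
    let ?k = "star A w \<otimes> (w \<ominus> x)"
    have "\<pi> ?k \<xi> = \<pi> (star A w \<otimes> w) \<xi>" if \<xi>: "\<xi> \<in> carrier H" for \<xi>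
    proof -
      have "\<pi> (w \<ominus> x) \<xi> = \<pi> (w \<ominus> \<zero>) \<xi>"
        using x wc \<xi> by (simp add: minus_eq_smult rep_add rep_smult ker del: minus_zero_right smult_zero)
      then show ?thesis using x wc \<xi> by (simp add: rep_mult)
    qed
    then have "op_bound w (nrm A ?k)" using x wc by (intro op_bound_graded_of_kernel[OF w]) auto
    then have "(nrm A w)\<^sup>2 \<le> nrm A ?k" by (rule nrm_le_op_bound[OF S])
    also have "\<dots> \<le> nrm A w * nrm A (w \<ominus> x)" using nrm_mult[of "star A w" "w \<ominus> x"] x wc by simp
    also have "\<dots> \<le> nrm A w * e"
      using xw nrm_minus_commute[OF x wc] wc by (intro mult_left_mono) auto
    finally have "nrm A w \<le> e" using e nrm_nonneg[OF wc] by (cases "nrm A w = 0") (auto simp: power2_eq_square)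
    then show ?thesis using nrm_le_add_minus[OF x wc] xw by simp
  qed
  from this[of "nrm A x / 4"] have "nrm A x \<le> 0" by (cases "0 < nrm A x") auto
  then show ?thesis using nrm_nonneg[OF x] nrm_zero_iff[OF x] by simp
qed

end

section \<open>Infinite paths and aperiodicity\<close>

context single_vertex_graph
begin

lemma infinite_path:
  assumes x: "x \<in> infinite_paths \<Lambda>" and pq: "p \<le> q"
  shows "x (p, q) \<in> mor \<Lambda>" and "deg \<Lambda> (x (p, q)) = q - p"
    and "q \<le> r \<Longrightarrow> x (p, r) = x (p, q) \<cdot> x (q, r)"
proof -
  have w: "(p, q) \<in> mor Omega" using pq by (simp add: Omega_def)
  show "x (p, q) \<in> mor \<Lambda>" using x w by (auto simp: infinite_paths_def)
  have "deg \<Lambda> (x (p, q)) = deg Omega (p, q)" using x w unfolding infinite_paths_def by blast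
  then show "deg \<Lambda> (x (p, q)) = q - p" by (simp add: Omega_def)
  assume qr: "q \<le> r"
  then have w': "(q, r) \<in> mor Omega" by (simp add: Omega_def)
  have "src Omega (p, q) = rng Omega (q, r)" by (simp add: Omega_def)
  then have "x (cmp Omega (p, q) (q, r)) = x (p, q) \<cdot> x (q, r)"
    using x w w' unfolding infinite_paths_def by blast
  then show "x (p, r) = x (p, q) \<cdot> x (q, r)" by (simp add: Omega_def)
qed

lemma pair_zero_le [simp]: "(0 :: nat \<times> nat) \<le> p"
  by (simp add: less_eq_prod_def)

text \<open>
  Here \<open>y\<close> is \<open>\<mu> x\<close>.  As \<open>\<mu> x(0, n)\<close> and \<open>\<nu> x(0, n)\<close> have a common extension for \<open>n = deg \<nu> + k\<close>, their initial segments of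
  degree \<open>deg \<nu> + k\<close> agree.  These are \<open>y(0, deg \<nu> + k)\<close> and \<open>\<nu> x(0, k)\<close>.  Hence \<open>y\<close> is also \<open>\<nu> x\<close>.
\<close>

lemma prepend_witness:
  assumes \<mu>: "\<mu> \<in> mor \<Lambda>" and \<nu>: "\<nu> \<in> mor \<Lambda>" and x: "x \<in> infinite_paths \<Lambda>"
    and common: "\<And>k. \<exists>\<alpha> \<in> mor \<Lambda>. \<exists>\<beta> \<in> mor \<Lambda>. \<mu> \<cdot> x (0, k) \<cdot> \<alpha> = \<nu> \<cdot> x (0, k) \<cdot> \<beta>"
    and y: "y \<in> infinite_paths \<Lambda>" "y (0, deg \<Lambda> \<mu>) = \<mu>" "shift (deg \<Lambda> \<mu>) y = x"
  shows "y (0, deg \<Lambda> \<nu>) = \<nu> \<and> shift (deg \<Lambda> \<nu>) y = x"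
proof -
  let ?m = "deg \<Lambda> \<mu>" and ?n = "deg \<Lambda> \<nu>"
  have xy: "x (p, q) = y (p + ?m, q + ?m)" if "p \<le> q" for p q
    unfolding y(3)[symmetric] using that by (simp add: shift_def Omega_def)
  have xm: "x (p, q) \<in> mor \<Lambda>" "deg \<Lambda> (x (p, q)) = q - p" if "p \<le> q" for p q
    using infinite_path(1,2)[OF x that] by simp_all
  have ym: "y (p, q) \<in> mor \<Lambda>" "deg \<Lambda> (y (p, q)) = q - p" if "p \<le> q" for p q
    using infinite_path(1,2)[OF y(1) that] by simp_all
  have long: "y (0, k + ?m) = \<mu> \<cdot> x (0, k)" for k
    using infinite_path(3)[OF y(1), of 0 ?m "k + ?m"] y(2) xy[of 0 k] by simp
  have initial: "y (0, ?n + k) = \<nu> \<cdot> x (0, k)" for k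
  proof -
    let ?K = "?n + k"
    obtain \<alpha> \<beta> where \<alpha>: "\<alpha> \<in> mor \<Lambda>" and \<beta>: "\<beta> \<in> mor \<Lambda>" and eq: "\<mu> \<cdot> x (0, ?K) \<cdot> \<alpha> = \<nu> \<cdot> x (0, ?K) \<cdot> \<beta>"
      using common by blast
    have "\<mu> \<cdot> x (0, ?K) = y (0, ?K) \<cdot> y (?K, ?K + ?m)"
      using infinite_path(3)[OF y(1), of 0 ?K "?K + ?m"] long[of ?K] by simp
    moreover have "x (0, ?K) = x (0, k) \<cdot> x (k, ?K)" using infinite_path(3)[OF x, of 0 k ?K] by simp
    ultimately have "y (0, ?K) \<cdot> (y (?K, ?K + ?m) \<cdot> \<alpha>) = (\<nu> \<cdot> x (0, k)) \<cdot> (x (k, ?K) \<cdot> \<beta>)"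
      using eq \<alpha> \<beta> \<mu> \<nu> xm ym by (simp add: conc_assoc)
    then show ?thesis using \<alpha> \<beta> \<nu> xm ym by (subst (asm) conc_eq_iff) auto
  qed
  have x0: "x (0, 0) = v" using xm[of 0 0] vertex by (auto simp: paths_def zero_prod_def)
  have yn: "y (0, ?n) = \<nu>" using initial[of 0] x0 \<nu> by simp
  have tail: "y (?n, ?n + k) = x (0, k)" for k
  proof -
    have "\<nu> \<cdot> y (?n, ?n + k) = \<nu> \<cdot> x (0, k)"
      using infinite_path(3)[OF y(1), of 0 ?n "?n + k"] initial[of k] yn by simp
    then show ?thesis using \<nu> xm ym by (subst (asm) conc_eq_iff) auto
  qed
  have "y (p + ?n, q + ?n) = x (p, q)" if pq: "p \<le> q" for p q
  proof -
    obtain l where l: "q = p + l" using pq by (rule pair_le_addE)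
    have "y (?n, ?n + q) = y (?n, ?n + p) \<cdot> y (?n + p, ?n + q)"
      by (rule infinite_path(3)[OF y(1)]) (auto simp: l less_eq_prod_def)
    moreover have "x (0, q) = x (0, p) \<cdot> x (p, q)" using infinite_path(3)[OF x, of 0 p q] pq by simp
    ultimately have "x (0, p) \<cdot> y (?n + p, ?n + q) = x (0, p) \<cdot> x (p, q)" by (simp add: tail)
    moreover have "?n + p \<le> ?n + q" by (auto simp: l less_eq_prod_def)
    ultimately show ?thesis using xm ym pq by (subst (asm) conc_eq_iff) (auto simp: add.commute)
  qed
  moreover have "x w = undefined" if "w \<notin> mor Omega" for w
    using x that unfolding infinite_paths_def by (blast intro: PiE_arb)
  ultimately have "shift ?n y = x"
    by (intro ext) (auto simp: shift_def restrict_def Omega_def fun_eq_iff)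
  with yn show ?thesis by simp
qed

text \<open>
  The two infinite paths are definite descriptions, and the described properties are equivalent.
\<close>

lemma prepend_eq_of_common_extensions:
  assumes \<mu>: "\<mu> \<in> mor \<Lambda>" and \<nu>: "\<nu> \<in> mor \<Lambda>" and x: "x \<in> infinite_paths \<Lambda>"
    and common: "\<And>k. \<exists>\<alpha> \<in> mor \<Lambda>. \<exists>\<beta> \<in> mor \<Lambda>. \<mu> \<cdot> x (0, k) \<cdot> \<alpha> = \<nu> \<cdot> x (0, k) \<cdot> \<beta>"
  shows "prepend \<Lambda> \<mu> x = prepend \<Lambda> \<nu> x"
proof -
  have common': "\<And>k. \<exists>\<alpha> \<in> mor \<Lambda>. \<exists>\<beta> \<in> mor \<Lambda>. \<nu> \<cdot> x (0, k) \<cdot> \<alpha> = \<mu> \<cdot> x (0, k) \<cdot> \<beta>"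
    using common by metis
  have "(\<lambda>y. y \<in> infinite_paths \<Lambda> \<and> y (0, deg \<Lambda> \<mu>) = \<mu> \<and> shift (deg \<Lambda> \<mu>) y = x)
      = (\<lambda>y. y \<in> infinite_paths \<Lambda> \<and> y (0, deg \<Lambda> \<nu>) = \<nu> \<and> shift (deg \<Lambda> \<nu>) y = x)"
    using prepend_witness[OF \<mu> \<nu> x common] prepend_witness[OF \<nu> \<mu> x common'] by (intro ext) blast
  then show ?thesis by (simp add: prepend_def)
qed

definition incomparable :: "'a \<Rightarrow> 'a \<Rightarrow> bool" where
  "incomparable \<mu> \<nu> \<longleftrightarrow> (\<forall>\<alpha> \<in> mor \<Lambda>. \<forall>\<beta> \<in> mor \<Lambda>. \<mu> \<cdot> \<alpha> \<noteq> \<nu> \<cdot> \<beta>)"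

lemma incomparable_extend:
  "\<lbrakk>incomparable \<mu> \<nu>; \<mu> \<in> mor \<Lambda>; \<nu> \<in> mor \<Lambda>; \<tau> \<in> mor \<Lambda>\<rbrakk> \<Longrightarrow> incomparable (\<mu> \<cdot> \<tau>) (\<nu> \<cdot> \<tau>)"
  by (auto simp: incomparable_def conc_assoc)

lemma incomparable_extension_exists:
  assumes \<mu>: "\<mu> \<in> mor \<Lambda>" and \<nu>: "\<nu> \<in> mor \<Lambda>" and nper: "zdeg (deg \<Lambda> \<mu>) - zdeg (deg \<Lambda> \<nu>) \<notin> Per \<Lambda>"
  shows "\<exists>\<tau> \<in> mor \<Lambda>. incomparable (\<mu> \<cdot> \<tau>) (\<nu> \<cdot> \<tau>)"
proof -
  have "\<not> cycline_pair \<Lambda> \<mu> \<nu>" using nper by (auto simp: Per_def zdeg_def)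
  then obtain x where x: "x \<in> infinite_paths \<Lambda>" and ne: "prepend \<Lambda> \<mu> x \<noteq> prepend \<Lambda> \<nu> x"
    using \<mu> \<nu> by (auto simp: cycline_pair_def)
  then obtain k where "incomparable (\<mu> \<cdot> x (0, k)) (\<nu> \<cdot> x (0, k))"
    using prepend_eq_of_common_extensions[OF \<mu> \<nu> x] unfolding incomparable_def by blast
  then show ?thesis using infinite_path(1)[OF x, of 0 k] by auto
qed

text \<open>
  Prolonging both members of a pair by one path does not change the difference of their degrees, and
  incomparability persists.  So the pairs can be treated one after the other.
\<close>

lemma incomparable_extension_finite:
  assumes "finite Z" and "\<And>\<mu> \<nu>. (\<mu>, \<nu>) \<in> Z \<Longrightarrow> \<mu> \<in> mor \<Lambda> \<and> \<nu> \<in> mor \<Lambda> \<and> zdeg (deg \<Lambda> \<mu>) - zdeg (deg \<Lambda> \<nu>) \<notin> Per \<Lambda>"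
  shows "\<exists>\<tau> \<in> mor \<Lambda>. \<forall>(\<mu>, \<nu>) \<in> Z. incomparable (\<mu> \<cdot> \<tau>) (\<nu> \<cdot> \<tau>)"
  using assms
proof (induction rule: finite_induct)
  case (insert z Z)
  obtain \<mu> \<nu> where z: "z = (\<mu>, \<nu>)" by force
  have \<mu>\<nu>: "\<mu> \<in> mor \<Lambda>" "\<nu> \<in> mor \<Lambda>" "zdeg (deg \<Lambda> \<mu>) - zdeg (deg \<Lambda> \<nu>) \<notin> Per \<Lambda>" using insert z by auto
  obtain \<tau> where \<tau>: "\<tau> \<in> mor \<Lambda>" "\<And>\<mu> \<nu>. (\<mu>, \<nu>) \<in> Z \<Longrightarrow> incomparable (\<mu> \<cdot> \<tau>) (\<nu> \<cdot> \<tau>)" using insert by blast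
  obtain \<tau>' where \<tau>': "\<tau>' \<in> mor \<Lambda>" "incomparable (\<mu> \<cdot> \<tau> \<cdot> \<tau>') (\<nu> \<cdot> \<tau> \<cdot> \<tau>')"
    using incomparable_extension_exists[of "\<mu> \<cdot> \<tau>" "\<nu> \<cdot> \<tau>"] \<mu>\<nu> \<tau>(1) by (auto simp: zdeg_add)
  have "incomparable (\<alpha> \<cdot> (\<tau> \<cdot> \<tau>')) (\<beta> \<cdot> (\<tau> \<cdot> \<tau>'))" if "(\<alpha>, \<beta>) \<in> insert z Z" for \<alpha> \<beta>
  proof (cases "(\<alpha>, \<beta>) = z")
    case True
    then show ?thesis using \<tau>' \<tau>(1) \<mu>\<nu> z by (simp add: conc_assoc)
  next
    case False
    then have mem: "(\<alpha>, \<beta>) \<in> Z" using that by auto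
    have "\<alpha> \<in> mor \<Lambda>" "\<beta> \<in> mor \<Lambda>" using insert.prems[OF that] by auto
    then show ?thesis using incomparable_extend[OF \<tau>(2)[OF mem] _ _ \<tau>'(1)] \<tau>(1) \<tau>'(1) by (simp add: conc_assoc)
  qed
  then show ?case using \<tau>(1) \<tau>'(1) by (intro bexI[of _ "\<tau> \<cdot> \<tau>'"]) auto
qed (use vertex_mor in blast)

end

section \<open>The unitary of a periodic 2-graph\<close>

locale periodic_ck_algebra = ck_algebra \<Lambda> v A s
  for \<Lambda> :: "'a graded_category" and v :: 'a and A :: "'c cstar" (structure) and s :: "'a \<Rightarrow> 'c" +
  fixes a b :: nat and h :: "'a \<Rightarrow> 'a"
  assumes bij_h: "bij_betw h (paths \<Lambda> (a, 0)) (paths \<Lambda> (0, b))"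
    and conc_h: "\<lbrakk>\<mu> \<in> paths \<Lambda> (a, 0); \<nu> \<in> paths \<Lambda> (0, b)\<rbrakk>
           \<Longrightarrow> \<mu> \<cdot> \<nu> = h \<mu> \<cdot> inv_into (paths \<Lambda> (a, 0)) h \<nu>"
begin

text \<open>
  Every cycline pair \<open>(\<mu>, h \<mu>)\<close> satisfies \<open>s \<mu> = W s (h \<mu>)\<close>.
\<close>

definition W :: 'c where
  "W = finsum A (\<lambda>\<mu>. s \<mu> \<otimes> star A (s (h \<mu>))) (paths \<Lambda> (a, 0))"

lemma h_paths: "\<mu> \<in> paths \<Lambda> (a, 0) \<Longrightarrow> h \<mu> \<in> paths \<Lambda> (0, b)"
  using bij_h by (auto simp: bij_betw_def)

lemma first_color_mor: "\<mu> \<in> paths \<Lambda> (a, 0) \<Longrightarrow> \<mu> \<in> mor \<Lambda> \<and> h \<mu> \<in> mor \<Lambda>"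
  using h_paths mem_pathsD by blast

lemma h_eq_iff: "\<lbrakk>\<mu> \<in> paths \<Lambda> (a, 0); \<nu> \<in> paths \<Lambda> (a, 0)\<rbrakk> \<Longrightarrow> h \<mu> = h \<nu> \<longleftrightarrow> \<mu> = \<nu>"
  using bij_h by (auto simp: bij_betw_def inj_on_def)

lemma W_closed [simp]: "W \<in> carrier A"
  unfolding W_def by (rule finsum_closed) (use first_color_mor in auto)

lemma star_W: "star A W = finsum A (\<lambda>\<mu>. s (h \<mu>) \<otimes> star A (s \<mu>)) (paths \<Lambda> (a, 0))"
proof -
  have "star A W = finsum A (\<lambda>\<mu>. star A (s \<mu> \<otimes> star A (s (h \<mu>)))) (paths \<Lambda> (a, 0))"
    unfolding W_def using first_color_mor by (intro star_finsum) auto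
  also have "\<dots> = finsum A (\<lambda>\<mu>. s (h \<mu>) \<otimes> star A (s \<mu>)) (paths \<Lambda> (a, 0))"
    using first_color_mor by (intro finsum_cong') (auto simp: star_mult star_star)
  finally show ?thesis .
qed

lemma W_s_h: 
  assumes \<mu>: "\<mu> \<in> paths \<Lambda> (a, 0)"
  shows "W \<otimes> s (h \<mu>) = s \<mu>"
proof -
  have "W \<otimes> s (h \<mu>) = finsum A (\<lambda>\<nu>. s \<nu> \<otimes> star A (s (h \<nu>)) \<otimes> s (h \<mu>)) (paths \<Lambda> (a, 0))"
    unfolding W_def using first_color_mor first_color_mor[OF \<mu>] by (intro finsum_mult_right) auto
  also have "\<dots> = s \<mu> \<otimes> star A (s (h \<mu>)) \<otimes> s (h \<mu>)"
  proof (rule finsum_eq_single)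
    fix \<nu> assume \<nu>: "\<nu> \<in> paths \<Lambda> (a, 0)" "\<nu> \<noteq> \<mu>"
    then have "star A (s (h \<nu>)) \<otimes> s (h \<mu>) = \<zero>"
      using star_s_s_orthogonal[OF h_paths h_paths] h_eq_iff \<mu> by metis
    then show "s \<nu> \<otimes> star A (s (h \<nu>)) \<otimes> s (h \<mu>) = \<zero>" using first_color_mor[OF \<nu>(1)] first_color_mor[OF \<mu>] by (simp add: mult_assoc)
  qed (use \<mu> first_color_mor[OF \<mu>] in auto)
  finally show ?thesis using first_color_mor[OF \<mu>] by (simp add: mult_assoc)
qed

lemma star_W_s:
  assumes \<mu>: "\<mu> \<in> paths \<Lambda> (a, 0)"
  shows "star A W \<otimes> s \<mu> = s (h \<mu>)"
proof -
  have "star A W \<otimes> s \<mu> = finsum A (\<lambda>\<nu>. s (h \<nu>) \<otimes> star A (s \<nu>) \<otimes> s \<mu>) (paths \<Lambda> (a, 0))"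
    unfolding star_W using first_color_mor first_color_mor[OF \<mu>] by (intro finsum_mult_right) auto
  also have "\<dots> = s (h \<mu>) \<otimes> star A (s \<mu>) \<otimes> s \<mu>"
  proof (rule finsum_eq_single)
    fix \<nu> assume \<nu>: "\<nu> \<in> paths \<Lambda> (a, 0)" "\<nu> \<noteq> \<mu>"
    then have "star A (s \<nu>) \<otimes> s \<mu> = \<zero>" using star_s_s_orthogonal \<mu> by metis
    then show "s (h \<nu>) \<otimes> star A (s \<nu>) \<otimes> s \<mu> = \<zero>" using first_color_mor[OF \<nu>(1)] first_color_mor[OF \<mu>] by (simp add: mult_assoc)
  qed (use \<mu> first_color_mor[OF \<mu>] in auto)
  finally show ?thesis using first_color_mor[OF \<mu>] by (simp add: mult_assoc)
qed

text \<open>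
  This is where the identity \<open>\<mu> (h \<nu>) = (h \<mu>) \<nu>\<close> enters: it moves \<open>h\<close> from the second factor to the first.
  Together with \<open>star_W_s\<close> it shows that \<open>W\<close> commutes with \<open>s \<mu>\<close> and with \<open>s (h \<mu>)\<close>.
\<close>

lemma s_star_W:
  assumes \<mu>: "\<mu> \<in> paths \<Lambda> (a, 0)"
  shows "s \<mu> \<otimes> star A W = s (h \<mu>)"
proof -
  have "s \<mu> \<otimes> star A W = finsum A (\<lambda>\<nu>. s \<mu> \<otimes> (s (h \<nu>) \<otimes> star A (s \<nu>))) (paths \<Lambda> (a, 0))"
    unfolding star_W using first_color_mor first_color_mor[OF \<mu>] by (intro finsum_mult_left) auto
  also have "\<dots> = finsum A (\<lambda>\<nu>. s (h \<mu>) \<otimes> (s \<nu> \<otimes> star A (s \<nu>))) (paths \<Lambda> (a, 0))"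
  proof (intro finsum_cong' refl)
    fix \<nu> assume \<nu>: "\<nu> \<in> paths \<Lambda> (a, 0)"
    have "inv_into (paths \<Lambda> (a, 0)) h (h \<nu>) = \<nu>" using bij_h \<nu> by (simp add: bij_betw_def)
    then have "\<mu> \<cdot> h \<nu> = h \<mu> \<cdot> \<nu>" using conc_h[OF \<mu> h_paths[OF \<nu>]] by simp
    then have "s \<mu> \<otimes> s (h \<nu>) = s (h \<mu>) \<otimes> s \<nu>" using first_color_mor[OF \<mu>] first_color_mor[OF \<nu>] by (metis s_conc)
    then show "s \<mu> \<otimes> (s (h \<nu>) \<otimes> star A (s \<nu>)) = s (h \<mu>) \<otimes> (s \<nu> \<otimes> star A (s \<nu>))"
      using first_color_mor[OF \<mu>] first_color_mor[OF \<nu>] by (simp flip: mult_assoc)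
  qed (use first_color_mor first_color_mor[OF \<mu>] in auto)
  also have "\<dots> = s (h \<mu>) \<otimes> s v"
    unfolding unit_sum[of "(a, 0)", symmetric]
    using first_color_mor first_color_mor[OF \<mu>] by (intro finsum_mult_left[symmetric]) auto
  finally show ?thesis using first_color_mor[OF \<mu>] by simp
qed

lemma star_W_W: "star A W \<otimes> W = s v"
proof -
  let ?P = "paths \<Lambda> (a, 0)"
  have "star A W \<otimes> W = finsum A (\<lambda>\<mu>. s (h \<mu>) \<otimes> star A (s \<mu>) \<otimes> W) ?P"
    using first_color_mor by (subst star_W) (intro finsum_mult_right, auto)
  also have "\<dots> = finsum A (\<lambda>\<mu>. s (h \<mu>) \<otimes> star A (s (h \<mu>))) ?P"
  proof (intro finsum_cong' refl)
    fix \<mu> assume \<mu>: "\<mu> \<in> ?P"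
    have "star A (s \<mu>) \<otimes> W = star A (star A W \<otimes> s \<mu>)" using first_color_mor[OF \<mu>] by (simp add: star_mult star_star)
    then show "s (h \<mu>) \<otimes> star A (s \<mu>) \<otimes> W = s (h \<mu>) \<otimes> star A (s (h \<mu>))"
      using first_color_mor[OF \<mu>] star_W_s[OF \<mu>] by (simp add: mult_assoc)
  qed (use first_color_mor in auto)
  also have "\<dots> = finsum A (\<lambda>\<nu>. s \<nu> \<otimes> star A (s \<nu>)) (h ` ?P)"
  proof (rule finsum_reindex[symmetric])
    show "(\<lambda>\<nu>. s \<nu> \<otimes> star A (s \<nu>)) \<in> h ` ?P \<rightarrow> carrier A" using first_color_mor by auto
  qed (use bij_h in \<open>simp add: bij_betw_def\<close>)
  also have "h ` ?P = paths \<Lambda> (0, b)" using bij_h by (simp add: bij_betw_def)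
  finally show ?thesis by (simp add: unit_sum)
qed

lemma s_h_W: 
  assumes \<mu>: "\<mu> \<in> paths \<Lambda> (a, 0)"
  shows "s (h \<mu>) \<otimes> W = s \<mu>"
  using s_star_W[OF \<mu>] star_W_W first_color_mor[OF \<mu>] mult_assoc[of "s \<mu>" "star A W" W] by simp

lemma W_s: 
  assumes \<mu>: "\<mu> \<in> paths \<Lambda> (a, 0)"
  shows "W \<otimes> s \<mu> = s \<mu> \<otimes> W"
  using W_s_h[OF \<mu>] s_h_W[OF \<mu>] first_color_mor[OF \<mu>] mult_assoc[of W "s (h \<mu>)" W] by simp

lemma W_block: "W \<in> block (a, 0) (0, b)"
  unfolding W_def block_def
  by (intro lspan_finsum[OF block_gens] lspan_gen[OF _ block_gens] finite_paths) (use h_paths in blast)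

lemma W_unit [simp]: "s v \<otimes> W = W" "W \<otimes> s v = W"
proof -
  show "W \<otimes> s v = W" using block_graded[OF W_block] by (rule graded_unit)
  have "star A W \<otimes> s v = star A W" using block_graded[OF block_star[OF W_block]] by (rule graded_unit)
  then have "star A (star A W \<otimes> s v) = star A (star A W)" by simp
  then show "s v \<otimes> W = W" by (simp add: star_mult star_star)
qed

lemma W_commutes: 
  assumes "\<rho> \<in> paths \<Lambda> (i * a, j * b)"
  shows "W \<otimes> s \<rho> = s \<rho> \<otimes> W"
proof -
  have step: "W \<otimes> s (\<mu> \<cdot> \<rho>) = s (\<mu> \<cdot> \<rho>) \<otimes> W"
    if "W \<otimes> s \<mu> = s \<mu> \<otimes> W" "W \<otimes> s \<rho> = s \<rho> \<otimes> W" "\<mu> \<in> mor \<Lambda>" "\<rho> \<in> mor \<Lambda>" for \<mu> \<rho>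
    using that by (metis W_closed mult_assoc s_closed s_conc)
  have b: "W \<otimes> s \<rho> = s \<rho> \<otimes> W" if "\<rho> \<in> paths \<Lambda> (0, j * b)" for j \<rho>
    using that
  proof (induction j arbitrary: \<rho>)
    case 0
    then show ?case using vertex by simp
  next
    case (Suc j)
    then have "\<rho> \<in> paths \<Lambda> ((0, b) + (0, j * b))" by simp
    then obtain \<nu> \<rho>' where \<nu>: "\<nu> \<in> paths \<Lambda> (0, b)" and \<rho>': "\<rho>' \<in> paths \<Lambda> (0, j * b)" and eq: "\<rho> = \<nu> \<cdot> \<rho>'"
      by (rule factor_path)
    obtain \<mu> where \<mu>: "\<mu> \<in> paths \<Lambda> (a, 0)" "\<nu> = h \<mu>" using \<nu> bij_h by (auto simp: bij_betw_def)
    have "W \<otimes> s \<nu> = s \<nu> \<otimes> W" using W_s_h[OF \<mu>(1)] s_h_W[OF \<mu>(1)] \<mu>(2) by simp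
    then show ?case unfolding eq using Suc.IH[OF \<rho>'] mem_pathsD(1)[OF \<nu>] mem_pathsD(1)[OF \<rho>'] by (rule step)
  qed
  show ?thesis using assms
  proof (induction i arbitrary: \<rho>)
    case 0
    then show ?case using b by simp
  next
    case (Suc i)
    then have "\<rho> \<in> paths \<Lambda> ((a, 0) + (i * a, j * b))" by simp
    then obtain \<mu> \<rho>' where \<mu>: "\<mu> \<in> paths \<Lambda> (a, 0)" and \<rho>': "\<rho>' \<in> paths \<Lambda> (i * a, j * b)" and eq: "\<rho> = \<mu> \<cdot> \<rho>'"
      by (rule factor_path)
    show ?case unfolding eq
      using W_s[OF \<mu>] Suc.IH[OF \<rho>'] mem_pathsD(1)[OF \<mu>] mem_pathsD(1)[OF \<rho>'] by (rule step)
  qed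
qed

definition Wpow :: "nat \<Rightarrow> 'c" where
  "Wpow k = ((\<lambda>x. W \<otimes> x) ^^ k) (s v)"

lemma Wpow_simps [simp]: "Wpow 0 = s v" "Wpow (Suc k) = W \<otimes> Wpow k"
  by (simp_all add: Wpow_def)

lemma Wpow_closed [simp]: "Wpow k \<in> carrier A"
  by (induction k) auto

lemma Wpow_unit [simp]: "s v \<otimes> Wpow k = Wpow k"
  by (induction k) (auto simp flip: mult_assoc)

lemma Wpow_commutes: "\<rho> \<in> paths \<Lambda> (i * a, j * b) \<Longrightarrow> Wpow k \<otimes> s \<rho> = s \<rho> \<otimes> Wpow k"
proof (induction k)
  case 0
  then show ?case by (simp add: mem_pathsD)
next
  case (Suc k)
  then show ?case using W_commutes[OF Suc.prems] mem_pathsD(1)[OF Suc.prems]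
    by (metis W_closed Wpow_closed Wpow_simps(2) mult_assoc s_closed)
qed

text \<open>
  Each segment \<open>\<mu>\<close> of degree \<open>(a, 0)\<close> is replaced by \<open>h \<mu>\<close> at the cost of a factor \<open>W\<close>, which moves to the
  front.  The degree of the remaining path depends on \<open>i + j\<close> only; two paths whose degrees differ
  by a period therefore have remaining paths of equal degree.
\<close>

lemma normal_form: 
  assumes "\<rho> \<in> paths \<Lambda> (i * a, j * b)"
  shows "\<exists>\<nu> \<in> paths \<Lambda> (0, (i + j) * b). s \<rho> = Wpow i \<otimes> s \<nu>"
  using assms
proof (induction i arbitrary: \<rho>)
  case 0
  then show ?case by (intro bexI[of _ \<rho>]) (simp_all add: mem_pathsD)
next
  case (Suc i)
  then have "\<rho> \<in> paths \<Lambda> ((a, 0) + (i * a, j * b))" by simp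
  then obtain \<mu> \<rho>' where \<mu>: "\<mu> \<in> paths \<Lambda> (a, 0)" and \<rho>': "\<rho>' \<in> paths \<Lambda> (i * a, j * b)" and eq: "\<rho> = \<mu> \<cdot> \<rho>'"
    by (rule factor_path)
  obtain \<nu> where \<nu>: "\<nu> \<in> paths \<Lambda> (0, (i + j) * b)" "s \<rho>' = Wpow i \<otimes> s \<nu>" using Suc.IH[OF \<rho>'] by blast
  note [simp] = mem_pathsD(1)[OF \<rho>'] mem_pathsD(1)[OF \<nu>(1)]
  have [simp]: "\<mu> \<in> mor \<Lambda>" "h \<mu> \<in> mor \<Lambda>" using first_color_mor[OF \<mu>] by auto
  have "h \<mu> \<in> paths \<Lambda> (0 * a, 1 * b)" using h_paths[OF \<mu>] by simp
  then have comm: "s (h \<mu>) \<otimes> Wpow i = Wpow i \<otimes> s (h \<mu>)" by (rule Wpow_commutes[symmetric])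
  have "s \<rho> = W \<otimes> s (h \<mu>) \<otimes> (Wpow i \<otimes> s \<nu>)" by (simp add: eq s_conc W_s_h[OF \<mu>] \<nu>(2))
  also have "\<dots> = W \<otimes> ((s (h \<mu>) \<otimes> Wpow i) \<otimes> s \<nu>)" by (simp add: mult_assoc)
  also have "\<dots> = Wpow (Suc i) \<otimes> s (h \<mu> \<cdot> \<nu>)" unfolding comm by (simp add: mult_assoc s_conc)
  finally have "s \<rho> = Wpow (Suc i) \<otimes> s (h \<mu> \<cdot> \<nu>)" .
  moreover have "h \<mu> \<cdot> \<nu> \<in> paths \<Lambda> (0, (Suc i + j) * b)" using conc_paths[OF h_paths[OF \<mu>] \<nu>(1)] by simp
  ultimately show ?case by blast
qed

end

section \<open>Separating vectors from wandering vectors\<close>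

locale periodic_ck_representation =
  periodic_ck_algebra \<Lambda> v A s a b h + ck_star_representation \<Lambda> v A s H \<pi>
  for \<Lambda> :: "'a graded_category" and v :: 'a and A :: "'c cstar" (structure) and s :: "'a \<Rightarrow> 'c"
    and a b :: nat and h :: "'a \<Rightarrow> 'a"
    and H :: "'h inner_space" and \<pi> :: "'c \<Rightarrow> 'h \<Rightarrow> 'h" +
  assumes pos: "0 < a" "0 < b"
    and Per_eq: "Per \<Lambda> = range (\<lambda>k::int. (k * int a, - k * int b))"
    and wandering: "\<And>N. \<exists>\<zeta> \<in> carrier H. \<pi> (s v) \<zeta> = \<zeta> \<and> 0 < nsq \<zeta> \<and>
      (\<forall>k \<in> {1..N}. cinner H (\<pi> (Wpow k) \<zeta>) \<zeta> = 0)"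
begin

text \<open>
  \<open>W\<close> acts isometrically on the range of \<open>\<pi> (s v)\<close>.
\<close>

lemma cinner_Wpow_shift:
  assumes \<zeta>: "\<zeta> \<in> carrier H" "\<pi> (s v) \<zeta> = \<zeta>"
  shows "cinner H (\<pi> (Wpow (k + n)) \<zeta>) (\<pi> (Wpow n) \<zeta>) = cinner H (\<pi> (Wpow k) \<zeta>) \<zeta>"
proof (induction n)
  case (Suc n)
  have "cinner H (\<pi> W (\<pi> (Wpow (k + n)) \<zeta>)) (\<pi> W (\<pi> (Wpow n) \<zeta>))
      = cinner H (\<pi> (Wpow (k + n)) \<zeta>) (\<pi> (star A W) (\<pi> W (\<pi> (Wpow n) \<zeta>)))"
    using \<zeta> by (intro adjointsD[OF adjoints_graded[OF block_graded[OF W_block]]]) auto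
  also have "\<pi> (star A W) (\<pi> W (\<pi> (Wpow n) \<zeta>)) = \<pi> (star A W \<otimes> W \<otimes> Wpow n) \<zeta>" using \<zeta> by (simp add: rep_mult)
  also have "\<dots> = \<pi> (Wpow n) \<zeta>" by (simp add: star_W_W)
  finally show ?case using Suc \<zeta> by (simp add: rep_mult)
qed (use \<zeta> in simp)

text \<open>
  In normal form the inner product is that of \<open>s \<nu> W\<^sup>i \<zeta>\<close> and \<open>s \<nu>' W\<^sup>i\<^sup>' \<zeta>\<close> with \<open>\<nu>\<close> and \<open>\<nu>'\<close> of one degree.  It vanishes if
  they differ, and otherwise reduces to a power of \<open>W\<close> between \<open>1\<close> and \<open>N\<close>.
\<close>

lemma periodic_orthogonal:
  assumes \<zeta>: "\<zeta> \<in> carrier H" "\<pi> (s v) \<zeta> = \<zeta>" and W0: "\<And>k. k \<in> {1..N} \<Longrightarrow> cinner H (\<pi> (Wpow k) \<zeta>) \<zeta> = 0"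
    and \<rho>: "\<rho> \<in> paths \<Lambda> (i * a, j * b)" and \<rho>': "\<rho>' \<in> paths \<Lambda> (i' * a, j' * b)"
    and ij: "i + j = i' + j'" "i \<noteq> i'" "i \<le> i' + N" "i' \<le> i + N"
  shows "cinner H (\<pi> (s \<rho>) \<zeta>) (\<pi> (s \<rho>') \<zeta>) = 0"
proof -
  obtain \<nu> where \<nu>: "\<nu> \<in> paths \<Lambda> (0, (i + j) * b)" "s \<rho> = Wpow i \<otimes> s \<nu>" using normal_form[OF \<rho>] by blast
  obtain \<nu>' where \<nu>': "\<nu>' \<in> paths \<Lambda> (0, (i + j) * b)" "s \<rho>' = Wpow i' \<otimes> s \<nu>'" using normal_form[OF \<rho>'] ij(1) by auto
  note [simp] = mem_pathsD(1)[OF \<nu>(1)] mem_pathsD(1)[OF \<nu>'(1)]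
  have comm: "Wpow k \<otimes> s \<kappa> = s \<kappa> \<otimes> Wpow k" if "\<kappa> \<in> paths \<Lambda> (0, (i + j) * b)" for k \<kappa>
    using that by (intro Wpow_commutes[of _ 0 "i + j"]) simp
  have "cinner H (\<pi> (s \<rho>) \<zeta>) (\<pi> (s \<rho>') \<zeta>) = cinner H (\<pi> (s \<nu>) (\<pi> (Wpow i) \<zeta>)) (\<pi> (s \<nu>') (\<pi> (Wpow i') \<zeta>))"
    using \<zeta> \<nu> \<nu>' by (simp add: comm rep_mult)
  also have "\<dots> = cinner H (\<pi> (Wpow i) \<zeta>) (\<pi> (star A (s \<nu>) \<otimes> s \<nu>' \<otimes> Wpow i') \<zeta>)"
    using \<zeta> by (simp add: cinner_rep_s_move rep_mult)
  also have "\<dots> = 0"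
  proof (cases "\<nu> = \<nu>'")
    case False
    then have "star A (s \<nu>) \<otimes> s \<nu>' = \<zero>" using \<nu>(1) \<nu>'(1) by (intro star_s_s_orthogonal)
    then show ?thesis using \<zeta> by (simp add: cinner_rep_zero cinner_cnj[of _ "\<pi> \<zero> _"])
  next
    case True
    then have "cinner H (\<pi> (Wpow i) \<zeta>) (\<pi> (star A (s \<nu>) \<otimes> s \<nu>' \<otimes> Wpow i') \<zeta>)
        = cinner H (\<pi> (Wpow i) \<zeta>) (\<pi> (Wpow i') \<zeta>)" by simp
    also have "\<dots> = 0"
    proof (cases "i' < i")
      case True
      then have "i - i' \<in> {1..N}" using ij by auto
      from W0[OF this] show ?thesis using True cinner_Wpow_shift[OF \<zeta>, of "i - i'" i'] by simp
    next
      case False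
      then have "i' - i \<in> {1..N}" using ij by auto
      from W0[OF this] have "cinner H (\<pi> (Wpow i') \<zeta>) (\<pi> (Wpow i) \<zeta>) = 0"
        using False cinner_Wpow_shift[OF \<zeta>, of "i' - i" i] by simp
      then show ?thesis using \<zeta> by (simp add: cinner_cnj[of "\<pi> (Wpow i) \<zeta>"])
    qed
    finally show ?thesis .
  qed
  finally show ?thesis .
qed

text \<open>
  The vector is \<open>\<pi> (s \<tau>) \<zeta>\<^sub>0\<close> with \<open>\<zeta>\<^sub>0\<close> from \<open>wandering\<close>.  The path \<open>\<tau>\<close> separates the finitely many pairs
  whose degrees do not differ by a period.  Its degree is a multiple of \<open>a\<close> and of \<open>b\<close> in the two coordinates, like \<open>q\<close>, so that
  the normal form applies to the other pairs.
\<close>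

lemma separating_vector:
  "\<exists>q\<ge>q0. \<exists>\<zeta> \<in> carrier H. \<pi> (s v) \<zeta> = \<zeta> \<and> 0 < nsq \<zeta> \<and>
      (\<forall>p \<mu> \<mu>'. p \<le> q + n \<and> p \<noteq> q \<and> \<mu> \<in> paths \<Lambda> p \<and> \<mu>' \<in> paths \<Lambda> q
        \<longrightarrow> cinner H (\<pi> (s \<mu>) \<zeta>) (\<pi> (s \<mu>') \<zeta>) = 0)"
proof -
  define I J where "I = fst q0" and "J = snd q0"
  define q where "q = (I * a, J * b)"
  have "q0 \<le> q" using pos by (cases q0) (auto simp: q_def I_def J_def less_eq_prod_def)
  define P where "P = (\<Union>i\<in>{..fst (q + n)}. \<Union>j\<in>{..snd (q + n)}. paths \<Lambda> (i, j))"
  have P: "\<mu> \<in> P" if "\<mu> \<in> paths \<Lambda> p" "p \<le> q + n" for \<mu> p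
    using that unfolding P_def by (cases p) (auto simp: less_eq_prod_def)
  define Z where "Z = {(\<mu>, \<mu>') \<in> P \<times> paths \<Lambda> q. zdeg (deg \<Lambda> \<mu>) - zdeg (deg \<Lambda> \<mu>') \<notin> Per \<Lambda>}"
  have "finite (P \<times> paths \<Lambda> q)" by (auto simp: P_def)
  then have "finite Z" by (rule rev_finite_subset) (auto simp: Z_def)
  moreover have "\<mu> \<in> mor \<Lambda> \<and> \<mu>' \<in> mor \<Lambda> \<and> zdeg (deg \<Lambda> \<mu>) - zdeg (deg \<Lambda> \<mu>') \<notin> Per \<Lambda>" if "(\<mu>, \<mu>') \<in> Z" for \<mu> \<mu>'
    using that by (auto simp: Z_def P_def paths_def)
  ultimately obtain \<tau>0 where \<tau>0: "\<tau>0 \<in> mor \<Lambda>" "\<And>\<mu> \<mu>'. (\<mu>, \<mu>') \<in> Z \<Longrightarrow> incomparable (\<mu> \<cdot> \<tau>0) (\<mu>' \<cdot> \<tau>0)"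
    using incomparable_extension_finite[of Z] by blast
  define r t where "r = fst (deg \<Lambda> \<tau>0)" and "t = snd (deg \<Lambda> \<tau>0)"
  \<comment> \<open>This path completes the degree \<open>(r, t)\<close> of \<open>\<tau>0\<close> to \<open>(r a, t b)\<close>.\<close>
  obtain \<tau>1 where \<tau>1: "\<tau>1 \<in> paths \<Lambda> (r * a - r, t * b - t)" using paths_nonempty by blast
  define \<tau> where "\<tau> = \<tau>0 \<cdot> \<tau>1"
  have le: "r \<le> r * a" "t \<le> t * b" using pos by auto
  have \<tau>: "\<tau> \<in> paths \<Lambda> (r * a, t * b)"
    using conc_paths[OF mem_paths_deg[OF \<tau>0(1)] \<tau>1] le by (simp add: \<tau>_def r_def t_def plus_prod_def)
  have \<tau>m [simp]: "\<tau> \<in> mor \<Lambda>" using \<tau> by (rule mem_pathsD)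
  obtain \<zeta>0 where \<zeta>0: "\<zeta>0 \<in> carrier H" "\<pi> (s v) \<zeta>0 = \<zeta>0" "0 < nsq \<zeta>0"
    and W0: "\<And>k. k \<in> {1..I + J} \<Longrightarrow> cinner H (\<pi> (Wpow k) \<zeta>0) \<zeta>0 = 0" using wandering[of "I + J"] by blast
  define \<zeta> where "\<zeta> = \<pi> (s \<tau>) \<zeta>0"
  have \<zeta>: "\<zeta> \<in> carrier H" "\<pi> (s v) \<zeta> = \<zeta>" "nsq \<zeta> = nsq \<zeta>0"
    using \<zeta>0 cinner_rep_s_s[OF \<tau>m \<zeta>0(1,1,2)] by (simp_all add: \<zeta>_def rep_mult[symmetric] nsq_def)
  have "cinner H (\<pi> (s \<mu>) \<zeta>) (\<pi> (s \<mu>') \<zeta>) = 0"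
    if p: "p \<le> q + n" "p \<noteq> q" and \<mu>: "\<mu> \<in> paths \<Lambda> p" and \<mu>': "\<mu>' \<in> paths \<Lambda> q" for p \<mu> \<mu>'
  proof -
    note [simp] = mem_pathsD[OF \<mu>] mem_pathsD[OF \<mu>']
    have eq: "cinner H (\<pi> (s \<mu>) \<zeta>) (\<pi> (s \<mu>') \<zeta>) = cinner H (\<pi> (s (\<mu> \<cdot> \<tau>)) \<zeta>0) (\<pi> (s (\<mu>' \<cdot> \<tau>)) \<zeta>0)"
      using \<zeta>0 by (simp add: \<zeta>_def s_conc rep_mult)
    show ?thesis
    proof (cases "zdeg p - zdeg q \<in> Per \<Lambda>")
      case False
      then have mem: "(\<mu>, \<mu>') \<in> Z" using P[OF \<mu> p(1)] \<mu>' by (simp add: Z_def)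
      have "incomparable (\<mu> \<cdot> \<tau>0 \<cdot> \<tau>1) (\<mu>' \<cdot> \<tau>0 \<cdot> \<tau>1)"
        using \<tau>0(1) by (intro incomparable_extend[OF \<tau>0(2)[OF mem] _ _ mem_pathsD(1)[OF \<tau>1]]) simp_all
      then have "star A (s (\<mu> \<cdot> \<tau>)) \<otimes> s (\<mu>' \<cdot> \<tau>) = \<zero>"
        using \<tau>0(1) mem_pathsD(1)[OF \<tau>1] unfolding incomparable_def
        by (intro star_s_s_no_common_extension) (auto simp: \<tau>_def conc_assoc)
      then show ?thesis unfolding eq using \<zeta>0
        by (simp add: cinner_rep_s_move rep_mult[symmetric] cinner_rep_zero cinner_cnj[of _ "\<pi> \<zero> _"])
    next
      case True
      then obtain k :: int where "zdeg p - zdeg q = (k * int a, - k * int b)" unfolding Per_eq by blast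
      then have k: "int (fst p) = (int I + k) * int a" "int (snd p) = (int J - k) * int b"
        by (auto simp: zdeg_def q_def algebra_simps prod_eq_iff)
      have "0 \<le> (int I + k) * int a" "0 \<le> (int J - k) * int b" by (simp_all flip: k)
      then have nn: "0 \<le> int I + k" "0 \<le> int J - k" using pos by (simp_all add: zero_le_mult_iff)
      define i j where "i = nat (int I + k)" and "j = nat (int J - k)"
      have "int (fst p) = int (i * a)" "int (snd p) = int (j * b)" using k nn by (simp_all add: i_def j_def)
      then have p_eq: "p = (i * a, j * b)" by (simp only: of_nat_eq_iff prod_eq_iff fst_conv snd_conv)
      have "i \<noteq> I" using p(2) nn pos unfolding p_eq q_def by (auto simp: i_def j_def)
      show ?thesis unfolding eq
      proof (rule periodic_orthogonal[OF \<zeta>0(1,2) W0])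
        show "\<mu> \<cdot> \<tau> \<in> paths \<Lambda> ((i + r) * a, (j + t) * b)" using conc_paths[OF \<mu> \<tau>] by (simp add: p_eq add_mult_distrib)
        show "\<mu>' \<cdot> \<tau> \<in> paths \<Lambda> ((I + r) * a, (J + t) * b)" using conc_paths[OF \<mu>' \<tau>] by (simp add: q_def add_mult_distrib)
      qed (use \<open>i \<noteq> I\<close> nn in \<open>auto simp: i_def j_def\<close>)
    qed
  qed
  then show ?thesis using \<open>q0 \<le> q\<close> \<zeta> \<zeta>0(3) by (intro exI[of _ q] conjI bexI[of _ \<zeta>]) auto
qed

end

section \<open>The space of square-integrable functions\<close>

lemma l2_measurable: "\<phi> \<in> l2_functions \<eta> \<Longrightarrow> \<phi> \<in> borel_measurable \<eta>"
  by (simp add: l2_functions_def)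

lemma cnj_measurable: "\<phi> \<in> borel_measurable \<eta> \<Longrightarrow> (\<lambda>x. cnj (\<phi> x)) \<in> borel_measurable \<eta>"
  by (intro borel_measurable_continuous_on[where f = cnj]) (auto intro!: continuous_intros)

lemma l2_mult_integrable:
  assumes \<phi>: "\<phi> \<in> l2_functions \<eta>" and \<psi>: "\<psi> \<in> l2_functions \<eta>"
  shows "integrable \<eta> (\<lambda>x. \<phi> x * cnj (\<psi> x))"
proof (rule Bochner_Integration.integrable_bound)
  show "integrable \<eta> (\<lambda>x. (cmod (\<phi> x))\<^sup>2 + (cmod (\<psi> x))\<^sup>2)" using assms by (simp add: l2_functions_def)
  note [measurable] = l2_measurable[OF \<phi>] l2_measurable[OF \<psi>]
  note [measurable] = cnj_measurable[OF l2_measurable[OF \<psi>]]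
  show "(\<lambda>x. \<phi> x * cnj (\<psi> x)) \<in> borel_measurable \<eta>" by measurable
  have "x * y \<le> x\<^sup>2 + y\<^sup>2" if "0 \<le> x" "0 \<le> y" for x y :: real
    using sum_squares_bound[of x y] mult_nonneg_nonneg[OF that] by simp
  then show "AE x in \<eta>. norm (\<phi> x * cnj (\<psi> x)) \<le> norm ((cmod (\<phi> x))\<^sup>2 + (cmod (\<psi> x))\<^sup>2)"
    by (intro AE_I2) (simp add: norm_mult)
qed

lemma l2_add: 
  assumes \<phi>: "\<phi> \<in> l2_functions \<eta>" and \<psi>: "\<psi> \<in> l2_functions \<eta>"
  shows "(\<lambda>x. \<phi> x + \<psi> x) \<in> l2_functions \<eta>"
proof -
  note [measurable] = l2_measurable[OF \<phi>] l2_measurable[OF \<psi>]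
  have "integrable \<eta> (\<lambda>x. (cmod (\<phi> x + \<psi> x))\<^sup>2)"
  proof (rule Bochner_Integration.integrable_bound)
    show "integrable \<eta> (\<lambda>x. 2 * (cmod (\<phi> x))\<^sup>2 + 2 * (cmod (\<psi> x))\<^sup>2)" using assms by (simp add: l2_functions_def)
    have "(cmod (a + b))\<^sup>2 \<le> 2 * (cmod a)\<^sup>2 + 2 * (cmod b)\<^sup>2" for a b
    proof -
      have "(cmod (a + b))\<^sup>2 \<le> (cmod a + cmod b)\<^sup>2" by (intro power_mono norm_triangle_ineq) simp
      also have "\<dots> \<le> 2 * (cmod a)\<^sup>2 + 2 * (cmod b)\<^sup>2"
        using sum_squares_bound[of "cmod a" "cmod b"] by (simp add: power2_sum)
      finally show ?thesis .
    qed
    then show "AE x in \<eta>. norm ((cmod (\<phi> x + \<psi> x))\<^sup>2) \<le> norm (2 * (cmod (\<phi> x))\<^sup>2 + 2 * (cmod (\<psi> x))\<^sup>2)"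
      by (intro AE_I2) simp
  qed measurable
  then show ?thesis by (simp add: l2_functions_def)
qed

lemma l2_scale:
  assumes \<phi>: "\<phi> \<in> l2_functions \<eta>"
  shows "(\<lambda>x. c * \<phi> x) \<in> l2_functions \<eta>"
proof -
  note [measurable] = l2_measurable[OF \<phi>]
  have "(\<lambda>x. c * \<phi> x) \<in> borel_measurable \<eta>" by measurable
  then show ?thesis using \<phi> by (simp add: l2_functions_def norm_mult power_mult_distrib)
qed

lemma l2_indicator_mult:
  assumes S: "S \<in> sets \<eta>" and \<phi>: "\<phi> \<in> l2_functions \<eta>"
  shows "(\<lambda>x. indicator S x * \<phi> x) \<in> l2_functions \<eta>"
proof -
  note [measurable] = S l2_measurable[OF \<phi>]
  have "integrable \<eta> (\<lambda>x. (cmod (indicator S x * \<phi> x))\<^sup>2)"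
  proof (rule Bochner_Integration.integrable_bound)
    show "integrable \<eta> (\<lambda>x. (cmod (\<phi> x))\<^sup>2)" using \<phi> by (simp add: l2_functions_def)
    show "AE x in \<eta>. norm ((cmod (indicator S x * \<phi> x))\<^sup>2) \<le> norm ((cmod (\<phi> x))\<^sup>2)"
      by (intro AE_I2) (simp add: indicator_def)
  qed measurable
  then show ?thesis by (simp add: l2_functions_def)
qed

lemma l2_class_eqI:
  assumes "AE x in \<eta>. \<phi> x = \<psi> x"
  shows "l2_class \<eta> \<phi> = l2_class \<eta> \<psi>"
  unfolding l2_class_def
proof (intro Collect_cong conj_cong refl)
  fix \<theta>
  show "(AE x in \<eta>. \<theta> x = \<phi> x) \<longleftrightarrow> (AE x in \<eta>. \<theta> x = \<psi> x)"
  proof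
    assume "AE x in \<eta>. \<theta> x = \<phi> x" with assms show "AE x in \<eta>. \<theta> x = \<psi> x" by eventually_elim simp
  next
    assume "AE x in \<eta>. \<theta> x = \<psi> x" with assms show "AE x in \<eta>. \<theta> x = \<phi> x" by eventually_elim simp
  qed
qed

lemma l2_rep_class:
  assumes "\<phi> \<in> l2_functions \<eta>"
  shows "l2_rep (l2_class \<eta> \<phi>) \<in> l2_functions \<eta>" and "AE x in \<eta>. l2_rep (l2_class \<eta> \<phi>) x = \<phi> x"
proof -
  have "\<phi> \<in> l2_class \<eta> \<phi>" using assms by (simp add: l2_class_def)
  then have "l2_rep (l2_class \<eta> \<phi>) \<in> l2_class \<eta> \<phi>" unfolding l2_rep_def by (rule someI[where P = "\<lambda>\<psi>. \<psi> \<in> l2_class \<eta> \<phi>"])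
  then show "l2_rep (l2_class \<eta> \<phi>) \<in> l2_functions \<eta>" "AE x in \<eta>. l2_rep (l2_class \<eta> \<phi>) x = \<phi> x"
    by (simp_all add: l2_class_def)
qed

lemma L2_class_closed: "\<phi> \<in> l2_functions \<eta> \<Longrightarrow> l2_class \<eta> \<phi> \<in> carrier (L2 \<eta>)"
  by (simp add: L2_def)

lemma L2_rep:
  assumes "u \<in> carrier (L2 \<eta>)"
  shows "l2_rep u \<in> l2_functions \<eta>" and "l2_class \<eta> (l2_rep u) = u"
proof -
  obtain \<phi> where \<phi>: "\<phi> \<in> l2_functions \<eta>" "u = l2_class \<eta> \<phi>" using assms by (auto simp: L2_def)
  show "l2_rep u \<in> l2_functions \<eta>" "l2_class \<eta> (l2_rep u) = u"
    using l2_rep_class[OF \<phi>(1)] l2_class_eqI[of "l2_rep u" \<phi> \<eta>] \<phi>(2) by simp_all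
qed

lemma L2_cinner_AE:
  assumes u: "u \<in> carrier (L2 \<eta>)" and w: "w \<in> carrier (L2 \<eta>)"
    and \<phi>: "\<phi> \<in> l2_functions \<eta>" "AE x in \<eta>. l2_rep u x = \<phi> x"
    and \<psi>: "\<psi> \<in> l2_functions \<eta>" "AE x in \<eta>. l2_rep w x = \<psi> x"
  shows "cinner (L2 \<eta>) u w = (\<integral>x. \<phi> x * cnj (\<psi> x) \<partial>\<eta>)"
proof -
  have "(\<integral>x. l2_rep u x * cnj (l2_rep w x) \<partial>\<eta>) = (\<integral>x. \<phi> x * cnj (\<psi> x) \<partial>\<eta>)"
  proof (rule integral_cong_AE)
    show "AE x in \<eta>. l2_rep u x * cnj (l2_rep w x) = \<phi> x * cnj (\<psi> x)"
      using \<phi>(2) \<psi>(2) by eventually_elim simp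
  qed (use l2_mult_integrable[OF L2_rep(1)[OF u] L2_rep(1)[OF w]] l2_mult_integrable[OF \<phi>(1) \<psi>(1)] in auto)
  then show ?thesis by (simp add: L2_def)
qed

lemma L2_cinner_class:
  assumes "\<phi> \<in> l2_functions \<eta>" "\<psi> \<in> l2_functions \<eta>"
  shows "cinner (L2 \<eta>) (l2_class \<eta> \<phi>) (l2_class \<eta> \<psi>) = (\<integral>x. \<phi> x * cnj (\<psi> x) \<partial>\<eta>)"
  by (rule L2_cinner_AE) (use assms in \<open>auto intro: L2_class_closed l2_rep_class(2)\<close>)

lemma L2_add: "u \<oplus>\<^bsub>L2 \<eta>\<^esub> w = l2_class \<eta> (\<lambda>x. l2_rep u x + l2_rep w x)"
  by (simp add: L2_def)

lemma L2_smult: "c \<odot>\<^bsub>L2 \<eta>\<^esub> u = l2_class \<eta> (\<lambda>x. c * l2_rep u x)"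
  by (simp add: L2_def)

lemma L2_cinner: "cinner (L2 \<eta>) u w = (\<integral>x. l2_rep u x * cnj (l2_rep w x) \<partial>\<eta>)"
  by (simp add: L2_def)

lemma L2_semi_inner_product: "semi_inner_product (L2 \<eta>)"
proof
  fix x y z :: "('a \<Rightarrow> complex) set" and c :: complex
  assume x: "x \<in> carrier (L2 \<eta>)"
  note rx = L2_rep(1)[OF x]
  show "c \<odot>\<^bsub>L2 \<eta>\<^esub> x \<in> carrier (L2 \<eta>)"
    unfolding L2_smult by (intro L2_class_closed l2_scale rx)
  show "0 \<le> Re (cinner (L2 \<eta>) x x)"
  proof -
    have "cinner (L2 \<eta>) x x = complex_of_real (\<integral>t. (cmod (l2_rep x t))\<^sup>2 \<partial>\<eta>)"
      unfolding L2_cinner by (simp only: complex_norm_square[symmetric] integral_complex_of_real)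
    then show ?thesis by simp
  qed
  assume y: "y \<in> carrier (L2 \<eta>)"
  note ry = L2_rep(1)[OF y]
  show "x \<oplus>\<^bsub>L2 \<eta>\<^esub> y \<in> carrier (L2 \<eta>)"
    unfolding L2_add by (intro L2_class_closed l2_add rx ry)
  show "cinner (L2 \<eta>) x y = cnj (cinner (L2 \<eta>) y x)"
    unfolding L2_cinner Bochner_Integration.integral_cnj[symmetric]
    by (rule Bochner_Integration.integral_cong) (simp_all add: mult.commute)
  show "cinner (L2 \<eta>) (c \<odot>\<^bsub>L2 \<eta>\<^esub> x) y = c * cinner (L2 \<eta>) x y"
  proof -
    have "cinner (L2 \<eta>) (c \<odot>\<^bsub>L2 \<eta>\<^esub> x) y = (\<integral>t. (c * l2_rep x t) * cnj (l2_rep y t) \<partial>\<eta>)"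
      unfolding L2_smult
      by (rule L2_cinner_AE[OF L2_class_closed[OF l2_scale[OF rx]] y l2_scale[OF rx] l2_rep_class(2)[OF l2_scale[OF rx]] ry]) simp
    then show ?thesis by (simp add: L2_cinner mult.assoc)
  qed
  assume z: "z \<in> carrier (L2 \<eta>)"
  note rz = L2_rep(1)[OF z]
  show "cinner (L2 \<eta>) (x \<oplus>\<^bsub>L2 \<eta>\<^esub> y) z = cinner (L2 \<eta>) x z + cinner (L2 \<eta>) y z"
  proof -
    have "cinner (L2 \<eta>) (x \<oplus>\<^bsub>L2 \<eta>\<^esub> y) z = (\<integral>t. (l2_rep x t + l2_rep y t) * cnj (l2_rep z t) \<partial>\<eta>)"
      unfolding L2_add
      by (rule L2_cinner_AE[OF L2_class_closed[OF l2_add[OF rx ry]] z l2_add[OF rx ry] l2_rep_class(2)[OF l2_add[OF rx ry]] rz]) simp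
    then show ?thesis
      using l2_mult_integrable[OF rx rz] l2_mult_integrable[OF ry rz] by (simp add: L2_cinner distrib_right)
  qed
qed

lemma L2_representation:
  assumes A: "c_star_algebra A" and \<pi>: "\<pi> \<in> star_hom A (operator_algebra (L2 \<eta>))"
  shows "hilbert_representation A (L2 \<eta>) \<pi>"
proof -
  interpret A: c_star_algebra A by fact
  interpret H: semi_inner_product "L2 \<eta>" by (rule L2_semi_inner_product)
  have bnd: "\<pi> x \<in> bounded_ops (L2 \<eta>)" if "x \<in> carrier A" for x
    using \<pi> that by (auto simp: star_hom_def operator_algebra_def)
  show ?thesis
  proof
    fix x \<xi> assume x: "x \<in> carrier A"
    show "\<exists>K. \<forall>\<xi> \<in> carrier (L2 \<eta>). hnorm (L2 \<eta>) (\<pi> x \<xi>) \<le> K * hnorm (L2 \<eta>) \<xi>"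
      using bnd[OF x] by (simp add: bounded_ops_def)
    assume \<xi>: "\<xi> \<in> carrier (L2 \<eta>)"
    show "\<pi> x \<xi> \<in> carrier (L2 \<eta>)" using bnd[OF x] \<xi> by (auto simp: bounded_ops_def)
    show "\<pi> (c \<odot>\<^bsub>A\<^esub> x) \<xi> = c \<odot>\<^bsub>L2 \<eta>\<^esub> \<pi> x \<xi>" for c
      using \<pi> x \<xi> by (simp add: star_hom_def operator_algebra_def)
    fix y assume y: "y \<in> carrier A"
    show "\<pi> (x \<oplus>\<^bsub>A\<^esub> y) \<xi> = \<pi> x \<xi> \<oplus>\<^bsub>L2 \<eta>\<^esub> \<pi> y \<xi>"
      using \<pi> x y \<xi> by (simp add: star_hom_def operator_algebra_def)
    show "\<pi> (x \<otimes>\<^bsub>A\<^esub> y) \<xi> = \<pi> x (\<pi> y \<xi>)"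
      using \<pi> x y \<xi> by (simp add: star_hom_def operator_algebra_def compose_def)
  qed
qed

section \<open>Change of variables\<close>

text \<open>
  The push-forward of \<open>M\<close> under \<open>f\<close> has density \<open>\<rho>\<close>.  The almost everywhere inverse \<open>g\<close> makes the push-forward
  \<open>\<sigma>\<close>-finite, so that its Radon-Nikodym derivative is finite almost everywhere and the conversion to a real function
  loses nothing.
\<close>

lemma RN_deriv_change_of_variables:
  fixes F :: "'x \<Rightarrow> 'b::{banach, second_countable_topology}"
  assumes M: "sigma_finite_measure M" and N: "sigma_finite_measure N"
    and f: "f \<in> M \<rightarrow>\<^sub>M N" and g: "g \<in> N \<rightarrow>\<^sub>M M" and gf: "AE x in M. g (f x) = x"
    and ac: "absolutely_continuous N (distr M N f)" and F: "F \<in> borel_measurable M"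
  defines "\<rho> \<equiv> \<lambda>y. enn2real (RN_deriv N (distr M N f) y)"
  shows "integrable N (\<lambda>y. \<rho> y *\<^sub>R F (g y)) \<longleftrightarrow> integrable M F"
    and "(\<integral>y. \<rho> y *\<^sub>R F (g y) \<partial>N) = (\<integral>x. F x \<partial>M)"
proof -
  interpret M: sigma_finite_measure M by fact
  interpret N: sigma_finite_measure N by fact
  note [measurable] = f g F
  let ?\<nu> = "distr M N f"
  have \<nu>: "sigma_finite_measure ?\<nu>"
  proof
    obtain C where C: "countable C" "C \<subseteq> sets M" "\<Union> C = space M" "\<forall>c\<in>C. emeasure M c \<noteq> \<infinity>"
      using M.sigma_finite_countable by blast
    let ?C = "(\<lambda>c. g -` c \<inter> space N) ` C"
    have sets: "?C \<subseteq> sets ?\<nu>" using C(2) measurable_sets[OF g] by auto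
    have "\<Union> ?C = space ?\<nu>" using measurable_space[OF g] unfolding C(3)[symmetric] by auto
    moreover have "emeasure ?\<nu> (g -` c \<inter> space N) \<noteq> \<infinity>" if c: "c \<in> C" for c
    proof -
      have "c \<in> sets M" using c C(2) by auto
      then have "emeasure ?\<nu> (g -` c \<inter> space N) = emeasure M (f -` (g -` c \<inter> space N) \<inter> space M)"
        by (intro emeasure_distr) measurable
      also have "\<dots> = emeasure M c"
      proof (rule emeasure_eq_AE)
        show "AE x in M. x \<in> f -` (g -` c \<inter> space N) \<inter> space M \<longleftrightarrow> x \<in> c"
          using gf AE_space by eventually_elim (use measurable_space[OF f] in auto)
      qed (use \<open>c \<in> sets M\<close> in measurable)
      finally show ?thesis using C(4) c by auto
    qed
    ultimately show "\<exists>A. countable A \<and> A \<subseteq> sets ?\<nu> \<and> \<Union> A = space ?\<nu> \<and> (\<forall>a\<in>A. emeasure ?\<nu> a \<noteq> \<infinity>)"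
      using C(1) sets by (intro exI[of _ ?C]) auto
  qed
  have [measurable]: "\<rho> \<in> borel_measurable N" unfolding \<rho>_def by measurable
  have "AE y in N. RN_deriv N ?\<nu> y \<noteq> \<infinity>" using \<nu> ac by (rule N.RN_deriv_finite) simp
  then have "AE y in N. ennreal (\<rho> y) = RN_deriv N ?\<nu> y"
    by eventually_elim (auto simp: \<rho>_def less_top)
  then have "density N \<rho> = density N (RN_deriv N ?\<nu>)" by (intro density_cong) auto
  also have "\<dots> = ?\<nu>" using ac by (intro N.density_RN_deriv) auto
  finally have dens: "density N \<rho> = ?\<nu>" .
  have Fg: "(\<lambda>y. F (g y)) \<in> borel_measurable N" by measurable
  have nn: "AE y in N. 0 \<le> \<rho> y" by (simp add: \<rho>_def)
  have cong: "AE x in M. F (g (f x)) = F x" using gf by eventually_elim simp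
  have "integrable N (\<lambda>y. \<rho> y *\<^sub>R F (g y)) \<longleftrightarrow> integrable ?\<nu> (\<lambda>y. F (g y))"
    using nn by (subst dens[symmetric], subst integrable_density) auto
  also have "\<dots> \<longleftrightarrow> integrable M (\<lambda>x. F (g (f x)))" by (rule integrable_distr_eq[OF f Fg])
  also have "\<dots> \<longleftrightarrow> integrable M F" by (rule integrable_cong_AE) (use cong in auto)
  finally show "integrable N (\<lambda>y. \<rho> y *\<^sub>R F (g y)) \<longleftrightarrow> integrable M F" .
  have "(\<integral>y. \<rho> y *\<^sub>R F (g y) \<partial>N) = (\<integral>y. F (g y) \<partial>?\<nu>)"
    using nn by (subst dens[symmetric], subst integral_density) auto
  also have "\<dots> = (\<integral>x. F (g (f x)) \<partial>M)" by (rule integral_distr[OF f Fg])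
  also have "\<dots> = (\<integral>x. F x \<partial>M)" by (rule integral_cong_AE) (use cong in auto)
  finally show "(\<integral>y. \<rho> y *\<^sub>R F (g y) \<partial>N) = (\<integral>x. F x \<partial>M)" .
qed

section \<open>Words of edges\<close>

context single_vertex_graph
begin

abbreviation word_path :: "'a list \<Rightarrow> 'a" where
  "word_path ws \<equiv> foldr conc ws v"

lemma edges_mor: "e \<in> edges \<Lambda> \<Longrightarrow> e \<in> mor \<Lambda>"
  by (auto simp: edges_def paths_def)

lemma word_path_mor [simp]: "set ws \<subseteq> edges \<Lambda> \<Longrightarrow> word_path ws \<in> mor \<Lambda>"
  by (induction ws) (auto simp: edges_mor)

lemma word_exists:
  assumes "\<mu> \<in> mor \<Lambda>"
  shows "\<exists>ws. set ws \<subseteq> edges \<Lambda> \<and> word_path ws = \<mu>"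
  using assms
proof (induction "fst (deg \<Lambda> \<mu>) + snd (deg \<Lambda> \<mu>)" arbitrary: \<mu> rule: less_induct)
  case less
  show ?case
  proof (cases "deg \<Lambda> \<mu> = 0")
    case True
    then have "\<mu> = v" using less.prems vertex by (auto simp: paths_def zero_prod_def)
    then show ?thesis by (intro exI[of _ "[]"]) simp
  next
    case False
    then obtain n m where nm: "deg \<Lambda> \<mu> = n + m" "n = (1, 0) \<or> n = (0, 1)"
    proof (cases "fst (deg \<Lambda> \<mu>) = 0")
      case True
      then show ?thesis using False
        by (intro that[of "(0, 1)" "(0, snd (deg \<Lambda> \<mu>) - 1)"]) (auto simp: prod_eq_iff)
    next
      case False
      then show ?thesis
        by (intro that[of "(1, 0)" "(fst (deg \<Lambda> \<mu>) - 1, snd (deg \<Lambda> \<mu>))"]) (auto simp: prod_eq_iff)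
    qed
    have "\<mu> \<in> paths \<Lambda> (n + m)" using nm(1) less.prems by (simp add: paths_def)
    then obtain e \<nu> where e: "e \<in> paths \<Lambda> n" and \<nu>: "\<nu> \<in> paths \<Lambda> m" and eq: "\<mu> = e \<cdot> \<nu>" by (rule factor_path)
    have "fst (deg \<Lambda> \<nu>) + snd (deg \<Lambda> \<nu>) < fst (deg \<Lambda> \<mu>) + snd (deg \<Lambda> \<mu>)"
      using nm mem_pathsD(2)[OF \<nu>] by auto
    then obtain ws where "set ws \<subseteq> edges \<Lambda>" "word_path ws = \<nu>" using less.hyps mem_pathsD(1)[OF \<nu>] by blast
    then show ?thesis using e nm(2) eq by (intro exI[of _ "e # ws"]) (auto simp: edges_def)
  qed
qed

lemma edge_word:
  assumes "\<mu> \<in> mor \<Lambda>"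
  shows "set (edge_word \<Lambda> v \<mu>) \<subseteq> edges \<Lambda>" "word_path (edge_word \<Lambda> v \<mu>) = \<mu>"
  using someI_ex[OF word_exists[OF assms]] by (simp_all add: edge_word_def)

lemma word_of_first_color:
  "\<lbrakk>set ws \<subseteq> edges \<Lambda>; word_path ws \<in> paths \<Lambda> (n, 0)\<rbrakk> \<Longrightarrow> set ws \<subseteq> paths \<Lambda> (1, 0) \<and> length ws = n"
proof (induction ws arbitrary: n)
  case Nil
  then show ?case by (auto simp: paths_def zero_prod_def)
next
  case (Cons e ws)
  have e: "e \<in> edges \<Lambda>" "e \<in> mor \<Lambda>" and ws: "set ws \<subseteq> edges \<Lambda>" using Cons.prems edges_mor by auto
  have d: "deg \<Lambda> e + deg \<Lambda> (word_path ws) = (n, 0)" using Cons.prems e ws by (simp add: paths_def)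
  have "deg \<Lambda> e = (1, 0) \<or> deg \<Lambda> e = (0, 1)" using e(1) by (auto simp: edges_def paths_def)
  then have de: "deg \<Lambda> e = (1, 0)" using d by (auto simp: prod_eq_iff)
  then have "deg \<Lambda> (word_path ws) = (n - 1, 0)" "n \<ge> 1" using d by (auto simp: prod_eq_iff)
  then have "set ws \<subseteq> paths \<Lambda> (1, 0) \<and> length ws = n - 1" using ws by (intro Cons.IH) (auto simp: paths_def)
  then show ?case using de e(2) \<open>n \<ge> 1\<close> by (auto simp: paths_def)
qed

end

section \<open>The representation of a branching system\<close>

locale branching_representation = ck_algebra \<Lambda> v A s
  for \<Lambda> :: "'a graded_category" and v :: 'a and A :: "'c cstar" (structure) and s :: "'a \<Rightarrow> 'c" +
  fixes \<eta> :: "'x measure" and \<B> :: "('a, 'x) branching"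
    and \<pi> :: "'c \<Rightarrow> ('x \<Rightarrow> complex) set \<Rightarrow> ('x \<Rightarrow> complex) set"
  assumes sigma_finite: "sigma_finite_measure \<eta>"
    and branching: "branching_system \<Lambda> \<eta> \<B>"
    and induced: "induced_representation \<Lambda> v \<eta> \<B> A s \<pi>"
begin

abbreviation "D \<equiv> bdom \<B>"
abbreviation "R \<equiv> bran \<B>"
abbreviation "H \<equiv> L2 \<eta>"

sublocale hilbert_representation A "L2 \<eta>" \<pi>
  using c_star_algebra_axioms induced by (intro L2_representation) (simp_all add: induced_representation_def)

lemma D_sets [measurable, simp]: "D \<in> sets \<eta>"
  using branching by (simp add: branching_system_def)

lemma R_sets [simp]: "e \<in> edges \<Lambda> \<Longrightarrow> R e \<in> sets \<eta>"
  using branching by (simp add: branching_system_def)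

lemma space_D [simp]: "space (restrict_space \<eta> D) = D"
  using sets.sets_into_space[OF D_sets] by (auto simp: space_restrict_space)

lemma space_R [simp]: "e \<in> edges \<Lambda> \<Longrightarrow> space (restrict_space \<eta> (R e)) = R e"
  using sets.sets_into_space[OF R_sets] by (auto simp: space_restrict_space)

lemma edge_maps:
  assumes "e \<in> edges \<Lambda>"
  shows "bmap \<B> e \<in> restrict_space \<eta> D \<rightarrow>\<^sub>M restrict_space \<eta> (R e)"
    and "binv \<B> e \<in> restrict_space \<eta> (R e) \<rightarrow>\<^sub>M restrict_space \<eta> D"
    and "AE y in restrict_space \<eta> (R e). bmap \<B> e (binv \<B> e y) = y"
    and "AE x in restrict_space \<eta> D. binv \<B> e (bmap \<B> e x) = x"
    and "absolutely_continuous (restrict_space \<eta> D) (distr (restrict_space \<eta> (R e)) (restrict_space \<eta> D) (binv \<B> e))"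
    and "absolutely_continuous (restrict_space \<eta> (R e)) (distr (restrict_space \<eta> D) (restrict_space \<eta> (R e)) (bmap \<B> e))"
  using branching assms unfolding branching_system_def by (simp_all add: Let_def)

lemma AE_R: "e \<in> edges \<Lambda> \<Longrightarrow> (AE y in restrict_space \<eta> (R e). P y) \<longleftrightarrow> (AE y in \<eta>. y \<in> R e \<longrightarrow> P y)"
  by (subst AE_restrict_space_iff) auto

lemma AE_D: "(AE y in restrict_space \<eta> D. P y) \<longleftrightarrow> (AE y in \<eta>. y \<in> D \<longrightarrow> P y)"
  by (subst AE_restrict_space_iff) auto

lemma binv_in_D: "\<lbrakk>e \<in> edges \<Lambda>; y \<in> R e\<rbrakk> \<Longrightarrow> binv \<B> e y \<in> D"
  using measurable_space[OF edge_maps(2)] by simp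

text \<open>
  Preimages of null sets under \<open>f\<^sub>e\<^sup>-\<^sup>1\<close> are null sets.
\<close>

lemma AE_binv:
  assumes e: "e \<in> edges \<Lambda>" and P: "AE x in \<eta>. P x"
  shows "AE y in \<eta>. y \<in> R e \<longrightarrow> P (binv \<B> e y)"
proof -
  have "AE x in restrict_space \<eta> D. P x" using P unfolding AE_D by eventually_elim simp
  then have "AE x in distr (restrict_space \<eta> (R e)) (restrict_space \<eta> D) (binv \<B> e). P x"
    by (rule absolutely_continuous_AE[OF _ edge_maps(5)[OF e], rotated]) simp
  then show ?thesis using AE_distrD[OF edge_maps(2)[OF e]] AE_R[OF e] by metis
qed

lemma preimage_binv_sets:
  assumes e: "e \<in> edges \<Lambda>" and S: "S \<in> sets \<eta>"
  shows "{y \<in> R e. binv \<B> e y \<in> S} \<in> sets \<eta>"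
proof -
  have "S \<inter> D \<in> sets (restrict_space \<eta> D)" using S by (auto simp: sets_restrict_space_iff)
  then have "binv \<B> e -` (S \<inter> D) \<inter> R e \<in> sets (restrict_space \<eta> (R e))"
    using measurable_sets[OF edge_maps(2)[OF e]] e by fastforce
  moreover have "binv \<B> e -` (S \<inter> D) \<inter> R e = {y \<in> R e. binv \<B> e y \<in> S}" using binv_in_D[OF e] by auto
  ultimately show ?thesis using e by (auto simp: sets_restrict_space_iff)
qed

lemma preimage_bmap_sets:
  assumes e: "e \<in> edges \<Lambda>" and S: "S \<in> sets \<eta>"
  shows "{x \<in> D. bmap \<B> e x \<in> S} \<in> sets \<eta>"
proof -
  have "S \<inter> R e \<in> sets (restrict_space \<eta> (R e))" using S e by (auto simp: sets_restrict_space_iff)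
  then have "bmap \<B> e -` (S \<inter> R e) \<inter> D \<in> sets (restrict_space \<eta> D)"
    using measurable_sets[OF edge_maps(1)[OF e]] e by fastforce
  moreover have "bmap \<B> e -` (S \<inter> R e) \<inter> D = {x \<in> D. bmap \<B> e x \<in> S}"
    using measurable_space[OF edge_maps(1)[OF e]] e by auto
  ultimately show ?thesis by (auto simp: sets_restrict_space_iff)
qed

text \<open>
  The operator \<open>\<pi> (s e)\<close> on the level of functions.
\<close>

definition edge_op :: "'a \<Rightarrow> ('x \<Rightarrow> complex) \<Rightarrow> 'x \<Rightarrow> complex" where
  "edge_op e \<phi> y = (if y \<in> R e
     then complex_of_real (sqrt (branching_density \<eta> \<B> e y)) * \<phi> (binv \<B> e y) else 0)"

lemma density_eq: "branching_density \<eta> \<B> e = (\<lambda>y. enn2real (RN_deriv (restrict_space \<eta> (R e))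
    (distr (restrict_space \<eta> D) (restrict_space \<eta> (R e)) (bmap \<B> e)) y))"
  by (rule ext) (simp add: branching_density_def Let_def)

lemma edge_change_of_variables:
  fixes F :: "'x \<Rightarrow> 'b::{banach, second_countable_topology}"
  assumes e: "e \<in> edges \<Lambda>" and F: "F \<in> borel_measurable \<eta>"
  shows "integrable \<eta> (\<lambda>y. indicator (R e) y *\<^sub>R branching_density \<eta> \<B> e y *\<^sub>R F (binv \<B> e y))
      \<longleftrightarrow> integrable \<eta> (\<lambda>x. indicator D x *\<^sub>R F x)"
    and "(\<integral>y. indicator (R e) y *\<^sub>R branching_density \<eta> \<B> e y *\<^sub>R F (binv \<B> e y) \<partial>\<eta>)
      = (\<integral>x. indicator D x *\<^sub>R F x \<partial>\<eta>)"
proof -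
  have F': "F \<in> borel_measurable (restrict_space \<eta> D)" using F by (rule measurable_restrict_space1)
  have sf: "sigma_finite_measure (restrict_space \<eta> D)" "sigma_finite_measure (restrict_space \<eta> (R e))"
    using sigma_finite e by (auto intro!: sigma_finite_measure_restrict_space)
  note cv = RN_deriv_change_of_variables[OF sf edge_maps(1)[OF e] edge_maps(2)[OF e] edge_maps(4)[OF e] edge_maps(6)[OF e] F']
  show "integrable \<eta> (\<lambda>y. indicator (R e) y *\<^sub>R branching_density \<eta> \<B> e y *\<^sub>R F (binv \<B> e y))
      \<longleftrightarrow> integrable \<eta> (\<lambda>x. indicator D x *\<^sub>R F x)"
    using cv(1) e by (simp add: density_eq integrable_restrict_space)
  show "(\<integral>y. indicator (R e) y *\<^sub>R branching_density \<eta> \<B> e y *\<^sub>R F (binv \<B> e y) \<partial>\<eta>)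
      = (\<integral>x. indicator D x *\<^sub>R F x \<partial>\<eta>)"
    using cv(2) e by (simp add: density_eq integral_restrict_space)
qed

lemma density_nonneg [simp]: "0 \<le> branching_density \<eta> \<B> e y"
  by (simp add: density_eq)

lemma edge_op_mult:
  "edge_op e \<phi> y * cnj (edge_op e \<psi> y)
    = indicator (R e) y *\<^sub>R branching_density \<eta> \<B> e y *\<^sub>R (\<phi> (binv \<B> e y) * cnj (\<psi> (binv \<B> e y)))"
proof -
  have "(complex_of_real r * a) * cnj (complex_of_real r * b) = complex_of_real (r * r) * (a * cnj b)" for r a b
    by simp
  from this[of "sqrt (branching_density \<eta> \<B> e y)"] show ?thesis
    unfolding edge_op_def scaleR_conv_of_real by simp
qed

lemma edge_op_l2:
  assumes e: "e \<in> edges \<Lambda>" and \<phi>: "\<phi> \<in> l2_functions \<eta>"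
  shows "edge_op e \<phi> \<in> l2_functions \<eta>"
proof -
  note [measurable] = l2_measurable[OF \<phi>]
  have \<phi>D: "\<phi> \<in> borel_measurable (restrict_space \<eta> D)" using l2_measurable[OF \<phi>] by (rule measurable_restrict_space1)
  have "(\<lambda>y. complex_of_real (sqrt (branching_density \<eta> \<B> e y)) * \<phi> (binv \<B> e y)) \<in> borel_measurable (restrict_space \<eta> (R e))"
  proof -
    have "(\<lambda>y. \<phi> (binv \<B> e y)) \<in> borel_measurable (restrict_space \<eta> (R e))"
      by (rule measurable_compose[OF edge_maps(2)[OF e] \<phi>D])
    then show ?thesis unfolding density_eq by measurable
  qed
  then have "(\<lambda>y. indicator (R e) y *\<^sub>R (complex_of_real (sqrt (branching_density \<eta> \<B> e y)) * \<phi> (binv \<B> e y)))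
      \<in> borel_measurable \<eta>"
    using e by (subst (asm) borel_measurable_restrict_space_iff) auto
  also have "(\<lambda>y. indicator (R e) y *\<^sub>R (complex_of_real (sqrt (branching_density \<eta> \<B> e y)) * \<phi> (binv \<B> e y))) = edge_op e \<phi>"
    by (auto simp: edge_op_def fun_eq_iff)
  finally have meas: "edge_op e \<phi> \<in> borel_measurable \<eta>" .
  have "integrable \<eta> (\<lambda>x. indicator D x *\<^sub>R (cmod (\<phi> x))\<^sup>2)"
  proof -
    have "(\<lambda>x. (cmod (indicator D x * \<phi> x))\<^sup>2) = (\<lambda>x. indicator D x *\<^sub>R (cmod (\<phi> x))\<^sup>2)"
      by (auto simp: indicator_def fun_eq_iff)
    then show ?thesis using l2_indicator_mult[OF D_sets \<phi>] by (simp add: l2_functions_def)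
  qed
  then have "integrable \<eta> (\<lambda>y. indicator (R e) y *\<^sub>R branching_density \<eta> \<B> e y *\<^sub>R (cmod (\<phi> (binv \<B> e y)))\<^sup>2)"
    by (subst edge_change_of_variables(1)[OF e, of "\<lambda>x. (cmod (\<phi> x))\<^sup>2"]) auto
  also have "(\<lambda>y. indicator (R e) y *\<^sub>R branching_density \<eta> \<B> e y *\<^sub>R (cmod (\<phi> (binv \<B> e y)))\<^sup>2) = (\<lambda>y. (cmod (edge_op e \<phi> y))\<^sup>2)"
    by (auto simp: edge_op_def fun_eq_iff norm_mult power_mult_distrib)
  finally show ?thesis using meas by (simp add: l2_functions_def)
qed

lemma rep_edge:
  assumes "e \<in> edges \<Lambda>" "\<phi> \<in> l2_functions \<eta>"
  shows "\<pi> (s e) (l2_class \<eta> \<phi>) = l2_class \<eta> (edge_op e \<phi>)"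
  using induced assms by (simp add: induced_representation_def edge_op_def[abs_def])

lemma rep_vertex:
  assumes "\<phi> \<in> l2_functions \<eta>"
  shows "\<pi> (s v) (l2_class \<eta> \<phi>) = l2_class \<eta> (\<lambda>x. indicator D x * \<phi> x)"
  using induced assms by (simp add: induced_representation_def)

text \<open>
  \<open>\<pi> (s e)\<close> is an isometry on the range of the projection \<open>\<pi> (s v)\<close>, by the change of variables \<open>f\<^sub>e\<close>.
\<close>

lemma cinner_edge_same:
  assumes e: "e \<in> edges \<Lambda>" and u: "u \<in> carrier H" and w: "w \<in> carrier H"
  shows "cinner H (\<pi> (s e) u) (\<pi> (s e) w) = cinner H (\<pi> (s v) u) w"
proof -
  define \<phi> \<psi> where "\<phi> = l2_rep u" and "\<psi> = l2_rep w"
  have \<phi>: "\<phi> \<in> l2_functions \<eta>" "u = l2_class \<eta> \<phi>" and \<psi>: "\<psi> \<in> l2_functions \<eta>" "w = l2_class \<eta> \<psi>"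
    using L2_rep[OF u] L2_rep[OF w] by (simp_all add: \<phi>_def \<psi>_def)
  have meas: "(\<lambda>x. \<phi> x * cnj (\<psi> x)) \<in> borel_measurable \<eta>" using l2_mult_integrable[OF \<phi>(1) \<psi>(1)] by simp
  have "cinner H (\<pi> (s e) u) (\<pi> (s e) w) = (\<integral>y. edge_op e \<phi> y * cnj (edge_op e \<psi> y) \<partial>\<eta>)"
    using e \<phi> \<psi> by (simp add: rep_edge L2_cinner_class edge_op_l2)
  also have "\<dots> = (\<integral>x. indicator D x *\<^sub>R (\<phi> x * cnj (\<psi> x)) \<partial>\<eta>)"
    unfolding edge_op_mult by (rule edge_change_of_variables(2)[OF e meas])
  also have "\<dots> = (\<integral>x. (indicator D x * \<phi> x) * cnj (\<psi> x) \<partial>\<eta>)"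
    by (rule Bochner_Integration.integral_cong) (auto simp: indicator_def)
  also have "\<dots> = cinner H (\<pi> (s v) u) w"
    using \<phi> \<psi> by (simp add: rep_vertex L2_cinner_class l2_indicator_mult)
  finally show ?thesis .
qed

section \<open>Essential supports\<close>

text \<open>
  The set \<open>S0\<close> spares the verification that \<open>S\<close> is measurable, and makes the notion monotone in \<open>S\<close>.
\<close>

definition supp :: "'x set \<Rightarrow> ('x \<Rightarrow> complex) set \<Rightarrow> bool" where
  "supp S u \<longleftrightarrow> (\<exists>S0 \<in> sets \<eta>. S0 \<subseteq> S \<and> (AE x in \<eta>. x \<notin> S0 \<longrightarrow> l2_rep u x = 0))"

lemma supp_mono: "\<lbrakk>supp S u; S \<subseteq> T\<rbrakk> \<Longrightarrow> supp T u"
  unfolding supp_def by blast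

lemma supp_class:
  assumes "\<phi> \<in> l2_functions \<eta>" "S \<in> sets \<eta>" "AE x in \<eta>. x \<notin> S \<longrightarrow> \<phi> x = 0"
  shows "supp S (l2_class \<eta> \<phi>)"
  unfolding supp_def
proof (intro bexI[of _ S] conjI)
  show "AE x in \<eta>. x \<notin> S \<longrightarrow> l2_rep (l2_class \<eta> \<phi>) x = 0"
    using assms(3) l2_rep_class(2)[OF assms(1)] by eventually_elim simp
qed (use assms in auto)

lemma supp_disjoint:
  assumes u: "u \<in> carrier H" "supp S u" and w: "w \<in> carrier H" "supp T w"
    and disj: "AE x in \<eta>. \<not> (x \<in> S \<and> x \<in> T)"
  shows "cinner H u w = 0"
proof -
  obtain S0 where S0: "S0 \<subseteq> S" "AE x in \<eta>. x \<notin> S0 \<longrightarrow> l2_rep u x = 0" using u(2) by (auto simp: supp_def)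
  obtain T0 where T0: "T0 \<subseteq> T" "AE x in \<eta>. x \<notin> T0 \<longrightarrow> l2_rep w x = 0" using w(2) by (auto simp: supp_def)
  have "AE x in \<eta>. l2_rep u x * cnj (l2_rep w x) = 0"
    using S0(2) T0(2) disj by eventually_elim (use S0(1) T0(1) in auto)
  then have "(\<integral>x. l2_rep u x * cnj (l2_rep w x) \<partial>\<eta>) = 0" by (rule integral_eq_zero_AE)
  then show ?thesis by (simp add: L2_cinner)
qed

lemma supp_vertex:
  assumes u: "u \<in> carrier H" and S: "supp S u"
  shows "supp (S \<inter> D) (\<pi> (s v) u)"
proof -
  obtain S0 where S0: "S0 \<in> sets \<eta>" "S0 \<subseteq> S" "AE x in \<eta>. x \<notin> S0 \<longrightarrow> l2_rep u x = 0" using S by (auto simp: supp_def)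
  have "supp (S0 \<inter> D) (l2_class \<eta> (\<lambda>x. indicator D x * l2_rep u x))"
    using S0(1) by (intro supp_class l2_indicator_mult L2_rep[OF u]) (use S0(3) in \<open>auto elim!: eventually_mono\<close>)
  then have "supp (S0 \<inter> D) (\<pi> (s v) u)" using rep_vertex[OF L2_rep(1)[OF u]] L2_rep(2)[OF u] by simp
  then show ?thesis using S0(2) by (elim supp_mono) auto
qed

lemma supp_space: "u \<in> carrier H \<Longrightarrow> supp (space \<eta>) u"
  unfolding supp_def by (intro bexI[of _ "space \<eta>"]) (auto intro: AE_I2)

lemma supp_edge:
  assumes e: "e \<in> edges \<Lambda>" and u: "u \<in> carrier H" and S: "supp S u"
  shows "supp {y \<in> R e. binv \<B> e y \<in> S} (\<pi> (s e) u)"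
proof -
  obtain S0 where S0: "S0 \<in> sets \<eta>" "S0 \<subseteq> S" "AE x in \<eta>. x \<notin> S0 \<longrightarrow> l2_rep u x = 0" using S by (auto simp: supp_def)
  have "supp {y \<in> R e. binv \<B> e y \<in> S0} (l2_class \<eta> (edge_op e (l2_rep u)))"
  proof (intro supp_class edge_op_l2 L2_rep[OF u] e preimage_binv_sets S0)
    show "AE y in \<eta>. y \<notin> {y \<in> R e. binv \<B> e y \<in> S0} \<longrightarrow> edge_op e (l2_rep u) y = 0"
      using AE_binv[OF e S0(3)] by eventually_elim (auto simp: edge_op_def)
  qed
  then have "supp {y \<in> R e. binv \<B> e y \<in> S0} (\<pi> (s e) u)" using rep_edge[OF e L2_rep(1)[OF u]] L2_rep(2)[OF u] by simp
  then show ?thesis using S0(2) by (elim supp_mono) auto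
qed

lemma cinner_edge_distinct:
  assumes n: "n \<in> {(1, 0), (0, 1)}" and e: "e \<in> paths \<Lambda> n" and e': "e' \<in> paths \<Lambda> n" and ne: "e \<noteq> e'"
    and u: "u \<in> carrier H" and w: "w \<in> carrier H"
  shows "cinner H (\<pi> (s e) u) (\<pi> (s e') w) = 0"
proof (rule supp_disjoint)
  have ed: "e \<in> edges \<Lambda>" "e' \<in> edges \<Lambda>" using n e e' by (auto simp: edges_def)
  then show "\<pi> (s e) u \<in> carrier H" "\<pi> (s e') w \<in> carrier H" using u w by (auto simp: edges_mor)
  show "supp (R e) (\<pi> (s e) u)" "supp (R e') (\<pi> (s e') w)"
    using supp_edge[OF ed(1) u supp_space[OF u]] supp_edge[OF ed(2) w supp_space[OF w]] by (auto elim: supp_mono)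
  have "emeasure \<eta> (R e \<inter> R e') = 0" using branching n e e' ne unfolding branching_system_def by blast
  then have "R e \<inter> R e' \<in> null_sets \<eta>" using ed by (intro null_setsI sets.Int R_sets)
  then show "AE x in \<eta>. \<not> (x \<in> R e \<and> x \<in> R e')" using AE_not_in by fastforce
qed

lemma adjoints_vertex: "adjoints (s v) (s v)"
  unfolding adjoints_def
proof (intro ballI)
  fix u w assume u: "u \<in> carrier H" and w: "w \<in> carrier H"
  define \<phi> \<psi> where "\<phi> = l2_rep u" and "\<psi> = l2_rep w"
  have \<phi>: "\<phi> \<in> l2_functions \<eta>" "u = l2_class \<eta> \<phi>" and \<psi>: "\<psi> \<in> l2_functions \<eta>" "w = l2_class \<eta> \<psi>"
    using L2_rep[OF u] L2_rep[OF w] by (simp_all add: \<phi>_def \<psi>_def)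
  have "(\<integral>x. (indicator D x * \<phi> x) * cnj (\<psi> x) \<partial>\<eta>) = (\<integral>x. \<phi> x * cnj (indicator D x * \<psi> x) \<partial>\<eta>)"
    by (rule Bochner_Integration.integral_cong) (auto simp: indicator_def)
  then show "cinner H (\<pi> (s v) u) w = cinner H u (\<pi> (s v) w)"
    using \<phi> \<psi> by (simp add: rep_vertex L2_cinner_class l2_indicator_mult)
qed

text \<open>
  In the expansion of \<open>\<langle>u, \<pi> (s e) w\<rangle>\<close> along \<open>s v = \<Sum> s e' (s e')\<^sup>*\<close>, only the term with \<open>e' = e\<close> survives, because
  operators of distinct edges of one colour have orthogonal ranges.  As \<open>\<pi> (s e)\<close> is isometric, this term is
  \<open>\<langle>\<pi> ((s e)\<^sup>*) u, w\<rangle>\<close>.  The argument takes the place of a formula for \<open>\<pi> ((s e)\<^sup>*)\<close>, and of the existence of adjoints of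
  arbitrary bounded operators.
\<close>

lemma adjoints_edge:
  assumes e: "e \<in> edges \<Lambda>"
  shows "adjoints (s e) (star A (s e))"
proof (rule adjoints_sym)
  have em [simp]: "e \<in> mor \<Lambda>" using e by (rule edges_mor)
  show "star A (s e) \<in> carrier A" "s e \<in> carrier A" by auto
  obtain n where n: "n \<in> {(1, 0), (0, 1)}" "e \<in> paths \<Lambda> n" using e by (auto simp: edges_def)
  have pm: "e' \<in> mor \<Lambda>" if "e' \<in> paths \<Lambda> n" for e' using that by (rule mem_pathsD)
  show "adjoints (star A (s e)) (s e)"
    unfolding adjoints_def
  proof (intro ballI)
    fix u w assume u: "u \<in> carrier H" and w: "w \<in> carrier H"
    have "cinner H u (\<pi> (s e) w) = cinner H u (\<pi> (s v) (\<pi> (s e) w))" using w by (simp add: rep_mult[symmetric])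
    also have "\<dots> = cinner H (\<pi> (s v) u) (\<pi> (s e) w)"
      using u w by (intro adjointsD[OF adjoints_vertex, symmetric]) auto
    also have "\<dots> = (\<Sum>e'\<in>paths \<Lambda> n. cinner H (\<pi> (s e' \<otimes> star A (s e')) u) (\<pi> (s e) w))"
      unfolding unit_sum[of n, symmetric] using u w pm by (intro cinner_rep_finsum) auto
    also have "\<dots> = (\<Sum>e'\<in>paths \<Lambda> n. if e' = e then cinner H (\<pi> (s e) (\<pi> (star A (s e)) u)) (\<pi> (s e) w) else 0)"
    proof (rule sum.cong[OF refl])
      fix e' assume e': "e' \<in> paths \<Lambda> n"
      show "cinner H (\<pi> (s e' \<otimes> star A (s e')) u) (\<pi> (s e) w)
          = (if e' = e then cinner H (\<pi> (s e) (\<pi> (star A (s e)) u)) (\<pi> (s e) w) else 0)"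
        using cinner_edge_distinct[OF n(1) e' n(2)] u w pm[OF e'] by (auto simp: rep_mult)
    qed
    also have "\<dots> = cinner H (\<pi> (s e) (\<pi> (star A (s e)) u)) (\<pi> (s e) w)" using n(2) by simp
    also have "\<dots> = cinner H (\<pi> (s v) (\<pi> (star A (s e)) u)) w" using u w by (intro cinner_edge_same[OF e]) auto
    also have "\<dots> = cinner H (\<pi> (star A (s e)) u) w" using u by (simp add: rep_mult[symmetric])
    finally show "cinner H (\<pi> (star A (s e)) u) w = cinner H u (\<pi> (s e) w)" by simp
  qed
qed

lemma adjoints_word:
  "set ws \<subseteq> edges \<Lambda> \<Longrightarrow> adjoints (s (word_path ws)) (star A (s (word_path ws)))"
proof (induction ws)
  case Nil
  then show ?case using adjoints_vertex by simp
next
  case (Cons e ws)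
  then have "e \<in> mor \<Lambda>" "word_path ws \<in> mor \<Lambda>" by (auto simp: edges_mor)
  moreover have "adjoints (s e) (star A (s e))" using Cons.prems by (intro adjoints_edge) auto
  ultimately show ?case using Cons by (simp add: s_conc star_mult adjoints_mult)
qed

sublocale ck_star_representation \<Lambda> v A s "L2 \<eta>" \<pi>
proof
  fix \<mu> assume "\<mu> \<in> mor \<Lambda>"
  then show "adjoints (s \<mu>) (star A (s \<mu>))" using adjoints_word[OF edge_word(1)] edge_word(2) by metis
qed

text \<open>
  By duality: the part of \<open>(s e)\<^sup>* u\<close> outside \<open>T = f\<^sub>e\<^sup>-\<^sup>1(S)\<close> is orthogonal to \<open>(s e)\<^sup>* u\<close>, because \<open>\<pi> (s e)\<close> maps functions
  supported outside \<open>T\<close> to functions that vanish almost everywhere on \<open>S\<close>.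
\<close>

lemma supp_star_edge:
  assumes e: "e \<in> edges \<Lambda>" and u: "u \<in> carrier H" and S: "supp S u"
  shows "supp {x \<in> D. bmap \<B> e x \<in> S} (\<pi> (star A (s e)) u)"
proof -
  have em [simp]: "e \<in> mor \<Lambda>" using e by (rule edges_mor)
  obtain S0 where S0: "S0 \<in> sets \<eta>" "S0 \<subseteq> S" "AE x in \<eta>. x \<notin> S0 \<longrightarrow> l2_rep u x = 0" using S by (auto simp: supp_def)
  define T where "T = {x \<in> D. bmap \<B> e x \<in> S0}"
  define G where "G = space \<eta> - T"
  have T: "T \<in> sets \<eta>" unfolding T_def by (rule preimage_bmap_sets[OF e S0(1)])
  then have G: "G \<in> sets \<eta>" by (auto simp: G_def)
  define w where "w = \<pi> (star A (s e)) u"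
  have w: "w \<in> carrier H" using u by (simp add: w_def)
  define \<phi> where "\<phi> = l2_rep w"
  have \<phi>: "\<phi> \<in> l2_functions \<eta>" "w = l2_class \<eta> \<phi>" using L2_rep[OF w] by (simp_all add: \<phi>_def)
  define \<psi> where "\<psi> = (\<lambda>x. indicator G x * \<phi> x)"
  have \<psi>: "\<psi> \<in> l2_functions \<eta>" unfolding \<psi>_def by (rule l2_indicator_mult[OF G \<phi>(1)])
  have z: "l2_class \<eta> \<psi> \<in> carrier H" using \<psi> by (rule L2_class_closed)
  have suppG: "supp G (l2_class \<eta> \<psi>)" using \<psi> G by (rule supp_class) (simp add: \<psi>_def)
  have "cinner H (\<pi> (s e) (l2_class \<eta> \<psi>)) u = 0"
  proof (rule supp_disjoint)
    show "supp {y \<in> R e. binv \<B> e y \<in> G} (\<pi> (s e) (l2_class \<eta> \<psi>))" by (rule supp_edge[OF e z suppG])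
    show "supp S0 u" using S0 by (auto simp: supp_def)
    have "AE y in \<eta>. y \<in> R e \<longrightarrow> bmap \<B> e (binv \<B> e y) = y" using edge_maps(3)[OF e] by (simp only: AE_R[OF e])
    then show "AE y in \<eta>. \<not> (y \<in> {y \<in> R e. binv \<B> e y \<in> G} \<and> y \<in> S0)"
      by eventually_elim (use binv_in_D[OF e] in \<open>auto simp: G_def T_def\<close>)
  qed (use u z in auto)
  then have "cinner H (l2_class \<eta> \<psi>) (l2_class \<eta> \<phi>) = 0"
    using cinner_rep_s_move[of e "l2_class \<eta> \<psi>" u] u z \<phi>(2) by (simp add: w_def)
  then have "(\<integral>x. \<psi> x * cnj (\<phi> x) \<partial>\<eta>) = 0" using \<psi> \<phi>(1) by (simp add: L2_cinner_class)
  moreover have "\<psi> x * cnj (\<phi> x) = complex_of_real ((cmod (\<psi> x))\<^sup>2)" for x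
    by (auto simp: \<psi>_def indicator_def complex_norm_square[symmetric] simp del: of_real_power)
  ultimately have "(\<integral>x. (cmod (\<psi> x))\<^sup>2 \<partial>\<eta>) = 0" by (simp only: integral_complex_of_real of_real_eq_0_iff)
  then have "AE x in \<eta>. (cmod (\<psi> x))\<^sup>2 = 0"
    using \<psi> by (subst (asm) integral_nonneg_eq_0_iff_AE) (auto simp: l2_functions_def)
  moreover have "AE x in \<eta>. x \<in> space \<eta>" by (rule AE_space)
  ultimately have "AE x in \<eta>. x \<notin> T \<longrightarrow> \<phi> x = 0" by eventually_elim (auto simp: \<psi>_def G_def)
  then have "supp T w" unfolding supp_def \<phi>_def using T by blast
  then show ?thesis unfolding w_def by (rule supp_mono) (use S0(2) in \<open>auto simp: T_def\<close>)
qed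

abbreviation word_preimage :: "'a list \<Rightarrow> 'x set \<Rightarrow> 'x set" where
  "word_preimage ws S \<equiv> foldr (\<lambda>e S. {y \<in> R e. binv \<B> e y \<in> S}) ws S"

abbreviation word_map :: "'a list \<Rightarrow> 'x \<Rightarrow> 'x" where
  "word_map ws \<equiv> foldr (\<lambda>e F. bmap \<B> e \<circ> F) ws id"

abbreviation word_inv :: "'a list \<Rightarrow> 'x \<Rightarrow> 'x" where
  "word_inv ws \<equiv> foldr (\<lambda>e F. F \<circ> binv \<B> e) ws id"

lemma supp_word:
  assumes "set ws \<subseteq> edges \<Lambda>" "u \<in> carrier H" "supp S u"
  shows "supp (word_preimage ws (S \<inter> D)) (\<pi> (s (word_path ws)) u)"
  using assms(1)
proof (induction ws)
  case Nil
  then show ?case using supp_vertex assms(2,3) by simp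
next
  case (Cons e ws)
  then have e: "e \<in> edges \<Lambda>" and ws: "set ws \<subseteq> edges \<Lambda>" by auto
  have "supp {y \<in> R e. binv \<B> e y \<in> word_preimage ws (S \<inter> D)} (\<pi> (s e) (\<pi> (s (word_path ws)) u))"
    using ws assms(2) Cons.IH by (intro supp_edge e) auto
  then show ?case using edges_mor[OF e] ws assms(2) by (simp add: s_conc rep_mult)
qed

lemma supp_star_word:
  assumes "set ws \<subseteq> edges \<Lambda>" "u \<in> carrier H" "supp S u"
  shows "supp {x \<in> D. word_map ws x \<in> S} (\<pi> (star A (s (word_path ws))) u)"
  using assms
proof (induction ws arbitrary: u S)
  case Nil
  then have "supp (S \<inter> D) (\<pi> (s v) u)" by (intro supp_vertex)
  then show ?case by (simp add: Int_def conj_commute)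
next
  case (Cons e ws)
  then have e: "e \<in> edges \<Lambda>" and ws: "set ws \<subseteq> edges \<Lambda>" by auto
  have "supp {x \<in> D. word_map ws x \<in> {x \<in> D. bmap \<B> e x \<in> S}} (\<pi> (star A (s (word_path ws))) (\<pi> (star A (s e)) u))"
    using ws Cons.prems e edges_mor[OF e] by (intro Cons.IH supp_star_edge) auto
  then have "supp {x \<in> D. word_map ws x \<in> {x \<in> D. bmap \<B> e x \<in> S}} (\<pi> (star A (s (word_path (e # ws)))) u)"
    using edges_mor[OF e] ws Cons.prems(2) by (simp add: s_conc star_mult rep_mult)
  moreover have "{x \<in> D. word_map ws x \<in> {x \<in> D. bmap \<B> e x \<in> S}} \<subseteq> {x \<in> D. word_map (e # ws) x \<in> S}"
    by (auto simp only: foldr_Cons comp_apply mem_Collect_eq)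
  ultimately show ?case by (rule supp_mono)
qed

lemma word_preimage_eq:
  "S \<subseteq> D \<Longrightarrow> word_preimage ws S = {y \<in> word_preimage ws D. word_inv ws y \<in> S}"
  by (induction ws) auto

text \<open>
  Different words of one length first differ in some letter.  There the ranges of the edges are disjoint,
  and the preceding letters pull null sets back to null sets.
\<close>

lemma word_preimage_disjoint:
  assumes "length ws = length ws'" "set ws \<subseteq> paths \<Lambda> (1, 0)" "set ws' \<subseteq> paths \<Lambda> (1, 0)" "ws \<noteq> ws'"
  shows "AE y in \<eta>. \<not> (y \<in> word_preimage ws D \<and> y \<in> word_preimage ws' D)"
  using assms
proof (induction ws ws' rule: list_induct2)
  case (Cons e ws e' ws')
  then have e: "e \<in> paths \<Lambda> (1, 0)" "e' \<in> paths \<Lambda> (1, 0)" by auto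
  then have ed: "e \<in> edges \<Lambda>" "e' \<in> edges \<Lambda>" by (auto simp: edges_def)
  show ?case
  proof (cases "e = e'")
    case True
    then have "AE y in \<eta>. \<not> (y \<in> word_preimage ws D \<and> y \<in> word_preimage ws' D)" using Cons by auto
    from AE_binv[OF ed(1) this] show ?thesis by eventually_elim (simp add: True)
  next
    case False
    have "emeasure \<eta> (R e \<inter> R e') = 0" using branching e False unfolding branching_system_def by blast
    then have "R e \<inter> R e' \<in> null_sets \<eta>" using ed by (intro null_setsI sets.Int R_sets)
    then have "AE y in \<eta>. y \<notin> R e \<inter> R e'" by (rule AE_not_in)
    then show ?thesis by eventually_elim auto
  qed
qed simp

lemma path_range_eq: "path_range \<Lambda> v \<B> \<mu> = word_preimage (edge_word \<Lambda> v \<mu>) D"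
  by (simp add: path_range_def)

lemma path_range_disjoint:
  assumes "\<mu> \<in> paths \<Lambda> (n, 0)" "\<nu> \<in> paths \<Lambda> (n, 0)" "\<mu> \<noteq> \<nu>"
  shows "AE y in \<eta>. \<not> (y \<in> path_range \<Lambda> v \<B> \<mu> \<and> y \<in> path_range \<Lambda> v \<B> \<nu>)"
  unfolding path_range_eq
proof (rule word_preimage_disjoint)
  note w = edge_word[OF mem_pathsD(1)[OF assms(1)]] and w' = edge_word[OF mem_pathsD(1)[OF assms(2)]]
  show "length (edge_word \<Lambda> v \<mu>) = length (edge_word \<Lambda> v \<nu>)"
    "set (edge_word \<Lambda> v \<mu>) \<subseteq> paths \<Lambda> (1, 0)" "set (edge_word \<Lambda> v \<nu>) \<subseteq> paths \<Lambda> (1, 0)"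
    using word_of_first_color[OF w(1), of n] word_of_first_color[OF w'(1), of n] w(2) w'(2) assms(1,2) by auto
  show "edge_word \<Lambda> v \<mu> \<noteq> edge_word \<Lambda> v \<nu>" using w(2) w'(2) assms(3) by metis
qed

lemma supp_path_range:
  assumes \<mu>: "\<mu> \<in> mor \<Lambda>" and u: "u \<in> carrier H"
  shows "supp (path_range \<Lambda> v \<B> \<mu>) (\<pi> (s \<mu>) u)"
proof -
  have "supp (word_preimage (edge_word \<Lambda> v \<mu>) (space \<eta> \<inter> D)) (\<pi> (s \<mu>) u)"
    using supp_word[OF edge_word(1)[OF \<mu>] u supp_space[OF u]] by (simp add: edge_word(2)[OF \<mu>])
  moreover have "space \<eta> \<inter> D = D" using sets.sets_into_space[OF D_sets] by auto
  ultimately show ?thesis by (simp add: path_range_eq)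
qed

text \<open>
  The operator \<open>s \<mu> (s \<nu>)\<^sup>*\<close> moves supports by \<open>f\<^sub>\<mu> \<circ> f\<^sub>\<nu>\<^sup>-\<^sup>1\<close>; the image of \<open>S\<close> is written as a
  preimage under the inverse map.
\<close>

lemma supp_transfer:
  assumes \<mu>: "\<mu> \<in> mor \<Lambda>" and \<nu>: "\<nu> \<in> mor \<Lambda>" and u: "u \<in> carrier H" and S: "supp S u"
  shows "supp {y \<in> path_range \<Lambda> v \<B> \<mu>. path_map \<Lambda> v \<B> \<nu> (path_inv \<Lambda> v \<B> \<mu> y) \<in> S} (\<pi> (s \<mu> \<otimes> star A (s \<nu>)) u)"
proof -
  let ?S = "{x \<in> D. path_map \<Lambda> v \<B> \<nu> x \<in> S}"
  have "supp ?S (\<pi> (star A (s \<nu>)) u)"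
    using supp_star_word[OF edge_word(1)[OF \<nu>] u S] by (simp add: edge_word(2)[OF \<nu>] path_map_def)
  then have "supp (word_preimage (edge_word \<Lambda> v \<mu>) (?S \<inter> D)) (\<pi> (s \<mu>) (\<pi> (star A (s \<nu>)) u))"
    using supp_word[OF edge_word(1)[OF \<mu>], of "\<pi> (star A (s \<nu>)) u" ?S] \<nu> u by (simp add: edge_word(2)[OF \<mu>])
  moreover have "word_preimage (edge_word \<Lambda> v \<mu>) (?S \<inter> D) = {y \<in> path_range \<Lambda> v \<B> \<mu>. path_inv \<Lambda> v \<B> \<mu> y \<in> ?S \<inter> D}"
    unfolding path_range_eq path_inv_def by (rule word_preimage_eq) auto
  ultimately have "supp {y \<in> path_range \<Lambda> v \<B> \<mu>. path_inv \<Lambda> v \<B> \<mu> y \<in> ?S \<inter> D} (\<pi> (s \<mu> \<otimes> star A (s \<nu>)) u)"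
    using \<mu> \<nu> u by (simp add: rep_mult)
  then show ?thesis by (elim supp_mono) auto
qed

lemma finite_positive_subset:
  assumes E: "E \<in> sets \<eta>" "emeasure \<eta> E \<noteq> 0"
  obtains E' where "E' \<in> sets \<eta>" "E' \<subseteq> E" "emeasure \<eta> E' \<noteq> 0" "emeasure \<eta> E' < \<infinity>"
proof (cases "emeasure \<eta> E = \<infinity>")
  case True
  interpret sigma_finite_measure \<eta> by (rule sigma_finite)
  obtain Z where "Z \<in> sets \<eta>" "Z \<subseteq> E" "emeasure \<eta> Z < \<infinity>" "emeasure \<eta> Z > ennreal 0"
    using approx_PInf_emeasure_with_finite[OF E(1) True, of 0] by blast
  then show ?thesis by (intro that[of Z]) auto
next
  case False
  then show ?thesis using E by (intro that[of E]) (auto simp: less_top)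
qed

lemma indicator_class:
  assumes E: "E \<in> sets \<eta>" "emeasure \<eta> E < \<infinity>"
  shows "indicator E \<in> l2_functions \<eta>"
    and "nsq (l2_class \<eta> (indicator E)) = measure \<eta> E"
    and "supp E (l2_class \<eta> (indicator E))"
proof -
  have int: "integrable \<eta> (indicator E :: _ \<Rightarrow> real)" using E by (intro integrable_real_indicator) auto
  have sq: "(\<lambda>x. (cmod (indicator E x))\<^sup>2) = (indicator E :: _ \<Rightarrow> real)" by (auto simp: indicator_def fun_eq_iff)
  have "(indicator E :: _ \<Rightarrow> complex) \<in> borel_measurable \<eta>" using E by measurable
  then show l2: "indicator E \<in> l2_functions \<eta>" using int by (simp add: l2_functions_def sq)
  have "cinner H (l2_class \<eta> (indicator E)) (l2_class \<eta> (indicator E)) = (\<integral>x. complex_of_real (indicator E x) \<partial>\<eta>)"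
    unfolding L2_cinner_class[OF l2 l2] by (rule Bochner_Integration.integral_cong) (auto simp: indicator_def)
  also have "\<dots> = complex_of_real (measure \<eta> E)"
    using E sets.sets_into_space[OF E(1)] by (simp add: Int_absorb1 Int_absorb2)
  finally show "nsq (l2_class \<eta> (indicator E)) = measure \<eta> E" by (simp add: nsq_def)
  show "supp E (l2_class \<eta> (indicator E))" using l2 E by (intro supp_class) auto
qed

lemma path_range_subset_D:
  assumes n: "0 < n" and \<mu>: "\<mu> \<in> paths \<Lambda> (n, 0)"
  shows "AE x in \<eta>. x \<in> path_range \<Lambda> v \<B> \<mu> \<longrightarrow> x \<in> D"
proof -
  note w = edge_word[OF mem_pathsD(1)[OF \<mu>]]
  have w1: "set (edge_word \<Lambda> v \<mu>) \<subseteq> paths \<Lambda> (1, 0)" "length (edge_word \<Lambda> v \<mu>) = n"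
    using word_of_first_color[OF w(1), of n] w(2) \<mu> by auto
  then obtain e ws where ew: "edge_word \<Lambda> v \<mu> = e # ws" using n by (cases "edge_word \<Lambda> v \<mu>") auto
  have e: "e \<in> paths \<Lambda> (1, 0)" using w1(1) ew by simp
  have "AE x in \<eta>. x \<in> (\<Union>\<mu> \<in> paths \<Lambda> (1, 0). R \<mu>) \<longleftrightarrow> x \<in> D"
    using branching unfolding branching_system_def by blast
  then show ?thesis unfolding path_range_eq ew by eventually_elim (use e in auto)
qed

end

section \<open>Wandering vectors from the branching system\<close>

context periodic_ck_algebra
begin

lemma star_s_W:
  assumes \<mu>: "\<mu> \<in> paths \<Lambda> (a, 0)"
  shows "star A (s \<mu>) \<otimes> W = star A (s (h \<mu>))" and "W \<otimes> star A (s \<mu>) = star A (s (h \<mu>))"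
proof -
  have [simp]: "\<mu> \<in> mor \<Lambda>" using first_color_mor[OF \<mu>] by simp
  have "star A (s \<mu>) \<otimes> W = star A (star A W \<otimes> s \<mu>)" by (simp add: star_mult star_star)
  then show "star A (s \<mu>) \<otimes> W = star A (s (h \<mu>))" by (simp add: star_W_s[OF \<mu>])
  have "W \<otimes> star A (s \<mu>) = star A (s \<mu> \<otimes> star A W)" by (simp add: star_mult star_star)
  then show "W \<otimes> star A (s \<mu>) = star A (s (h \<mu>))" by (simp add: s_star_W[OF \<mu>])
qed

text \<open>
  The projection \<open>s \<mu> (s \<mu>)\<^sup>*\<close> commutes with \<open>W\<close> and cuts \<open>W\<close> down to \<open>s \<mu> (s (h \<mu>))\<^sup>*\<close>.
\<close>

lemma cut_Wpow_Suc:
  assumes \<mu>: "\<mu> \<in> paths \<Lambda> (a, 0)"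
  shows "s \<mu> \<otimes> (star A (s \<mu>) \<otimes> Wpow (Suc k)) = s \<mu> \<otimes> star A (s (h \<mu>)) \<otimes> (s \<mu> \<otimes> (star A (s \<mu>) \<otimes> Wpow k))"
proof -
  have [simp]: "\<mu> \<in> mor \<Lambda>" "h \<mu> \<in> mor \<Lambda>" using first_color_mor[OF \<mu>] by simp_all
  have "star A (s (h \<mu>)) \<otimes> (s \<mu> \<otimes> (star A (s \<mu>) \<otimes> Wpow k)) = (W \<otimes> star A (s \<mu>)) \<otimes> (s \<mu> \<otimes> (star A (s \<mu>) \<otimes> Wpow k))"
    by (simp only: star_s_W(2)[OF \<mu>])
  also have "\<dots> = (W \<otimes> star A (s \<mu>)) \<otimes> Wpow k" by (simp add: mult_assoc)
  also have "\<dots> = (star A (s \<mu>) \<otimes> W) \<otimes> Wpow k" by (simp only: star_s_W[OF \<mu>])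
  also have "\<dots> = star A (s \<mu>) \<otimes> Wpow (Suc k)" by (simp add: mult_assoc)
  finally show ?thesis by (simp add: mult_assoc)
qed

lemma Wpow_eq_sum: "Wpow k = finsum A (\<lambda>\<mu>. s \<mu> \<otimes> (star A (s \<mu>) \<otimes> Wpow k)) (paths \<Lambda> (a, 0))"
proof -
  have "Wpow k = finsum A (\<lambda>\<mu>. s \<mu> \<otimes> star A (s \<mu>)) (paths \<Lambda> (a, 0)) \<otimes> Wpow k" by (simp add: unit_sum)
  also have "\<dots> = finsum A (\<lambda>\<mu>. s \<mu> \<otimes> star A (s \<mu>) \<otimes> Wpow k) (paths \<Lambda> (a, 0))"
    using first_color_mor by (intro finsum_mult_right) auto
  also have "\<dots> = finsum A (\<lambda>\<mu>. s \<mu> \<otimes> (star A (s \<mu>) \<otimes> Wpow k)) (paths \<Lambda> (a, 0))"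
    using first_color_mor by (intro finsum_cong') (auto simp: mult_assoc)
  finally show ?thesis .
qed

end

locale periodic_branching_representation =
  branching_representation \<Lambda> v A s \<eta> \<B> \<pi> + periodic_ck_algebra \<Lambda> v A s a b h
  for \<Lambda> :: "'a graded_category" and v :: 'a and A :: "'c cstar" (structure) and s :: "'a \<Rightarrow> 'c"
    and \<eta> :: "'x measure" and \<B> :: "('a, 'x) branching"
    and \<pi> :: "'c \<Rightarrow> ('x \<Rightarrow> complex) set \<Rightarrow> ('x \<Rightarrow> complex) set"
    and a b :: nat and h :: "'a \<Rightarrow> 'a"
begin

text \<open>
  The induction starts with \<open>W\<^sup>1\<close>: then the support lies in the range of \<open>\<mu>\<close>, as the definition of the images of \<open>E\<close>
  requires, by the leftmost factor \<open>s \<mu>\<close> of the operator.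
\<close>

lemma supp_cut_Wpow:
  assumes \<mu>: "\<mu> \<in> paths \<Lambda> (a, 0)" and u: "u \<in> carrier H" and E: "supp E u"
  shows "supp {y \<in> path_range \<Lambda> v \<B> \<mu>. ((path_map \<Lambda> v \<B> (h \<mu>) \<circ> path_inv \<Lambda> v \<B> \<mu>) ^^ Suc k) y \<in> E}
    (\<pi> (s \<mu> \<otimes> (star A (s \<mu>) \<otimes> Wpow (Suc k))) u)"
proof (induction k)
  case 0
  have [simp]: "\<mu> \<in> mor \<Lambda>" "h \<mu> \<in> mor \<Lambda>" using first_color_mor[OF \<mu>] by simp_all
  have "s \<mu> \<otimes> (star A (s \<mu>) \<otimes> Wpow (Suc 0)) = s \<mu> \<otimes> star A (s (h \<mu>))" by (simp add: star_s_W[OF \<mu>])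
  then show ?case using supp_transfer[of \<mu> "h \<mu>" u E] u E by simp
next
  case (Suc k)
  let ?\<phi> = "path_map \<Lambda> v \<B> (h \<mu>) \<circ> path_inv \<Lambda> v \<B> \<mu>"
  have [simp]: "\<mu> \<in> mor \<Lambda>" "h \<mu> \<in> mor \<Lambda>" using first_color_mor[OF \<mu>] by simp_all
  let ?S = "{y \<in> path_range \<Lambda> v \<B> \<mu>. (?\<phi> ^^ Suc k) y \<in> E}"
  let ?u = "\<pi> (s \<mu> \<otimes> (star A (s \<mu>) \<otimes> Wpow (Suc k))) u"
  have c: "?u \<in> carrier H" using u by (intro rep_closed) (simp_all del: Wpow_simps)
  have supp: "supp {y \<in> path_range \<Lambda> v \<B> \<mu>. path_map \<Lambda> v \<B> (h \<mu>) (path_inv \<Lambda> v \<B> \<mu> y) \<in> ?S}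
      (\<pi> (s \<mu> \<otimes> star A (s (h \<mu>))) ?u)"
    by (rule supp_transfer[OF _ _ c Suc]) simp_all
  have eq: "\<pi> (s \<mu> \<otimes> star A (s (h \<mu>))) ?u = \<pi> (s \<mu> \<otimes> (star A (s \<mu>) \<otimes> Wpow (Suc (Suc k)))) u"
    unfolding cut_Wpow_Suc[OF \<mu>, of "Suc k"] using u by (intro rep_mult[symmetric]) (simp_all del: Wpow_simps)
  have "{y \<in> path_range \<Lambda> v \<B> \<mu>. path_map \<Lambda> v \<B> (h \<mu>) (path_inv \<Lambda> v \<B> \<mu> y) \<in> ?S}
      \<subseteq> {y \<in> path_range \<Lambda> v \<B> \<mu>. (?\<phi> ^^ Suc (Suc k)) y \<in> E}"
    by (auto simp: funpow_swap1)
  then show ?case using supp unfolding eq by (elim supp_mono[rotated])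
qed

text \<open>
  The vector is the indicator function of a subset \<open>F\<close> of \<open>E\<close> with finite positive measure.  The vector \<open>\<pi> (W\<^sup>k) \<zeta>\<close> is
  the sum of its parts in the ranges of the \<open>\<nu>\<close> of degree \<open>(a, 0)\<close>.  The part for \<open>\<nu> = \<mu>\<close> is supported in the
  image of \<open>E\<close> under the \<open>k\<close>-th power of \<open>f\<^sub>\<mu> \<circ> f\<^sub>h\<^sub>(\<^sub>\<mu>\<^sub>)\<^sup>-\<^sup>1\<close>, which is disjoint from \<open>E\<close>, and the other parts live on ranges that
  are disjoint from that of \<open>\<mu>\<close>.
\<close>

lemma wandering_vector:
  assumes a: "0 < a"
    and \<mu>: "\<mu> \<in> paths \<Lambda> (a, 0)" and E: "E \<in> sets \<eta>" "E \<subseteq> path_range \<Lambda> v \<B> \<mu>" "emeasure \<eta> E \<noteq> 0"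
    and disj: "\<And>n. n \<in> {1..int N} \<Longrightarrow> AE x in \<eta>. x \<notin> transfer_image \<Lambda> v \<B> \<mu> (h \<mu>) n E \<inter> E"
  shows "\<exists>\<zeta> \<in> carrier H. \<pi> (s v) \<zeta> = \<zeta> \<and> 0 < nsq \<zeta> \<and> (\<forall>k \<in> {1..N}. cinner H (\<pi> (Wpow k) \<zeta>) \<zeta> = 0)"
proof -
  obtain F where F: "F \<in> sets \<eta>" "F \<subseteq> E" "emeasure \<eta> F \<noteq> 0" "emeasure \<eta> F < \<infinity>"
    using finite_positive_subset[OF E(1,3)] .
  define \<zeta> where "\<zeta> = l2_class \<eta> (indicator F)"
  note ind = indicator_class[OF F(1,4)]
  have \<zeta>: "\<zeta> \<in> carrier H" unfolding \<zeta>_def by (rule L2_class_closed[OF ind(1)])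
  have "0 < measure \<eta> F" using F(3,4) by (simp add: measure_def enn2real_positive_iff zero_less_iff_neq_zero)
  then have pos: "0 < nsq \<zeta>" unfolding \<zeta>_def ind(2) .
  have fix_\<zeta>: "\<pi> (s v) \<zeta> = \<zeta>"
  proof -
    have "AE x in \<eta>. indicator D x * indicator F x = (indicator F x :: complex)"
      using path_range_subset_D[OF a \<mu>] by eventually_elim (use F(2) E(2) in \<open>auto simp: indicator_def\<close>)
    then show ?thesis unfolding \<zeta>_def rep_vertex[OF ind(1)] by (rule l2_class_eqI)
  qed
  have suppF: "supp F \<zeta>" unfolding \<zeta>_def by (rule ind(3))
  then have suppE: "supp E \<zeta>" using F(2) by (rule supp_mono)
  have "cinner H (\<pi> (Wpow k) \<zeta>) \<zeta> = 0" if k: "k \<in> {1..N}" for k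
  proof -
    obtain j where j: "k = Suc j" using k by (cases k) auto
    have "cinner H (\<pi> (Wpow k) \<zeta>) \<zeta>
        = (\<Sum>\<nu>\<in>paths \<Lambda> (a, 0). cinner H (\<pi> (s \<nu> \<otimes> (star A (s \<nu>) \<otimes> Wpow k)) \<zeta>) \<zeta>)"
      by (subst Wpow_eq_sum) (use first_color_mor \<zeta> in \<open>auto intro!: cinner_rep_finsum\<close>)
    also have "\<dots> = 0"
    proof (rule sum.neutral, rule ballI)
      fix \<nu> assume \<nu>: "\<nu> \<in> paths \<Lambda> (a, 0)"
      have \<nu>m [simp]: "\<nu> \<in> mor \<Lambda>" using first_color_mor[OF \<nu>] by simp
      let ?u = "\<pi> (s \<nu> \<otimes> (star A (s \<nu>) \<otimes> Wpow k)) \<zeta>"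
      have u: "?u \<in> carrier H" using \<zeta> by simp
      show "cinner H ?u \<zeta> = 0"
      proof (cases "\<nu> = \<mu>")
        case False
        have "supp (path_range \<Lambda> v \<B> \<nu>) ?u"
          using supp_path_range[OF \<nu>m, of "\<pi> (star A (s \<nu>) \<otimes> Wpow k) \<zeta>"] \<zeta> by (simp add: rep_mult[of "s \<nu>"])
        moreover have "AE x in \<eta>. \<not> (x \<in> path_range \<Lambda> v \<B> \<nu> \<and> x \<in> E)"
          using path_range_disjoint[OF \<nu> \<mu> False] by eventually_elim (use E(2) in auto)
        ultimately show ?thesis using u \<zeta> suppE by (intro supp_disjoint)
      next
        case True
        have img: "transfer_image \<Lambda> v \<B> \<mu> (h \<mu>) (int k) E
            = {y \<in> path_range \<Lambda> v \<B> \<mu>. ((path_map \<Lambda> v \<B> (h \<mu>) \<circ> path_inv \<Lambda> v \<B> \<mu>) ^^ k) y \<in> E}"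
          by (simp add: transfer_image_def transfer_power_def j del: funpow.simps of_nat_Suc)
        have "supp (transfer_image \<Lambda> v \<B> \<mu> (h \<mu>) (int k) E) ?u"
          unfolding img True unfolding j by (rule supp_cut_Wpow[OF \<mu> \<zeta> suppE])
        moreover have "AE x in \<eta>. \<not> (x \<in> transfer_image \<Lambda> v \<B> \<mu> (h \<mu>) (int k) E \<and> x \<in> E)"
          using disj[of "int k"] k by auto
        ultimately show ?thesis using u \<zeta> suppE by (intro supp_disjoint)
      qed
    qed
    finally show ?thesis .
  qed
  then show ?thesis using \<zeta> pos fix_\<zeta> by blast
qed

end

section \<open>Faithfulness\<close>

theorem theorem5p5:
  fixes \<Lambda> :: "'a graded_category" and v :: 'a and a b :: nat and h :: "'a \<Rightarrow> 'a"
    and \<eta> :: "'x measure" and \<B> :: "('a, 'x) branching"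
    and A :: "'c cstar" and s :: "'a \<Rightarrow> 'c"
    and \<pi> :: "'c \<Rightarrow> ('x \<Rightarrow> complex) set \<Rightarrow> ('x \<Rightarrow> complex) set"
  assumes "two_graph \<Lambda>" and "paths \<Lambda> (0, 0) = {v}" and "periodic \<Lambda>"
    and "finite (paths \<Lambda> (1, 0))" and "2 \<le> card (paths \<Lambda> (1, 0))"
    and "finite (paths \<Lambda> (0, 1))" and "2 \<le> card (paths \<Lambda> (0, 1))"
    and "0 < a" and "0 < b" and "Per \<Lambda> = range (\<lambda>k::int. (k * int a, - k * int b))"
    and "bij_betw h (paths \<Lambda> (a, 0)) (paths \<Lambda> (0, b))"
    and "\<And>\<mu> \<nu>. \<lbrakk>\<mu> \<in> paths \<Lambda> (a, 0); \<nu> \<in> paths \<Lambda> (0, b)\<rbrakk>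
           \<Longrightarrow> cmp \<Lambda> \<mu> \<nu> = cmp \<Lambda> (h \<mu>) (inv_into (paths \<Lambda> (a, 0)) h \<nu>)"
    and "sigma_finite_measure \<eta>" and "branching_system \<Lambda> \<eta> \<B>" and "emeasure \<eta> (bdom \<B>) \<noteq> 0"
    and "universal_graph_algebra \<Lambda> v A s" and "induced_representation \<Lambda> v \<eta> \<B> A s \<pi>"
    and "\<And>F::int set. \<lbrakk>finite F; 0 \<notin> F\<rbrakk> \<Longrightarrow>
           \<exists>\<mu> \<in> paths \<Lambda> (a, 0). \<exists>E \<in> sets \<eta>. E \<subseteq> path_range \<Lambda> v \<B> \<mu> \<and> emeasure \<eta> E \<noteq> 0 \<and>
             (\<forall>n \<in> F. AE x in \<eta>. x \<notin> transfer_image \<Lambda> v \<B> \<mu> (h \<mu>) n E \<inter> E)"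
  shows "inj_on \<pi> (carrier A)"
proof -
  have A: "c_star_algebra A" "cuntz_krieger_family \<Lambda> v A s"
    and gen: "\<And>S. \<lbrakk>closed_star_subalgebra A S; s ` mor \<Lambda> \<subseteq> S\<rbrakk> \<Longrightarrow> S = carrier A"
    using assms(16) unfolding universal_graph_algebra_def by blast+
  have ne: "paths \<Lambda> (1, 0) \<noteq> {}" "paths \<Lambda> (0, 1) \<noteq> {}" using assms(5,7) by auto
  interpret G: single_vertex_graph \<Lambda> v
    by (intro single_vertex_graph.intro assms(1) single_vertex_graph_axioms.intro assms(2,4,6) ne)
  interpret C: ck_algebra \<Lambda> v A s
    by (intro ck_algebra.intro G.single_vertex_graph_axioms A(1) ck_algebra_axioms.intro A(2))
  interpret B: branching_representation \<Lambda> v A s \<eta> \<B> \<pi>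
    by (intro branching_representation.intro C.ck_algebra_axioms branching_representation_axioms.intro assms(13,14,17))
  interpret P: periodic_ck_algebra \<Lambda> v A s a b h
    by (intro periodic_ck_algebra.intro C.ck_algebra_axioms periodic_ck_algebra_axioms.intro assms(11,12))
  interpret PB: periodic_branching_representation \<Lambda> v A s \<eta> \<B> \<pi> a b h ..
  interpret PR: periodic_ck_representation \<Lambda> v A s a b h "L2 \<eta>" \<pi>
  proof
    fix N
    obtain \<mu> E where "\<mu> \<in> paths \<Lambda> (a, 0)" "E \<in> sets \<eta>" "E \<subseteq> path_range \<Lambda> v \<B> \<mu>" "emeasure \<eta> E \<noteq> 0"
      "\<And>n. n \<in> {1..int N} \<Longrightarrow> AE x in \<eta>. x \<notin> transfer_image \<Lambda> v \<B> \<mu> (h \<mu>) n E \<inter> E"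
      using assms(18)[of "{1..int N}"] by auto
    then show "\<exists>\<zeta> \<in> carrier (L2 \<eta>). \<pi> (s v) \<zeta> = \<zeta> \<and> 0 < B.nsq \<zeta> \<and>
      (\<forall>k \<in> {1..N}. cinner (L2 \<eta>) (\<pi> (P.Wpow k) \<zeta>) \<zeta> = 0)"
      by (rule PB.wandering_vector[OF assms(8)])
  qed (use assms(8,9,10) in auto)
  interpret U: ck_representation \<Lambda> v A s "L2 \<eta>" \<pi>
    by unfold_locales (use gen PR.separating_vector in auto)
  show ?thesis
  proof (rule inj_onI)
    fix x y assume x: "x \<in> carrier A" and y: "y \<in> carrier A" and eq: "\<pi> x = \<pi> y"
    have "\<pi> (x \<ominus>\<^bsub>A\<^esub> y) \<xi> = \<pi> \<zero>\<^bsub>A\<^esub> \<xi>" if \<xi>: "\<xi> \<in> carrier (L2 \<eta>)" for \<xi>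
    proof -
      have "\<pi> (x \<ominus>\<^bsub>A\<^esub> y) \<xi> = \<pi> (y \<ominus>\<^bsub>A\<^esub> y) \<xi>"
        using x y \<xi> by (simp add: C.minus_eq_smult B.rep_add B.rep_smult eq del: C.minus_self)
      then show ?thesis using y by simp
    qed
    then have "x \<ominus>\<^bsub>A\<^esub> y = \<zero>\<^bsub>A\<^esub>" using x y by (intro U.kernel_trivial) auto
    then show "x = y" using x y by (simp add: C.minus_eq_zero_iff)
  qed
qed

end
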